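(* Let $(\mathcal V,d,\mu)$ be the weighted homogeneous tree of order $q+1$, $H^1(\mu)$ the atomic Hardy space on it, $\mathcal L$ the Laplacian and $\nabla$ the gradient on it, as defined in the context. Then the first order Riesz transform $\nabla\mathcal L^{-1/2}$ extends to a bounded operator from $H^1(\mu)$ to $L^1(\mu)$.
   Context: Weighted tree. Fix an integer $q\ge 2$. $\mathcal V$ is the vertex set of the infinite homogeneous tree of order $q+1$, i.e. the connected acyclic graph in which every vertex has exactly $q+1$ neighbours; $d$ is the graph distance. Fix a doubly-infinite geodesic $g\subset\mathcal V$ (a connected subset in which every element has exactly two neighbours belonging to $g$ and which contains the shortest path between any two of its elements) and a map $N:g\to\mathbb Z$ with $|N(x)-N(y)|=d(x,y)$ for all $x,y\in g$. The level function $\ell:\mathcal V\to\mathbb Z$ is $\ell(x)=N(x')-d(x,x')$, where $x'$ is the unique vertex of $g$ closest to $x$. The measure $\mu$ on $\mathcal V$ is $\int_{\mathcal V}f\,d\mu=\sum_{x\in\mathcal V}f(x)q^{\ell(x)}$. A vertex $x$ lies below a vertex $y$ if $\ell(x)=\ell(y)-d(x,y)$. Calderón–Zygmund sets. An admissible trapezoid is a set $R\subset\mathcal V$ that is either a single vertex $R=\{x_R\}$ (degenerate case; put $h(R)=1$), or of the form $R=\{x\in\mathcal V: x\text{ lies below }x_R,\ h\le \ell(x_R)-\ell(x)<2h\}$ for some $x_R\in\mathcal V$ and some integer $h\ge1$ (put $h(R)=h$). The envelope of $R$ is $\tilde R=\{x\in\mathcal V: x\text{ lies below }x_R,\ \tfrac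 h2\le \ell(x_R)-\ell(x)<4h\}$ in the nondegenerate case, and $\tilde R=R$ in the degenerate case. A Calderón–Zygmund set is the envelope of an admissible trapezoid. Hardy space. A $(1,\infty)$-atom is a function $a:\mathcal V\to\mathbb C$ such that: $a$ is supported in a Calderón–Zygmund set $\tilde R$; $\|a\|_{L^\infty}\le\mu(\tilde R)^{-1}$; and $\int_{\mathcal V}a\,d\mu=0$. $H^1(\mu)=H^{1,\infty}(\mu)$ is the space of all $h\in L^1(\mu)$ of the form $h=\sum_j\lambda_ja_j$ (convergence in $L^1(\mu)$) with $a_j$ $(1,\infty)$-atoms and $\lambda_j\in\mathbb C$, $\sum_j|\lambda_j|<\infty$; $\|h\|_{H^1}$ is the infimum of $\sum_j|\lambda_j|$ over all such decompositions. Operators. For $f:\mathcal V\to\mathbb C$, $$\mathcal Lf(x)=f(x)-\frac1{2\sqrt q}\sum_{y\in\mathcal V:\,d(x,y)=1}q^{\frac{\ell(y)-\ell(x)}2}f(y),\qquad (\nabla f)(x)=\sum_{y\in\mathcal V:\,d(x,y)=1}|f(y)-f(x)|,\qquad x\in\mathcal V.$$ $\mathcal L$ is bounded and self-adjoint on $L^2(\mu)$ with spectrum $[0,2]$, and $\mathcal L^{-1/2}$ is defined by the spectral theorem as a (possibly unbounded) operator on $L^2(\mu)$, whose domain contains the finitely supported functions. The Riesz transform is the sublinear operator $f\mapsto\nabla(\mathcal L^{-1/2}f)$, initially defined on finitely supported functions; "bounded" means $\|\nabla\mathcal L^{-1/2}f\|_{L^1(\mu)}\le C\|f\|_{H^1}$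 with $C$ independent of $f$. *)

theory Defs
  imports "HOL-Analysis.Analysis"
begin

section \<open>Homogeneous trees and the level function\<close>

text \<open>A graph is given by its adjacency relation; the vertex set is the whole type.\<close>

definition graph_dist :: "('v \<Rightarrow> 'v \<Rightarrow> bool) \<Rightarrow> 'v \<Rightarrow> 'v \<Rightarrow> nat" where
  "graph_dist adj x y = (LEAST n. (adj ^^ n) x y)"

definition is_cycle :: "('v \<Rightarrow> 'v \<Rightarrow> bool) \<Rightarrow> 'v list \<Rightarrow> bool" where
  "is_cycle adj xs \<longleftrightarrow>
     3 \<le> length xs \<and> distinct xs \<and> successively adj xs \<and> adj (last xs) (hd xs)"

text \<open>The infinite homogeneous tree in which every vertex has \<open>q + 1\<close> neighbours.\<close>

definition homogeneous_tree :: "nat \<Rightarrow> ('v \<Rightarrow> 'v \<Rightarrow> bool) \<Rightarrow> bool" where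
  "homogeneous_tree q adj \<longleftrightarrow>
     symp adj \<and> irreflp adj \<and>
     (\<forall>x y. adj\<^sup>*\<^sup>* x y) \<and>
     (\<nexists>xs. is_cycle adj xs) \<and>
     (\<forall>x. card {y. adj x y} = q + 1)"

definition doubly_infinite_geodesic :: "('v \<Rightarrow> 'v \<Rightarrow> bool) \<Rightarrow> 'v set \<Rightarrow> bool" where
  "doubly_infinite_geodesic adj g \<longleftrightarrow>
     g \<noteq> {} \<and>
     (\<forall>x\<in>g. \<forall>y\<in>g. (\<lambda>u v. u \<in> g \<and> v \<in> g \<and> adj u v)\<^sup>*\<^sup>* x y) \<and>
     (\<forall>x\<in>g. card {y \<in> g. adj x y} = 2) \<and>
     (\<forall>xs. xs \<noteq> [] \<longrightarrow> successively adj xs \<longrightarrow> hd xs \<in> g \<longrightarrow> last xs \<in> g \<longrightarrow>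
        length xs = graph_dist adj (hd xs) (last xs) + 1 \<longrightarrow> set xs \<subseteq> g)"

definition closest_in :: "('v \<Rightarrow> 'v \<Rightarrow> bool) \<Rightarrow> 'v set \<Rightarrow> 'v \<Rightarrow> 'v" where
  "closest_in adj g x =
     (THE x'. x' \<in> g \<and> (\<forall>y\<in>g. graph_dist adj x x' \<le> graph_dist adj x y))"

definition level :: "('v \<Rightarrow> 'v \<Rightarrow> bool) \<Rightarrow> 'v set \<Rightarrow> ('v \<Rightarrow> int) \<Rightarrow> 'v \<Rightarrow> int" where
  "level adj g N x = N (closest_in adj g x) - int (graph_dist adj x (closest_in adj g x))"

text \<open>In the following \<open>l\<close> stands for the level function.\<close>

definition level_measure :: "nat \<Rightarrow> ('v \<Rightarrow> int) \<Rightarrow> 'v measure" where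
  "level_measure q l = point_measure UNIV (\<lambda>x. ennreal (real q powi l x))"

definition lies_below :: "('v \<Rightarrow> 'v \<Rightarrow> bool) \<Rightarrow> ('v \<Rightarrow> int) \<Rightarrow> 'v \<Rightarrow> 'v \<Rightarrow> bool" where
  "lies_below adj l x y \<longleftrightarrow> l x = l y - int (graph_dist adj x y)"


section \<open>The atomic Hardy space\<close>

text \<open>\<open>trapezoid_envelope adj l R S\<close>: \<open>R\<close> is an admissible trapezoid with envelope \<open>S\<close>.\<close>

inductive trapezoid_envelope ::
  "('v \<Rightarrow> 'v \<Rightarrow> bool) \<Rightarrow> ('v \<Rightarrow> int) \<Rightarrow> 'v set \<Rightarrow> 'v set \<Rightarrow> bool"
  for adj :: "'v \<Rightarrow> 'v \<Rightarrow> bool" and l :: "'v \<Rightarrow> int" where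
  degenerate: "trapezoid_envelope adj l {r} {r}"
| nondegenerate: "1 \<le> h \<Longrightarrow>
    trapezoid_envelope adj l
      {x. lies_below adj l x r \<and> h \<le> l r - l x \<and> l r - l x < 2 * h}
      {x. lies_below adj l x r \<and>
          real_of_int h / 2 \<le> real_of_int (l r - l x) \<and> l r - l x < 4 * h}"

definition CZ_set :: "('v \<Rightarrow> 'v \<Rightarrow> bool) \<Rightarrow> ('v \<Rightarrow> int) \<Rightarrow> 'v set \<Rightarrow> bool" where
  "CZ_set adj l S \<longleftrightarrow> (\<exists>R. trapezoid_envelope adj l R S)"

text \<open>All points have positive mass, so the essential supremum is a supremum.\<close>

definition is_atom ::
  "nat \<Rightarrow> ('v \<Rightarrow> 'v \<Rightarrow> bool) \<Rightarrow> ('v \<Rightarrow> int) \<Rightarrow> ('v \<Rightarrow> complex) \<Rightarrow> bool" where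
  "is_atom q adj l a \<longleftrightarrow>
     (\<exists>S. CZ_set adj l S \<and>
          (\<forall>x. x \<notin> S \<longrightarrow> a x = 0) \<and>
          (\<forall>x. cmod (a x) \<le> 1 / measure (level_measure q l) S)) \<and>
     (\<integral>x. a x \<partial>level_measure q l) = 0"

definition atomic_decomposition ::
  "nat \<Rightarrow> ('v \<Rightarrow> 'v \<Rightarrow> bool) \<Rightarrow> ('v \<Rightarrow> int) \<Rightarrow> ('v \<Rightarrow> complex) \<Rightarrow>
   (nat \<Rightarrow> complex) \<Rightarrow> (nat \<Rightarrow> 'v \<Rightarrow> complex) \<Rightarrow> bool" where
  "atomic_decomposition q adj l h c a \<longleftrightarrow>
     (\<forall>j. is_atom q adj l (a j)) \<and>
     summable (\<lambda>j. cmod (c j)) \<and>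
     (\<lambda>n. \<integral>x. cmod (h x - (\<Sum>j<n. c j * a j x)) \<partial>level_measure q l) \<longlonglongrightarrow> 0"

definition hardy_space ::
  "nat \<Rightarrow> ('v \<Rightarrow> 'v \<Rightarrow> bool) \<Rightarrow> ('v \<Rightarrow> int) \<Rightarrow> ('v \<Rightarrow> complex) set" where
  "hardy_space q adj l =
     {h. integrable (level_measure q l) h \<and> (\<exists>c a. atomic_decomposition q adj l h c a)}"

definition hardy_norm ::
  "nat \<Rightarrow> ('v \<Rightarrow> 'v \<Rightarrow> bool) \<Rightarrow> ('v \<Rightarrow> int) \<Rightarrow> ('v \<Rightarrow> complex) \<Rightarrow> real" where
  "hardy_norm q adj l h =
     Inf {\<Sum>j. cmod (c j) | c. \<exists>a. atomic_decomposition q adj l h c a}"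


section \<open>Inverse square roots of positive operators\<close>

text \<open>
  Operators act on functions, not on equivalence classes modulo null sets; the definitions below
  are meant for measures \<open>M\<close> without nonempty null sets, such as \<^term>\<open>level_measure q l\<close>.
\<close>

definition L2_space :: "'v measure \<Rightarrow> ('v \<Rightarrow> complex) set" where
  "L2_space M = {f \<in> borel_measurable M. integrable M (\<lambda>x. (cmod (f x))\<^sup>2)}"

definition L2_inner :: "'v measure \<Rightarrow> ('v \<Rightarrow> complex) \<Rightarrow> ('v \<Rightarrow> complex) \<Rightarrow> complex" where
  "L2_inner M f g = (\<integral>x. f x * cnj (g x) \<partial>M)"

text \<open>
  The spectral measure of a bounded self-adjoint operator \<open>T\<close> at the vector \<open>f\<close>, i.e. the measure
  \<open>B \<mapsto> \<langle>E(B) f, f\<rangle>\<close> where \<open>E\<close> is the resolution of the identity of \<open>T\<close>. It is the only compactly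
  supported finite Borel measure representing \<open>p \<mapsto> \<langle>p(T) f, f\<rangle>\<close> on polynomials; by the spectral
  theorem it exists.
\<close>

definition spectral_measure ::
  "'v measure \<Rightarrow> (('v \<Rightarrow> complex) \<Rightarrow> 'v \<Rightarrow> complex) \<Rightarrow> ('v \<Rightarrow> complex) \<Rightarrow> real measure" where
  "spectral_measure M T f =
     (SOME \<nu>. finite_measure \<nu> \<and> sets \<nu> = sets borel \<and>
        (\<exists>K. compact K \<and> emeasure \<nu> (- K) = 0) \<and>
        (\<forall>n. L2_inner M ((T ^^ n) f) f = complex_of_real (\<integral>t. t ^ n \<partial>\<nu>)))"

text \<open>
  For positive \<open>T\<close>, the domain of \<open>T\<^sup>-\<^sup>1\<^sup>/\<^sup>2\<close> consists of the \<open>f\<close> with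
  \<open>\<integral> \<bar>t\<^sup>-\<^sup>1\<^sup>/\<^sup>2\<bar>\<^sup>2 d\<langle>E(t) f, f\<rangle> < \<infinity>\<close>. Here \<^term>\<open>inverse (ennreal t)\<close> is infinite for \<open>t \<le> 0\<close>,
  so spectral measures of vectors in the domain do not charge \<open>0\<close>.
\<close>

definition inv_sqrt_domain ::
  "'v measure \<Rightarrow> (('v \<Rightarrow> complex) \<Rightarrow> 'v \<Rightarrow> complex) \<Rightarrow> ('v \<Rightarrow> complex) set" where
  "inv_sqrt_domain M T =
     {f \<in> L2_space M. (\<integral>\<^sup>+t. inverse (ennreal t) \<partial>spectral_measure M T f) < \<infinity>}"

text \<open>
  \<open>u = T\<^sup>-\<^sup>1\<^sup>/\<^sup>2 f\<close> iff \<open>\<langle>u, g\<rangle> = \<integral> t\<^sup>-\<^sup>1\<^sup>/\<^sup>2 d\<langle>E(t) f, g\<rangle>\<close> for all \<open>g\<close> in the (dense) domain; the complex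
  measure on the right is expressed by polarization. The operator is only meaningful for \<open>f\<close> in the
  domain.
\<close>

definition inv_sqrt_op ::
  "'v measure \<Rightarrow> (('v \<Rightarrow> complex) \<Rightarrow> 'v \<Rightarrow> complex) \<Rightarrow> ('v \<Rightarrow> complex) \<Rightarrow> 'v \<Rightarrow> complex" where
  "inv_sqrt_op M T f =
     (THE u. u \<in> L2_space M \<and>
        (\<forall>g\<in>inv_sqrt_domain M T.
           L2_inner M u g =
             (\<Sum>k<4. \<i> ^ k * complex_of_real
               (\<integral>t. t powr (- 1 / 2) \<partial>spectral_measure M T (\<lambda>x. f x + \<i> ^ k * g x))) / 4))"


section \<open>Laplacian, gradient and Riesz transform\<close>

definition laplacian ::
  "nat \<Rightarrow> ('v \<Rightarrow> 'v \<Rightarrow> bool) \<Rightarrow> ('v \<Rightarrow> int) \<Rightarrow> ('v \<Rightarrow> complex) \<Rightarrow> 'v \<Rightarrow> complex" where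
  "laplacian q adj l f x =
     f x - complex_of_real (1 / (2 * sqrt (real q))) *
       (\<Sum>y | graph_dist adj x y = 1.
          complex_of_real (real q powr (real_of_int (l y - l x) / 2)) * f y)"

definition gradient :: "('v \<Rightarrow> 'v \<Rightarrow> bool) \<Rightarrow> ('v \<Rightarrow> complex) \<Rightarrow> 'v \<Rightarrow> real" where
  "gradient adj f x = (\<Sum>y | graph_dist adj x y = 1. cmod (f y - f x))"

definition riesz_transform ::
  "nat \<Rightarrow> ('v \<Rightarrow> 'v \<Rightarrow> bool) \<Rightarrow> ('v \<Rightarrow> int) \<Rightarrow> ('v \<Rightarrow> complex) \<Rightarrow> 'v \<Rightarrow> real" where
  "riesz_transform q adj l f =
     gradient adj (inv_sqrt_op (level_measure q l) (laplacian q adj l) f)"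

text \<open>
  A bounded sublinear operator from \<open>H\<^sup>1(\<mu>)\<close> to \<open>L\<^sup>1(\<mu>)\<close>. Sublinearity yields
  \<open>\<bar>Z f - Z h\<bar> \<le> Z (f - h)\<close>, so such an operator is continuous and determined by its values on
  the finitely supported functions in \<open>H\<^sup>1(\<mu>)\<close>, which are dense.
\<close>

definition bounded_sublinear_H1_L1 ::
  "nat \<Rightarrow> ('v \<Rightarrow> 'v \<Rightarrow> bool) \<Rightarrow> ('v \<Rightarrow> int) \<Rightarrow> (('v \<Rightarrow> complex) \<Rightarrow> 'v \<Rightarrow> real) \<Rightarrow> bool" where
  "bounded_sublinear_H1_L1 q adj l Z \<longleftrightarrow>
     (\<forall>f\<in>hardy_space q adj l. \<forall>h\<in>hardy_space q adj l. \<forall>x.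
        Z (\<lambda>y. f y + h y) x \<le> Z f x + Z h x) \<and>
     (\<forall>c. \<forall>f\<in>hardy_space q adj l. \<forall>x. Z (\<lambda>y. c * f y) x = cmod c * Z f x) \<and>
     (\<exists>C. \<forall>f\<in>hardy_space q adj l.
        integrable (level_measure q l) (Z f) \<and>
        (\<integral>x. \<bar>Z f x\<bar> \<partial>level_measure q l) \<le> C * hardy_norm q adj l f)"

end

theory Submission
  imports Defs "HOL-Probability.Probability"
begin

text \<open>
  The level function gives every vertex \<open>x\<close> a parent \<open>par x\<close> one level higher, and \<open>q\<close> children. Let \<open>A f = f \<circ> par\<close>,
  and let \<open>avg f\<close> be the average of \<open>f\<close> over the children. The measure is invariant under \<open>par\<close>; so \<open>A\<close> is an
  isometry of \<open>L\<^sup>1\<close> and \<open>L\<^sup>2\<close>, \<open>avg\<close> is its adjoint, \<open>avg A = 1\<close>, and the Laplacian is \<open>L = 1 - (A + avg)/2\<close>. As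
  for every isometry, \<open>U\<^sub>m((A + avg)/2) = \<Sum>i\<le>m. A\<^sup>i avg\<^sup>m\<^sup>-\<^sup>i\<close> for the Chebyshev polynomials \<open>U\<^sub>m\<close> of the second kind.
  Expanding \<open>t\<^sup>-\<^sup>1\<^sup>/\<^sup>2\<close> in the polynomials \<open>U\<^sub>m(1 - t)\<close> therefore yields the closed form
  \<open>L\<^sup>-\<^sup>1\<^sup>/\<^sup>2 = \<Sum>i j. kappa (i + j) A\<^sup>i avg\<^sup>j\<close> with \<open>kappa m = (\<surd>2/\<pi>) (1/(m + 1/2) + 1/(m + 3/2))\<close>, called \<open>K\<close> below.

  Up to the factor \<open>1 + q\<close>, the \<open>L\<^sup>1\<close> norm of the gradient of \<open>u\<close> is that of \<open>A u - u\<close> (\<open>nn_gradient\<close>), and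
  \<open>(A - 1) K\<close> has a kernel built from \<open>kappa\<close> and its differences (\<open>K_gradient\<close>). For an atom supported at
  depths between \<open>h/2\<close> and \<open>4 h\<close> below \<open>r\<close>, three regions are considered. Close to the support, the identity
  \<open>\<parallel>(A - 1) u\<parallel>\<^sup>2 = 2 \<langle>L u, u\<rangle>\<close> gives an \<open>L\<^sup>2\<close> bound (\<open>K_energy\<close>, \<open>local_part\<close>). Far below \<open>r\<close>, the kernel itself is
  summable (\<open>sum_below\<close>). Along the ancestors of \<open>r\<close>, the vanishing mean turns the kernel into differences,
  and all sums telescope to the sum of \<open>kappa\<close> over \<open>[h/2, 4 h]\<close>, which does not depend much on \<open>h\<close>
  (\<open>sum_above\<close>). Since \<open>K f x\<close> converges absolutely for every integrable \<open>f\<close> (\<open>kernel_op_summable\<close>), the uniform bound on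
  atoms passes to the Hardy space (\<open>Z_decomposition\<close>).

  It remains to identify \<open>K\<close> with the inverse square root defined through spectral measures
  (\<open>inv_sqrt_lap\<close>). Spectral measures exist by the Hausdorff moment problem (\<open>hausdorff_moment\<close>,
  \<open>spectral_measure_ex\<close>). The partial sums \<open>p\<^sub>N\<close> of the binomial series of \<open>t\<^sup>-\<^sup>1\<^sup>/\<^sup>2\<close> in powers of \<open>1 - t/2\<close> increase to
  \<open>t\<^sup>-\<^sup>1\<^sup>/\<^sup>2\<close> on \<open>(0, 2]\<close>. So \<open>p\<^sub>N(L) f\<close> converges weakly to \<open>L\<^sup>-\<^sup>1\<^sup>/\<^sup>2 f\<close> for \<open>f\<close> in the domain (\<open>inv_sqrt_op_eq\<close>), while
  its Chebyshev coefficients tend to \<open>kappa\<close>, so that \<open>p\<^sub>N(L) f\<close> converges pointwise to \<open>K f\<close>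
  (\<open>inv_sqrt_poly_tendsto_K\<close>). Point masses belong to the domain because they have the form \<open>v - avg v\<close> with \<open>v\<close>
  in \<open>L\<^sup>2\<close> (\<open>point_dom\<close>).
\<close>

section \<open>Reduced walks in a tree\<close>

definition reduced :: "'v list \<Rightarrow> bool" where
  "reduced xs \<longleftrightarrow> (\<forall>i. i + 2 < length xs \<longrightarrow> xs ! i \<noteq> xs ! (i + 2))"

locale forest =
  fixes adj :: "'v \<Rightarrow> 'v \<Rightarrow> bool"
  assumes sym: "adj x y \<Longrightarrow> adj y x"
    and irrefl: "\<not> adj x x"
    and acyclic: "\<not> is_cycle adj xs"
begin

definition walk :: "'v list \<Rightarrow> bool" where
  "walk xs \<longleftrightarrow> xs \<noteq> [] \<and> successively adj xs \<and> reduced xs"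

text \<open>In a forest a walk without backtracking never meets itself: the stretch between two visits of a vertex
  that are as close together as possible would be a cycle, of length at least three.\<close>

lemma reduced_distinct:
  assumes "successively adj xs" "reduced xs"
  shows "distinct xs"
proof (rule ccontr)
  assume nd: "\<not> distinct xs"
  define Q where "Q d \<longleftrightarrow> (\<exists>i. 0 < d \<and> i + d < length xs \<and> xs ! i = xs ! (i + d))" for d
  from nd obtain i j where ij: "i < length xs" "j < length xs" "i \<noteq> j" "xs ! i = xs ! j"
    by (auto simp: distinct_conv_nth)
  have "Q (max i j - min i j)"
    unfolding Q_def using ij
    by (cases "i < j") (auto intro!: exI[of _ "min i j"] simp: max_def min_def)
  then have ex: "\<exists>d. Q d" by blast
  define d where "d = (LEAST d. Q d)"
  have Qd: "Q d" and least: "\<And>e. e < d \<Longrightarrow> \<not> Q e"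
    unfolding d_def using ex by (auto intro: LeastI_ex dest: not_less_Least)
  from Qd obtain k where k: "0 < d" "k + d < length xs" "xs ! k = xs ! (k + d)"
    unfolding Q_def by blast
  have succ: "adj (xs ! n) (xs ! Suc n)" if "Suc n < length xs" for n
    using assms(1) that by (simp add: successively_conv_nth)
  have "d \<noteq> 1"
    using succ[of k] k irrefl by auto
  moreover have "d \<noteq> 2"
    using assms(2) k unfolding reduced_def by auto
  ultimately have d3: "3 \<le> d" using k by linarith
  define ys where "ys = take d (drop k xs)"
  have len: "length ys = d" unfolding ys_def using k by simp
  have nth: "ys ! n = xs ! (k + n)" if "n < d" for n
    unfolding ys_def using that k by simp
  have "distinct ys"
  proof (rule ccontr)
    assume "\<not> distinct ys"
    then obtain a b where ab: "a < b" "b < d" "ys ! a = ys ! b"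
      unfolding distinct_conv_nth len by (metis linorder_neqE_nat)
    then have "Q (b - a)"
      unfolding Q_def using k nth[of a] nth[of b] by (auto intro!: exI[of _ "k + a"])
    moreover have "b - a < d" using ab by simp
    ultimately show False using least by blast
  qed
  moreover have "successively adj ys"
    unfolding successively_conv_nth len using nth succ k by auto
  moreover have "adj (last ys) (hd ys)"
  proof -
    have "ys \<noteq> []" using len d3 by auto
    then have "last ys = xs ! (k + (d - 1))" "hd ys = xs ! k"
      using nth[of "d - 1"] nth[of 0] d3 len by (auto simp: last_conv_nth hd_conv_nth)
    then show ?thesis using succ[of "k + (d - 1)"] k d3 by auto
  qed
  ultimately have "is_cycle adj ys" unfolding is_cycle_def len using d3 by simp
  with acyclic show False by blast
qed

lemma walk_Cons:
  assumes "walk xs" "adj z (hd xs)" "length xs \<ge> 2 \<longrightarrow> z \<noteq> xs ! 1"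
  shows "walk (z # xs)"
  unfolding walk_def reduced_def
proof (intro conjI allI impI)
  show "successively adj (z # xs)"
    using assms by (cases xs) (auto simp: walk_def)
  fix i assume i: "i + 2 < length (z # xs)"
  show "(z # xs) ! i \<noteq> (z # xs) ! (i + 2)"
  proof (cases i)
    case 0 then show ?thesis using assms i by auto
  next
    case (Suc j) then show ?thesis using assms(1) i by (auto simp: walk_def reduced_def)
  qed
qed simp

lemma walk_tl: "walk (z # xs) \<Longrightarrow> xs \<noteq> [] \<Longrightarrow> walk xs"
  unfolding walk_def reduced_def by (fastforce simp: successively_Cons)

lemma walk_second:
  assumes "walk (z # xs)" "xs \<noteq> []"
  shows "adj z (hd xs)" "length xs \<ge> 2 \<longrightarrow> z \<noteq> xs ! 1"
  using assms unfolding walk_def reduced_def by (cases xs, auto dest: spec[of _ 0])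

text \<open>Gluing: no backtracking may occur at the joint.\<close>

lemma walk_append:
  assumes "walk (xs @ [a])" "walk (a # ys)" "xs \<noteq> [] \<Longrightarrow> ys \<noteq> [] \<Longrightarrow> last xs \<noteq> hd ys"
  shows "walk (xs @ a # ys)"
  using assms
proof (induction xs)
  case Nil then show ?case by simp
next
  case (Cons z xs)
  have w: "walk (xs @ a # ys)"
  proof (cases "xs = []")
    case False
    then show ?thesis using Cons by (auto dest: walk_tl)
  qed (use Cons.prems in simp)
  have *: "adj z (hd (xs @ [a]))" "length (xs @ [a]) \<ge> 2 \<longrightarrow> z \<noteq> (xs @ [a]) ! 1"
    using walk_second[of z "xs @ [a]"] Cons.prems by auto
  show ?case unfolding append_Cons
  proof (rule walk_Cons[OF w])
    show "adj z (hd (xs @ a # ys))" using * by (cases xs) auto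
    show "2 \<le> length (xs @ a # ys) \<longrightarrow> z \<noteq> (xs @ a # ys) ! 1"
      using * Cons.prems(3) by (cases xs; cases "tl xs"; cases ys) (auto simp: hd_conv_nth)
  qed
qed

lemma walk_rev:
  assumes "walk xs" shows "walk (rev xs)"
  unfolding walk_def
proof (intro conjI)
  show "rev xs \<noteq> []" "successively adj (rev xs)"
    using assms sym by (auto simp: walk_def successively_rev intro: successively_mono)
  show "reduced (rev xs)"
    unfolding reduced_def
  proof (intro allI impI)
    fix i assume i: "i + 2 < length (rev xs)"
    define j where "j = length xs - 3 - i"
    have "rev xs ! i = xs ! (j + 2)" "rev xs ! (i + 2) = xs ! j"
      using i by (auto simp: rev_nth j_def intro!: arg_cong[of _ _ "(!) xs"])
    moreover have "j + 2 < length xs" using i by (auto simp: j_def)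
    ultimately show "rev xs ! i \<noteq> rev xs ! (i + 2)"
      using assms by (auto simp: walk_def reduced_def)
  qed
qed

text \<open>Two different reduced walks would glue to a closed one.\<close>

lemma walk_unique:
  assumes "walk xs" "walk ys" "hd xs = hd ys" "last xs = last ys"
  shows "xs = ys"
  using assms
proof (induction xs arbitrary: ys)
  case Nil then show ?case by (simp add: walk_def)
next
  case (Cons z xs)
  obtain ys' where ys: "ys = z # ys'"
    using Cons.prems by (cases ys) (auto simp: walk_def)
  have closed: "zs = []" if "walk (z # zs)" "last (z # zs) = z" for zs
  proof -
    have "distinct (z # zs)" using that reduced_distinct unfolding walk_def by blast
    then show ?thesis using that(2) by (metis distinct.simps(2) last_ConsR last_in_set)
  qed
  consider "xs = []" | "ys' = []" | "xs \<noteq> []" "ys' \<noteq> []" by blast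
  then show ?case
  proof cases
    case 1
    then have "last (z # ys') = z" using Cons.prems(4) ys by simp
    then have "ys' = []" using closed[of ys'] Cons.prems(2) ys by blast
    then show ?thesis using 1 ys by simp
  next
    case 2
    then have "last (z # xs) = z" using Cons.prems(4) ys by simp
    then have "xs = []" using closed[of xs] Cons.prems(1) by blast
    then show ?thesis using 2 ys by simp
  next
    case 3
    show ?thesis
    proof (cases "hd xs = hd ys'")
      case True
      have "xs = ys'"
        using Cons.IH[of ys'] Cons.prems 3 True ys by (auto dest: walk_tl)
      then show ?thesis using ys by simp
    next
      case False
      have "walk (rev xs @ z # ys')"
      proof (rule walk_append)
        show "walk (rev xs @ [z])" using walk_rev[OF Cons.prems(1)] by simp
        show "walk (z # ys')" using Cons.prems ys by simp
        show "last (rev xs) \<noteq> hd ys'" using False 3 by (simp add: last_rev)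
      qed
      then have "distinct (rev xs @ z # ys')" using reduced_distinct unfolding walk_def by blast
      moreover have "last ys' \<in> set xs" "last ys' \<in> set ys'"
        using 3 Cons.prems(4) ys last_in_set[of xs] last_in_set[of ys'] by simp_all
      ultimately show ?thesis by auto
    qed
  qed
qed

lemma relpowp_to_list:
  assumes "(R ^^ n) x y"
  shows "\<exists>xs. length xs = n + 1 \<and> successively R xs \<and> hd xs = x \<and> last xs = y"
  using assms
proof (induction n arbitrary: y)
  case 0
  then show ?case by (auto intro!: exI[of _ "[x]"])
next
  case (Suc n)
  then obtain z where z: "(R ^^ n) x z" "R z y" by auto
  from Suc.IH[OF z(1)] obtain xs where
    xs: "length xs = n + 1" "successively R xs" "hd xs = x" "last xs = z" by blast
  then have "xs \<noteq> []" by auto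
  then show ?case using z(2) xs
    by (intro exI[of _ "xs @ [y]"]) (simp add: successively_append_iff)
qed

lemma list_to_relpowp:
  assumes "successively R xs" "xs \<noteq> []"
  shows "(R ^^ (length xs - 1)) (hd xs) (last xs)"
  using assms
proof (induction xs)
  case (Cons z xs)
  show ?case
  proof (cases "xs = []")
    case False
    then have "R z (hd xs)" "(R ^^ (length xs - 1)) (hd xs) (last xs)"
      using Cons by (auto simp: successively_Cons)
    then have "(R ^^ Suc (length xs - 1)) z (last xs)"
      using relpowp_Suc_I2 by metis
    then show ?thesis using False by simp
  qed simp
qed simp

text \<open>A shortest walk does not backtrack. The relation \<open>R\<close> is either adjacency itself or its restriction to
  the geodesic, which yields reduced walks that stay on the geodesic.\<close>

lemma shortest_reduced:
  assumes R: "\<And>u v. R u v \<Longrightarrow> adj u v" and "R\<^sup>*\<^sup>* x y"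
  obtains xs where "walk xs" "successively R xs" "hd xs = x" "last xs = y"
    "length xs = (LEAST n. (R ^^ n) x y) + 1"
proof -
  define n where "n = (LEAST n. (R ^^ n) x y)"
  have "\<exists>n. (R ^^ n) x y" using assms(2) by (simp add: rtranclp_power)
  then have n: "(R ^^ n) x y" "\<And>k. (R ^^ k) x y \<Longrightarrow> n \<le> k"
    unfolding n_def by (auto intro: LeastI_ex Least_le)
  obtain xs where xs: "length xs = n + 1" "successively R xs" "hd xs = x" "last xs = y"
    using relpowp_to_list[OF n(1)] by blast
  have "reduced xs"
    unfolding reduced_def
  proof (intro allI impI notI)
    fix i assume i: "i + 2 < length xs" "xs ! i = xs ! (i + 2)"
    define ys where "ys = take (Suc i) xs @ drop (i + 3) xs"
    have t: "take (Suc i) xs = take i xs @ [xs ! i]" using i by (simp add: take_Suc_conv_app_nth)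
    have s: "xs = take (i + 2) xs @ xs ! (i + 2) # drop (i + 3) xs"
      using i by (simp add: id_take_nth_drop numeral_3_eq_3)
    have nth: "R (xs ! k) (xs ! Suc k)" if "Suc k < length xs" for k
      using xs(2) that by (simp add: successively_conv_nth)
    have "successively R ys"
      unfolding ys_def successively_append_iff
    proof (intro conjI impI)
      show "successively R (take (Suc i) xs)"
        using nth by (auto simp: successively_conv_nth)
      show "successively R (drop (i + 3) xs)"
        unfolding successively_conv_nth
      proof (intro allI impI)
        fix k assume k: "Suc k < length (drop (i + 3) xs)"
        then show "R (drop (i + 3) xs ! k) (drop (i + 3) xs ! Suc k)"
          using nth[of "i + 3 + k"] by (simp add: add_ac)
      qed
      show "take (Suc i) xs = [] \<or> drop (i + 3) xs = [] \<or>
          R (last (take (Suc i) xs)) (hd (drop (i + 3) xs))"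
        using nth[of "i + 2"] i t
        by (cases "i + 3 < length xs") (auto simp: hd_drop_conv_nth numeral_3_eq_3)
    qed
    moreover have "hd ys = x" unfolding ys_def using xs i by (cases xs) auto
    moreover have "last ys = y"
    proof (cases "i + 3 < length xs")
      case True then show ?thesis unfolding ys_def using xs by auto
    next
      case False
      then have "length xs = i + 3" using i by simp
      moreover have "xs \<noteq> []" using i by auto
      ultimately have "xs ! (i + 2) = y" "drop (i + 3) xs = []"
        using xs by (auto simp: last_conv_nth)
      then show ?thesis unfolding ys_def using i t by simp
    qed
    moreover have "length ys = n - 1" "ys \<noteq> []" unfolding ys_def using xs i by auto
    ultimately have "(R ^^ (n - 1 - 1)) x y" using list_to_relpowp[of R ys] by auto
    from n(2)[OF this] xs i show False by auto
  qed
  moreover have "successively adj xs" using xs(2) R by (rule successively_mono) auto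
  moreover have "xs \<noteq> []" using xs by auto
  ultimately show ?thesis using that[of xs] xs n_def unfolding walk_def by auto
qed

lemma dist_walk:
  assumes "walk xs"
  shows "graph_dist adj (hd xs) (last xs) = length xs - 1"
proof -
  have "adj\<^sup>*\<^sup>* (hd xs) (last xs)"
    using list_to_relpowp[of adj xs] assms by (auto simp: walk_def rtranclp_power)
  from shortest_reduced[OF _ this, of thesis] obtain ys where
    ys: "walk ys" "hd ys = hd xs" "last ys = last xs"
      "length ys = graph_dist adj (hd xs) (last xs) + 1"
    using shortest_reduced[OF _ \<open>adj\<^sup>*\<^sup>* (hd xs) (last xs)\<close>] unfolding graph_dist_def by blast
  then show ?thesis using walk_unique[OF assms ys(1)] by simp
qed

lemma dist_attained:
  assumes "adj\<^sup>*\<^sup>* x y"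
  shows "(adj ^^ graph_dist adj x y) x y"
proof -
  obtain n where "(adj ^^ n) x y" using rtranclp_imp_relpowp[OF assms] by blast
  then show ?thesis unfolding graph_dist_def by (rule LeastI)
qed

lemma dist_1_iff: "graph_dist adj x y = 1 \<longleftrightarrow> adj x y" if "adj\<^sup>*\<^sup>* x y"
proof
  assume "adj x y"
  then have "walk [x, y]" by (auto simp: walk_def reduced_def)
  from dist_walk[OF this] show "graph_dist adj x y = 1" by simp
next
  assume "graph_dist adj x y = 1"
  moreover have "(adj ^^ graph_dist adj x y) x y"
    by (rule dist_attained[OF that])
  ultimately show "adj x y" by (simp add: eq_OO)
qed

end

section \<open>The parent map of the level function\<close>

locale levelled_tree = forest adj for adj :: "'v \<Rightarrow> 'v \<Rightarrow> bool" +
  fixes q :: nat and g :: "'v set" and N :: "'v \<Rightarrow> int"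
  assumes conn: "adj\<^sup>*\<^sup>* x y"
    and deg: "card {y. adj x y} = q + 1"
    and g_ne: "g \<noteq> {}"
    and g_conn: "x \<in> g \<Longrightarrow> y \<in> g \<Longrightarrow> (\<lambda>u v. u \<in> g \<and> v \<in> g \<and> adj u v)\<^sup>*\<^sup>* x y"
    and g_deg: "x \<in> g \<Longrightarrow> card {y \<in> g. adj x y} = 2"
    and N_dist: "x \<in> g \<Longrightarrow> y \<in> g \<Longrightarrow> \<bar>N x - N y\<bar> = int (graph_dist adj x y)"
begin

abbreviation "lev \<equiv> level adj g N"

text \<open>A reduced walk that enters \<open>g\<close> only with its last step continues inside \<open>g\<close> without
  backtracking; so its end is the closest point.\<close>

lemma closest_walk:
  assumes "walk (xs @ [a])" "a \<in> g" "xs \<noteq> [] \<Longrightarrow> last xs \<notin> g" "z = hd (xs @ [a])"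
  shows "lev z = N a - int (length xs)"
proof -
  have d: "graph_dist adj z y = length xs + graph_dist adj a y" if y: "y \<in> g" for y
  proof -
    obtain ys where ys: "walk ys" "successively (\<lambda>u v. u \<in> g \<and> v \<in> g \<and> adj u v) ys"
      "hd ys = a" "last ys = y"
      using shortest_reduced[OF _ g_conn[OF assms(2) y]] by blast
    then obtain ys' where ys': "ys = a # ys'" by (cases ys) (auto simp: walk_def)
    have "ys' \<noteq> [] \<Longrightarrow> hd ys' \<in> g" using ys(2) ys' by (auto simp: successively_Cons)
    then have "walk (xs @ a # ys')"
      using walk_append[of xs a ys'] assms(1,3) ys(1) ys' by metis
    from dist_walk[OF this] dist_walk[OF ys(1)] show ?thesis
      using ys ys' assms(4) by (cases xs) auto
  qed
  have da: "graph_dist adj a a = 0"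
    using dist_walk[of "[a]"] by (simp add: walk_def reduced_def)
  have pos: "0 < graph_dist adj a y" if "y \<noteq> a" for y
  proof (rule ccontr)
    assume "\<not> 0 < graph_dist adj a y"
    then have "graph_dist adj a y = 0" by simp
    moreover have "(adj ^^ graph_dist adj a y) a y"
      by (rule dist_attained[OF conn])
    ultimately show False using that by simp
  qed
  have "closest_in adj g z = a"
    unfolding closest_in_def
  proof (rule the_equality)
    show "a \<in> g \<and> (\<forall>y\<in>g. graph_dist adj z a \<le> graph_dist adj z y)"
      using d assms(2) da by auto
    fix b assume b: "b \<in> g \<and> (\<forall>y\<in>g. graph_dist adj z b \<le> graph_dist adj z y)"
    then have "graph_dist adj a b \<le> 0" using d[of b] d[of a] assms(2) da by fastforce
    then show "b = a" using pos[of b] by auto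
  qed
  then show ?thesis unfolding level_def using d[OF assms(2)] da by simp
qed

lemma walk_to_g:
  obtains xs a where "walk (xs @ [a])" "a \<in> g" "set xs \<inter> g = {}" "x = hd (xs @ [a])"
proof -
  obtain y where y: "y \<in> g" using g_ne by blast
  obtain ys where ys: "walk ys" "hd ys = x" "last ys = y"
    using shortest_reduced[OF _ conn[of x y]] by blast
  have "\<exists>v\<in>set ys. v \<in> g" using ys y by (metis last_in_set walk_def)
  then obtain xs a zs where s: "ys = xs @ a # zs" "a \<in> g" "\<forall>v\<in>set xs. v \<notin> g"
    using split_list_first_prop[of ys "\<lambda>v. v \<in> g"] by blast
  have "walk (xs @ [a])"
    unfolding walk_def reduced_def
  proof (intro conjI allI impI)
    show "successively adj (xs @ [a])" using ys(1) s(1)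
      by (auto simp: walk_def successively_append_iff)
    fix i assume i: "i + 2 < length (xs @ [a])"
    have "ys ! i \<noteq> ys ! (i + 2)" using ys(1) i s(1) by (auto simp: walk_def reduced_def)
    then show "(xs @ [a]) ! i \<noteq> (xs @ [a]) ! (i + 2)"
      using i s(1) by (auto simp: nth_append split: if_splits)
  qed simp
  then show ?thesis using that[of xs a] s ys by (cases xs) auto
qed

text \<open>Off the geodesic the parent is the first step of the walk towards it, and every other neighbour
  prolongs that walk. On the geodesic the two neighbours belonging to it differ by \<open>2\<close> under \<open>N\<close>, so one
  is above and one is below; all remaining neighbours have this vertex as their closest point.\<close>

lemma unique_parent: "\<exists>p. adj x p \<and> lev p = lev x + 1 \<and> (\<forall>z. adj x z \<and> z \<noteq> p \<longrightarrow> lev z = lev x - 1)"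
proof -
  obtain xs a where w: "walk (xs @ [a])" "a \<in> g" "set xs \<inter> g = {}" "x = hd (xs @ [a])"
    by (rule walk_to_g)
  have lx: "lev x = N a - int (length xs)"
    using w by (intro closest_walk) (auto dest: last_in_set)
  show ?thesis
  proof (cases xs)
    case Nil
    then have x: "x \<in> g" "lev x = N x" and ax: "a = x" using w lx by auto
    have wx: "walk [x]" by (simp add: walk_def reduced_def)
    have lg: "lev y = N y" if "y \<in> g" for y
      using closest_walk[of "[]" y y] that by (simp add: walk_def reduced_def)
    from g_deg[OF x(1)] obtain y1 y2 where y: "{y \<in> g. adj x y} = {y1, y2}" "y1 \<noteq> y2"
      by (meson card_2_iff)
    then have yg: "y1 \<in> g" "y2 \<in> g" "adj x y1" "adj x y2" by blast+
    have "walk [x, y1]" "walk [x, y2]" "walk [y1, x, y2]"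
      using yg y(2) sym by (auto simp: walk_def reduced_def)
    from this[THEN dist_walk] have "\<bar>N x - N y1\<bar> = 1" "\<bar>N x - N y2\<bar> = 1" "\<bar>N y1 - N y2\<bar> = 2"
      using N_dist yg x by auto
    then consider "N y1 = N x + 1" "N y2 = N x - 1" | "N y2 = N x + 1" "N y1 = N x - 1" by linarith
    then obtain p p' where p: "{y \<in> g. adj x y} = {p, p'}" "N p = N x + 1" "N p' = N x - 1"
      using y(1) by cases (metis, metis insert_commute)
    have pg: "p \<in> g" "p' \<in> g" "adj x p" using p(1) by blast+
    have "lev z = lev x - 1" if z: "adj x z" "z \<noteq> p" for z
    proof (cases "z \<in> g")
      case True
      then have "z = p'" using z p(1) by blast
      then show ?thesis using p(3) lg[of p'] pg x by simp
    next
      case False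
      then have "lev z = N x - int (length [z])"
        using z sym x by (intro closest_walk) (auto simp: walk_def reduced_def)
      then show ?thesis using x by simp
    qed
    then show ?thesis using p lg[of p] pg x by auto
  next
    case (Cons x0 ys)
    then have x0: "x0 = x" using w by simp
    define p where "p = hd (ys @ [a])"
    have wp: "walk (ys @ [a])" using w(1) Cons walk_tl by fastforce
    have "lev p = N a - int (length ys)"
      using w Cons by (intro closest_walk[OF wp]) (auto simp: p_def dest: last_in_set)
    then have lp: "lev p = lev x + 1" using lx Cons by simp
    have ap: "adj x p" using walk_second(1)[of x "ys @ [a]"] w(1) Cons x0 by (simp add: p_def)
    have "lev z = lev x - 1" if z: "adj x z" "z \<noteq> p" for z
    proof -
      have "walk (z # xs @ [a])"
      proof (rule walk_Cons[OF w(1)])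
        show "adj z (hd (xs @ [a]))" using z sym w(4) by simp
        show "2 \<le> length (xs @ [a]) \<longrightarrow> z \<noteq> (xs @ [a]) ! 1"
          using z(2) Cons by (cases ys) (auto simp: p_def)
      qed
      then have "lev z = N a - int (length (z # xs))"
        using w Cons by (intro closest_walk) (auto dest: last_in_set split: if_splits)
      then show ?thesis using lx by simp
    qed
    then show ?thesis using ap lp by blast
  qed
qed

definition par :: "'v \<Rightarrow> 'v" where
  "par x = (SOME p. adj x p \<and> lev p = lev x + 1 \<and> (\<forall>z. adj x z \<and> z \<noteq> p \<longrightarrow> lev z = lev x - 1))"

lemma par: "adj x (par x)" "lev (par x) = lev x + 1"
    "adj x z \<Longrightarrow> z \<noteq> par x \<Longrightarrow> lev z = lev x - 1"
  unfolding par_def using someI_ex[OF unique_parent[of x]] by blast+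

lemma adj_iff: "adj x y \<longleftrightarrow> y = par x \<or> x = par y"
proof
  assume a: "adj x y"
  show "y = par x \<or> x = par y"
  proof (rule ccontr)
    assume "\<not> ?thesis"
    then have "lev y = lev x - 1" "lev x = lev y - 1"
      using par(3)[of x y] par(3)[of y x] a sym by blast+
    then show False by simp
  qed
qed (use par(1) sym in blast)

lemma neighbours: "{y. adj x y} = insert (par x) {y. par y = x}" "par (par x) \<noteq> x"
proof -
  show "par (par x) \<noteq> x"
    using par(2)[of x] par(2)[of "par x"] by auto
  show "{y. adj x y} = insert (par x) {y. par y = x}"
    using adj_iff by auto
qed

lemma finite_neighbours: "finite {y. adj x y}"
  using deg[of x] card.infinite by fastforce

lemma card_children: "card {y. par y = x} = q"
proof -
  have "finite {y. par y = x}"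
    using finite_subset[OF _ finite_neighbours[of x]] neighbours(1)[of x] by blast
  moreover have "par x \<notin> {y. par y = x}" using neighbours(2) by simp
  ultimately show ?thesis using deg[of x] neighbours(1)[of x] by simp
qed

lemma lev_adj_le: "adj x y \<Longrightarrow> lev y \<le> lev x + 1"
  using par[of x] by (cases "y = par x") auto

lemma lev_path_le: "(adj ^^ k) x y \<Longrightarrow> lev y \<le> lev x + int k"
proof (induction k arbitrary: y)
  case (Suc k)
  then obtain z where "(adj ^^ k) x z" "adj z y" by auto
  then show ?case using Suc.IH[of z] lev_adj_le[of z y] by simp
qed simp

text \<open>A walk that gains as many levels as it has steps must go to the parent in each step.\<close>

lemma lies_below_iff: "lies_below adj lev x y \<longleftrightarrow> (\<exists>n. (par ^^ n) x = y)"
proof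
  assume b: "lies_below adj lev x y"
  define n where "n = graph_dist adj x y"
  have rp: "(adj ^^ n) x y"
    unfolding n_def by (rule dist_attained[OF conn])
  have "lev v = lev u + int k \<Longrightarrow> (par ^^ k) u = v" if "(adj ^^ k) u v" for k u v
    using that
  proof (induction k arbitrary: v)
    case (Suc k)
    then obtain z where z: "(adj ^^ k) u z" "adj z v" by auto
    have "lev z = lev u + int k" using lev_path_le[OF z(1)] lev_adj_le[OF z(2)] Suc.prems by simp
    moreover have "v = par z" using par(3)[OF z(2)] Suc.prems calculation by force
    ultimately show ?case using Suc.IH[OF _ z(1)] by simp
  qed simp
  from this[OF rp] show "\<exists>n. (par ^^ n) x = y"
    using b unfolding lies_below_def n_def by auto
next
  assume "\<exists>n. (par ^^ n) x = y"
  then obtain n where n: "(par ^^ n) x = y" by blast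
  have l: "lev ((par ^^ k) x) = lev x + int k" for k by (induction k) (auto simp: par)
  have rp: "(adj ^^ n) x y" unfolding n[symmetric]
  proof (induction n)
    case (Suc n)
    then show ?case using par(1)[of "(par ^^ n) x"] by auto
  qed simp
  have "graph_dist adj x y = n"
    unfolding graph_dist_def
  proof (rule Least_equality)
    show "(adj ^^ n) x y" by (rule rp)
    fix k assume k: "(adj ^^ k) x y"
    from lev_path_le[OF k] l[of n] n show "n \<le> k" by simp
  qed
  then show "lies_below adj lev x y" unfolding lies_below_def using l[of n] n by simp
qed

end

section \<open>The Hausdorff moment problem\<close>

text \<open>Power moments and falling factorial moments of a distribution on \<open>{0..n}\<close>, rescaled to the unit interval,
  agree asymptotically; the latter are the ones that Bernstein weights reproduce exactly.\<close>

lemma binomial_ratio_bound: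
  assumes "2 * r + 2 \<le> n" "k \<le> n"
  shows "\<bar>real (k choose r) / real (n choose r) - (real k / real n) ^ r\<bar> \<le> real r * (2 * real r / real n)"
proof -
  have ff: "real (m choose r) = (\<Prod>i<r. (real m - real i)) / fact r" for m
    unfolding binomial_gbinomial by (simp add: gbinomial_prod_rev lessThan_atLeast0)
  have nz: "(\<Prod>i<r. (real n - real i)) \<noteq> 0" using assms by auto
  have "real (k choose r) / real (n choose r) = (\<Prod>i<r. (real k - real i) / (real n - real i))"
    unfolding ff using nz by (simp add: prod_dividef)
  moreover have "(real k / real n) ^ r = (\<Prod>i<r. real k / real n)" by simp
  ultimately have "\<bar>real (k choose r) / real (n choose r) - (real k / real n) ^ r\<bar>
      = norm ((\<Prod>i<r. (real k - real i) / (real n - real i)) - (\<Prod>i<r. real k / real n))"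
    by simp
  also have "\<dots> \<le> (\<Sum>i<r. norm ((real k - real i) / (real n - real i) - real k / real n))"
  proof (rule norm_prod_diff)
    fix i assume i: "i \<in> {..<r}"
    have "\<bar>real k - real i\<bar> \<le> real n - real i" using assms i by (auto simp: abs_if)
    moreover have "real n - real i > 0" using assms i by auto
    ultimately show "norm ((real k - real i) / (real n - real i)) \<le> 1" by simp
    show "norm (real k / real n) \<le> 1" using assms by (auto simp: divide_simps)
  qed
  also have "\<dots> \<le> (\<Sum>i<r. 2 * real r / real n)"
  proof (rule sum_mono)
    fix i assume i: "i \<in> {..<r}"
    have n: "real n > 0" "real n - real i > 0" using assms i by auto
    have "(real k - real i) / (real n - real i) - real k / real n
        = - (real i * (real n - real k)) / (real n * (real n - real i))"
      using n by (simp add: field_simps)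
    then have "norm ((real k - real i) / (real n - real i) - real k / real n)
        = (real i / real n) * ((real n - real k) / (real n - real i))"
      using n assms by (simp add: abs_mult)
    also have "\<dots> \<le> (real r / real n) * 2"
    proof (rule mult_mono)
      show "(real n - real k) / (real n - real i) \<le> 2"
        using n assms i by (auto simp: divide_simps)
    qed (use n assms i in \<open>auto simp: divide_right_mono\<close>)
    finally show "norm ((real k - real i) / (real n - real i) - real k / real n) \<le> 2 * real r / real n"
      by (simp add: mult.commute)
  qed
  finally show ?thesis by simp
qed

lemma bernstein_power:
  assumes "r \<le> n"
  shows "(\<Sum>k\<le>n. smult (real (k choose r) / real (n choose r) * real (n choose k))
           ([:0, 1:] ^ k * [:1, -1:] ^ (n - k))) = [:0, 1:] ^ r"
proof -
  let ?x = "[:0, 1:] :: real poly" and ?y = "[:1, -1:] :: real poly"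
  have c: "real (k choose r) / real (n choose r) * real (n choose k) = real ((n - r) choose (k - r))"
    if "r \<le> k" "k \<le> n" for k
    using choose_mult[OF that] that assms
    by (simp add: field_simps of_nat_mult[symmetric] del: of_nat_mult)
  have "(\<Sum>k\<le>n. smult (real (k choose r) / real (n choose r) * real (n choose k)) (?x ^ k * ?y ^ (n - k)))
      = (\<Sum>k\<in>{r..n}. smult (real (k choose r) / real (n choose r) * real (n choose k)) (?x ^ k * ?y ^ (n - k)))"
    by (rule sum.mono_neutral_right) auto
  also have "\<dots> = (\<Sum>k\<in>{r..n}. of_nat ((n - r) choose (k - r)) * (?x ^ k * ?y ^ (n - k)))"
  proof (rule sum.cong)
    fix k assume k: "k \<in> {r..n}"
    show "smult (real (k choose r) / real (n choose r) * real (n choose k)) (?x ^ k * ?y ^ (n - k))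
        = of_nat ((n - r) choose (k - r)) * (?x ^ k * ?y ^ (n - k))"
      using k by (subst c) (simp_all add: of_nat_poly)
  qed simp
  also have "\<dots> = (\<Sum>j\<in>{0..n-r}. of_nat ((n - r) choose j) * (?x ^ (j + r) * ?y ^ (n - (j + r))))"
    using assms by (intro sum.reindex_bij_witness[of _ "\<lambda>j. j + r" "\<lambda>k. k - r"]) auto
  also have "\<dots> = ?x ^ r * (\<Sum>j\<le>n-r. of_nat ((n - r) choose j) * ?x ^ j * ?y ^ ((n - r) - j))"
    by (simp add: sum_distrib_left power_add algebra_simps atLeast0AtMost)
  also have "\<dots> = ?x ^ r * (?x + ?y) ^ (n - r)"
    by (subst binomial_ring) simp
  also have "?x + ?y = 1" by (simp add: one_pCons)
  finally show ?thesis by simp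
qed

text \<open>The Bernstein weights of \<open>\<Lambda>\<close> define probability measures on the points \<open>k/n\<close> whose moments tend to the
  numbers \<open>\<Lambda> (x ^ m)\<close>, and Helly's selection theorem provides a weak limit. Truncating the variable to the
  unit interval makes the powers bounded continuous test functions and forces the limit onto \<open>[0, 1]\<close>.\<close>

lemma hausdorff_moment_prob:
  fixes \<Lambda> :: "real poly \<Rightarrow> real"
  assumes add: "\<And>p q. \<Lambda> (p + q) = \<Lambda> p + \<Lambda> q"
    and smult: "\<And>c p. \<Lambda> (smult c p) = c * \<Lambda> p"
    and pos: "\<And>k j. 0 \<le> \<Lambda> ([:0, 1:] ^ k * [:1, -1:] ^ j)"
    and one: "\<Lambda> 1 = 1"
  obtains \<nu> where "prob_space \<nu>" "sets \<nu> = sets borel" "AE t in \<nu>. t \<in> {0..1}"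
    "\<And>n. \<Lambda> ([:0, 1:] ^ n) = (\<integral>t. t ^ n \<partial>\<nu>)"
proof -
  have zero: "\<Lambda> 0 = 0" using smult[of 0 0] by simp
  have sum: "\<Lambda> (\<Sum>k\<in>A. f k) = (\<Sum>k\<in>A. \<Lambda> (f k))" for A :: "nat set" and f
    by (induction A rule: infinite_finite_induct) (auto simp: zero add)
  define w where "w n k = real (n choose k) * \<Lambda> ([:0, 1:] ^ k * [:1, -1:] ^ (n - k))" for n k
  have w0: "0 \<le> w n k" for n k unfolding w_def using pos by simp
  have wr: "(\<Sum>k\<le>n. real (k choose r) / real (n choose r) * w n k) = \<Lambda> ([:0, 1:] ^ r)"
    if "r \<le> n" for n r
    unfolding bernstein_power[OF that, symmetric] sum smult w_def by (simp add: mult.assoc)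
  have w1: "(\<Sum>k\<le>n. w n k) = 1" for n using wr[of 0 n] one by simp
  define \<mu> where "\<mu> n = distr (point_measure {..n} (\<lambda>k. ennreal (w n k))) borel (\<lambda>k. real k / real n)" for n
  have meas: "(\<lambda>k. real k / real n) \<in> measurable (point_measure {..n} (\<lambda>k. ennreal (w n k))) borel" for n
    by simp
  have rd: "real_distribution (\<mu> n)" for n
  proof -
    have "prob_space (point_measure {..n} (\<lambda>k. ennreal (w n k)))"
      by (rule prob_spaceI) (simp add: space_point_measure emeasure_point_measure_finite w0 w1)
    from prob_space.prob_space_distr[OF this meas] show ?thesis
      unfolding \<mu>_def by (simp add: real_distribution_def real_distribution_axioms_def)
  qed
  have int: "(\<integral>t. f t \<partial>\<mu> n) = (\<Sum>k\<le>n. w n k * f (real k / real n))" if "f \<in> borel_measurable borel" for f :: "real \<Rightarrow> real" and n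
    unfolding \<mu>_def using that w0
    by (subst integral_distr[OF meas]) (auto simp: lebesgue_integral_point_measure_finite)
  have "tight \<mu>"
    unfolding tight_def
  proof (intro conjI allI impI)
    fix e :: real assume "e > 0"
    have "measure (\<mu> n) {-1<..1} = 1" for n
    proof -
      interpret real_distribution "\<mu> n" by (rule rd)
      have "measure (\<mu> n) {-1<..1} = (\<integral>t. indicator {-1<..1} t \<partial>\<mu> n)" by simp
      also have "\<dots> = (\<Sum>k\<le>n. w n k * indicator {-1<..1} (real k / real n))" by (rule int) simp
      also have "\<dots> = (\<Sum>k\<le>n. w n k * 1)"
      proof (rule sum.cong)
        fix k assume "k \<in> {..n}"
        then have "0 \<le> real k / real n" "real k / real n \<le> 1" by (auto simp: divide_simps)
        then have "real k / real n \<in> {-1<..1}" using order.strict_trans2[of "-1" 0 "real k / real n"] by simp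
        then show "w n k * indicator {-1<..1} (real k / real n) = w n k * 1" by simp
      qed simp
      finally show ?thesis using w1 by simp
    qed
    then show "\<exists>a b. a < b \<and> (\<forall>n. 1 - e < measure (\<mu> n) {a<..b})"
      using \<open>e > 0\<close> by (intro exI[of _ "-1"] exI[of _ 1]) simp
  qed (rule rd)
  from tight_imp_convergent_subsubsequence[OF this strict_mono_id]
  obtain r M where r: "strict_mono r" and M: "real_distribution M" and conv: "weak_conv_m (\<mu> \<circ> id \<circ> r) M"
    by blast
  interpret M: real_distribution M by (rule M)
  define clamp where "clamp t = max 0 (min 1 t)" for t :: real
  have cl: "0 \<le> clamp t" "clamp t \<le> 1" for t unfolding clamp_def by auto
  have clm[measurable]: "clamp \<in> borel_measurable borel" unfolding clamp_def by measurable
  have clm': "clamp \<in> borel_measurable M" by simp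
  have mom: "(\<integral>t. clamp t ^ m \<partial>M) = \<Lambda> ([:0, 1:] ^ m)" for m
  proof (rule LIMSEQ_unique)
    interpret rdn: real_distribution "(\<mu> \<circ> id \<circ> r) n" for n using rd by simp
    show "(\<lambda>n. \<integral>t. clamp t ^ m \<partial>(\<mu> \<circ> id \<circ> r) n) \<longlonglongrightarrow> (\<integral>t. clamp t ^ m \<partial>M)"
    proof (rule weak_conv_imp_integral_bdd_continuous_conv[OF _ _ conv])
      show "real_distribution ((\<mu> \<circ> id \<circ> r) n)" for n using rd by simp
      show "isCont (\<lambda>t. clamp t ^ m) t" for t unfolding clamp_def by (intro continuous_intros)
      show "norm (clamp t ^ m) \<le> 1" for t using cl[of t] by (simp add: power_le_one)
    qed (rule M)
    have "(\<lambda>n. (\<integral>t. clamp t ^ m \<partial>\<mu> n) - \<Lambda> ([:0, 1:] ^ m)) \<longlonglongrightarrow> 0"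
    proof (rule Lim_null_comparison)
      show "eventually (\<lambda>n. norm ((\<integral>t. clamp t ^ m \<partial>\<mu> n) - \<Lambda> ([:0, 1:] ^ m)) \<le> real m * (2 * real m / real n)) sequentially"
        using eventually_ge_at_top[of "2 * m + 2"]
      proof eventually_elim
        case (elim n)
        have cln: "clamp (real k / real n) = real k / real n" if "k \<le> n" for k
          using that elim by (auto simp: clamp_def divide_simps)
        have "(\<integral>t. clamp t ^ m \<partial>\<mu> n) - \<Lambda> ([:0, 1:] ^ m)
            = (\<Sum>k\<le>n. w n k * ((real k / real n) ^ m - real (k choose m) / real (n choose m)))"
          using wr[of m n] elim by (subst int) (auto simp: cln sum_subtractf algebra_simps)
        also have "norm \<dots> \<le> (\<Sum>k\<le>n. w n k * (real m * (2 * real m / real n)))"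
        proof (rule order_trans[OF norm_sum sum_mono])
          fix k assume "k \<in> {..n}"
          then show "norm (w n k * ((real k / real n) ^ m - real (k choose m) / real (n choose m))) \<le> w n k * (real m * (2 * real m / real n))"
            using mult_left_mono[OF binomial_ratio_bound[OF elim, of k] w0[of n k]] w0[of n k]
            by (simp add: abs_mult abs_minus_commute)
        qed
        also have "\<dots> = real m * (2 * real m / real n)" using w1[of n] by (simp only: sum_distrib_right[symmetric] mult_1)
        finally show ?case .
      qed
      show "(\<lambda>n. real m * (2 * real m / real n)) \<longlonglongrightarrow> 0"
        by (intro tendsto_mult_right_zero tendsto_divide_0[OF tendsto_const])
          (rule filterlim_mono[OF filterlim_real_sequentially at_top_le_at_infinity order_refl])
    qed
    then have "(\<lambda>n. \<integral>t. clamp t ^ m \<partial>\<mu> n) \<longlonglongrightarrow> \<Lambda> ([:0, 1:] ^ m)" by (rule LIM_zero_cancel)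
    from LIMSEQ_subseq_LIMSEQ[OF this r]
    show "(\<lambda>n. \<integral>t. clamp t ^ m \<partial>(\<mu> \<circ> id \<circ> r) n) \<longlonglongrightarrow> \<Lambda> ([:0, 1:] ^ m)"
      by (simp add: o_def)
  qed
  show ?thesis
  proof (rule that[of "distr M borel clamp"])
    show "prob_space (distr M borel clamp)" by (rule M.prob_space_distr[OF clm'])
    show "AE t in distr M borel clamp. t \<in> {0..1}"
      by (subst AE_distr_iff[OF clm']) (auto simp: cl)
    show "\<Lambda> ([:0, 1:] ^ n) = (\<integral>t. t ^ n \<partial>distr M borel clamp)" for n
      by (subst integral_distr[OF clm']) (auto simp: mom)
  qed simp
qed

lemma hausdorff_moment:
  fixes \<Lambda> :: "real poly \<Rightarrow> real"
  assumes add: "\<And>p q. \<Lambda> (p + q) = \<Lambda> p + \<Lambda> q"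
    and smult: "\<And>c p. \<Lambda> (smult c p) = c * \<Lambda> p"
    and pos: "\<And>k j. 0 \<le> \<Lambda> ([:0, 1:] ^ k * [:1, -1:] ^ j)"
  obtains \<nu> where "finite_measure \<nu>" "sets \<nu> = sets borel" "AE t in \<nu>. t \<in> {0..1}"
    "\<And>n. \<Lambda> ([:0, 1:] ^ n) = (\<integral>t. t ^ n \<partial>\<nu>)"
proof (cases "\<Lambda> 1 = 0")
  case True
  have "\<Lambda> ([:0, 1:] ^ n) = 0" for n
  proof (induction n)
    case 0 then show ?case using True by simp
  next
    case (Suc n)
    have "[:0, 1:] ^ n * [:1, -1:] ^ 1 + [:0, 1:] ^ Suc n = ([:0, 1:] ^ n :: real poly)"
    proof -
      have "[:0, 1:] ^ n * [:1, -1:] ^ 1 + [:0, 1:] ^ Suc n = ([:0, 1:] ^ n * ([:1, -1:] + [:0, 1:]) :: real poly)"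
        by (simp only: power_Suc power_one_right) (simp only: algebra_simps)
      also have "[:1, -1:] + [:0, 1:] = (1 :: real poly)" by (simp add: one_pCons)
      finally show ?thesis by simp
    qed
    then have "\<Lambda> ([:0, 1:] ^ n * [:1, -1:] ^ 1) + \<Lambda> ([:0, 1:] ^ Suc n) = 0"
      using Suc by (metis add)
    then show ?case using pos[of n 1] pos[of "Suc n" 0] by simp
  qed
  then show ?thesis
    by (intro that[of "null_measure borel"]) (auto intro: finite_measureI simp: integral_eq_zero_AE AE_iff_null)
next
  case False
  then have p: "\<Lambda> 1 > 0" using pos[of 0 0] by simp
  obtain \<nu> where \<nu>: "prob_space \<nu>" "sets \<nu> = sets borel" "AE t in \<nu>. t \<in> {0..1}"
    "\<And>n. \<Lambda> ([:0, 1:] ^ n) / \<Lambda> 1 = (\<integral>t. t ^ n \<partial>\<nu>)"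
    by (rule hausdorff_moment_prob[of "\<lambda>p. \<Lambda> p / \<Lambda> 1"])
      (use p in \<open>auto simp: add smult pos add_divide_distrib intro: divide_nonneg_pos\<close>)
  interpret prob_space \<nu> by (rule \<nu>)
  show ?thesis
  proof (rule that[of "density \<nu> (\<lambda>_. ennreal (\<Lambda> 1))"])
    show "finite_measure (density \<nu> (\<lambda>_. ennreal (\<Lambda> 1)))"
      by (rule finite_measureI) (simp add: emeasure_density emeasure_space_1)
    show "AE t in density \<nu> (\<lambda>_. ennreal (\<Lambda> 1)). t \<in> {0..1}"
      using \<nu>(3) by (subst AE_density) auto
    show "\<Lambda> ([:0, 1:] ^ n) = (\<integral>t. t ^ n \<partial>density \<nu> (\<lambda>_. ennreal (\<Lambda> 1)))" for n
    proof -
      have "(\<lambda>t. t ^ n) \<in> borel_measurable \<nu>" by (simp add: measurable_cong_sets[OF \<nu>(2) refl])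
      then show ?thesis using p \<nu>(4)[of n] by (subst integral_density) (auto simp: field_simps)
    qed
  qed (simp add: \<nu>)
qed

section \<open>Square integrable functions\<close>

lemma L2D:
  assumes "f \<in> L2_space M"
  shows "f \<in> borel_measurable M" "integrable M (\<lambda>x. (cmod (f x))\<^sup>2)"
  using assms by (auto simp: L2_space_def)

lemma cmod_add_sq_le: "(cmod (a + b))\<^sup>2 \<le> 2 * (cmod a)\<^sup>2 + 2 * (cmod b)\<^sup>2"
proof -
  have "(cmod (a + b))\<^sup>2 \<le> (cmod a + cmod b)\<^sup>2" by (intro power_mono norm_triangle_ineq) simp
  also have "\<dots> \<le> 2 * (cmod a)\<^sup>2 + 2 * (cmod b)\<^sup>2"
    using sum_squares_bound[of "cmod a" "cmod b"] by (simp add: power2_sum)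
  finally show ?thesis .
qed

lemma L2_add:
  assumes "f \<in> L2_space M" "g \<in> L2_space M"
  shows "(\<lambda>x. f x + g x) \<in> L2_space M"
proof -
  note [measurable] = L2D(1)[OF assms(1)] L2D(1)[OF assms(2)]
  have "integrable M (\<lambda>x. (cmod (f x + g x))\<^sup>2)"
    by (rule Bochner_Integration.integrable_bound[of M "\<lambda>x. 2 * (cmod (f x))\<^sup>2 + 2 * (cmod (g x))\<^sup>2"])
      (use assms cmod_add_sq_le in \<open>auto simp: L2_space_def\<close>)
  then show ?thesis by (simp add: L2_space_def)
qed

lemma L2_scale: "f \<in> L2_space M \<Longrightarrow> (\<lambda>x. c * f x) \<in> L2_space M"
  by (auto simp: L2_space_def norm_mult power_mult_distrib)

lemma L2_diff:
  assumes "f \<in> L2_space M" "g \<in> L2_space M"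
  shows "(\<lambda>x. f x - g x) \<in> L2_space M"
  using L2_add[OF assms(1) L2_scale[OF assms(2), of "-1"]] by simp

lemma L2_zero: "(\<lambda>x. 0) \<in> L2_space M"
  by (simp add: L2_space_def)

lemma L2_integrable_mult:
  assumes "f \<in> L2_space M" "g \<in> L2_space M"
  shows "integrable M (\<lambda>x. f x * cnj (g x))"
proof -
  note [measurable] = L2D(1)[OF assms(1)] L2D(1)[OF assms(2)]
  have [measurable]: "(\<lambda>x. cnj (g x)) \<in> borel_measurable M"
    by (rule borel_measurable_continuous_on[OF _ L2D(1)[OF assms(2)]]) (intro continuous_intros)
  have "cmod (f x * cnj (g x)) \<le> (cmod (f x))\<^sup>2 + (cmod (g x))\<^sup>2" for x
  proof -
    have "0 \<le> cmod (f x) * cmod (g x)" by simp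
    then have "cmod (f x) * cmod (g x) \<le> (cmod (f x))\<^sup>2 + (cmod (g x))\<^sup>2"
      using sum_squares_bound[of "cmod (f x)" "cmod (g x)"] by linarith
    then show ?thesis by (simp add: norm_mult)
  qed
  then have b: "cmod (f x * cnj (g x)) \<le> norm ((cmod (f x))\<^sup>2 + (cmod (g x))\<^sup>2)" for x
    by (metis abs_ge_self order_trans real_norm_def)
  show ?thesis
  proof (rule Bochner_Integration.integrable_bound)
    show "integrable M (\<lambda>x. (cmod (f x))\<^sup>2 + (cmod (g x))\<^sup>2)" using assms by (simp add: L2D)
    show "(\<lambda>x. f x * cnj (g x)) \<in> borel_measurable M" by measurable
  qed (rule AE_I2[OF b])
qed

lemma L2_inner_add_left:
  "f \<in> L2_space M \<Longrightarrow> f' \<in> L2_space M \<Longrightarrow> g \<in> L2_space M \<Longrightarrow>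
    L2_inner M (\<lambda>x. f x + f' x) g = L2_inner M f g + L2_inner M f' g"
  by (simp add: L2_inner_def distrib_right L2_integrable_mult)

lemma L2_inner_scale_left: "L2_inner M (\<lambda>x. c * f x) g = c * L2_inner M f g"
  by (simp add: L2_inner_def mult.assoc)

lemma L2_inner_cnj: "L2_inner M g f = cnj (L2_inner M f g)"
  unfolding L2_inner_def by (subst Bochner_Integration.integral_cnj[symmetric]) (simp add: mult.commute)

lemma L2_inner_add_right:
  "f \<in> L2_space M \<Longrightarrow> g \<in> L2_space M \<Longrightarrow> g' \<in> L2_space M \<Longrightarrow>
    L2_inner M f (\<lambda>x. g x + g' x) = L2_inner M f g + L2_inner M f g'"
  by (simp add: L2_inner_def distrib_left L2_integrable_mult)

lemma L2_inner_scale_right: "L2_inner M f (\<lambda>x. c * g x) = cnj c * L2_inner M f g"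
  by (subst (1 2) L2_inner_cnj) (simp add: L2_inner_scale_left)

lemma L2_inner_self: "L2_inner M f f = complex_of_real (\<integral>x. (cmod (f x))\<^sup>2 \<partial>M)"
  unfolding L2_inner_def by (simp add: complex_norm_square[symmetric] flip: of_real_power)

lemma L2_inner_self_ge_0: "0 \<le> Re (L2_inner M f f)"
  by (simp add: L2_inner_self)

text \<open>Weak convergence from boundedness and pointwise convergence: the part of \<open>\<bar>v g\<bar>\<close> exceeding
  \<open>\<delta> \<bar>v\<bar>\<^sup>2\<close> is dominated by \<open>\<bar>g\<bar>\<^sup>2 / (4 \<delta>)\<close>.\<close>

lemma L2_weak_convergence:
  assumes u: "\<And>n. u n \<in> L2_space M" and bnd: "\<And>n. (\<integral>x. (cmod (u n x))\<^sup>2 \<partial>M) \<le> C"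
    and lim: "\<And>x. (\<lambda>n. u n x) \<longlonglongrightarrow> v x" and g: "g \<in> L2_space M"
  shows "v \<in> L2_space M" "(\<integral>x. (cmod (v x))\<^sup>2 \<partial>M) \<le> C" "(\<lambda>n. L2_inner M (u n) g) \<longlonglongrightarrow> L2_inner M v g"
proof -
  note um[measurable] = L2D(1)[OF u] and gm[measurable] = L2D(1)[OF g]
  have vm[measurable]: "v \<in> borel_measurable M" by (rule borel_measurable_LIMSEQ_metric[OF um]) (rule lim)
  have C: "0 \<le> C" using bnd[of 0] by (rule order_trans[rotated]) simp
  have nn: "(\<integral>\<^sup>+x. ennreal ((cmod (v x))\<^sup>2) \<partial>M) \<le> ennreal C"
  proof -
    have "(\<integral>\<^sup>+x. ennreal ((cmod (v x))\<^sup>2) \<partial>M) = (\<integral>\<^sup>+x. liminf (\<lambda>n. ennreal ((cmod (u n x))\<^sup>2)) \<partial>M)"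
    proof (rule nn_integral_cong)
      fix x
      have "(\<lambda>n. ennreal ((cmod (u n x))\<^sup>2)) \<longlonglongrightarrow> ennreal ((cmod (v x))\<^sup>2)"
        by (intro tendsto_ennrealI tendsto_intros lim)
      then show "ennreal ((cmod (v x))\<^sup>2) = liminf (\<lambda>n. ennreal ((cmod (u n x))\<^sup>2))"
        by (intro lim_imp_Liminf[symmetric]) auto
    qed
    also have "\<dots> \<le> liminf (\<lambda>n. \<integral>\<^sup>+x. ennreal ((cmod (u n x))\<^sup>2) \<partial>M)"
      by (rule nn_integral_liminf) measurable
    also have "\<dots> \<le> liminf (\<lambda>n. ennreal C)"
      by (intro Liminf_mono always_eventually allI, subst nn_integral_eq_integral)
        (use u bnd in \<open>auto simp: L2_space_def intro: ennreal_leI\<close>)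
    finally show ?thesis by (simp add: Liminf_const)
  qed
  then have "integrable M (\<lambda>x. (cmod (v x))\<^sup>2)"
    by (intro integrableI_bounded) (auto simp: le_less_trans)
  then show v: "v \<in> L2_space M" by (simp add: L2_space_def)
  show vC: "(\<integral>x. (cmod (v x))\<^sup>2 \<partial>M) \<le> C"
    using nn nn_integral_eq_integral[OF L2D(2)[OF v]] C by simp
  have d: "(\<lambda>x. u n x - v x) \<in> L2_space M" for n by (rule L2_diff[OF u v])
  have dC: "(\<integral>x. (cmod (u n x - v x))\<^sup>2 \<partial>M) \<le> 4 * C" for n
  proof -
    have "(\<integral>x. (cmod (u n x - v x))\<^sup>2 \<partial>M) \<le> (\<integral>x. 2 * (cmod (u n x))\<^sup>2 + 2 * (cmod (v x))\<^sup>2 \<partial>M)"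
      by (intro integral_mono) (use L2D(2)[OF d] L2D(2)[OF u] L2D(2)[OF v] cmod_add_sq_le[of _ "- v _"] in auto)
    then show ?thesis using bnd[of n] vC L2D(2)[OF u] L2D(2)[OF v] by simp
  qed
  have main: "(\<lambda>n. \<integral>x. cmod (u n x - v x) * cmod (g x) \<partial>M) \<longlonglongrightarrow> 0"
  proof (rule LIMSEQ_I)
    fix e :: real assume e: "e > 0"
    \<comment> \<open>The integrals of \<open>\<bar>u n - v\<bar>\<^sup>2\<close> are at most \<open>4 C\<close>, and half of \<open>e\<close> is reserved for them.\<close>
    define \<delta> where "\<delta> = e / (2 * (4 * C + 1))"
    have \<delta>: "\<delta> > 0" "\<delta> * (4 * C) < e / 2 \<or> \<delta> * (4 * C) = 0" "\<delta> * (4 * C) \<le> e / 2"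
      using e C by (auto simp: \<delta>_def divide_simps algebra_simps)
    define \<phi> where "\<phi> n x = max 0 (cmod (u n x - v x) * cmod (g x) - \<delta> * (cmod (u n x - v x))\<^sup>2)" for n x
    have \<phi>b: "\<bar>\<phi> n x\<bar> \<le> (cmod (g x))\<^sup>2 / (4 * \<delta>)" for n x
    proof -
      have "0 \<le> (2 * \<delta> * cmod (u n x - v x) - cmod (g x))\<^sup>2" by simp
      then have "4 * \<delta> * (cmod (u n x - v x) * cmod (g x) - \<delta> * (cmod (u n x - v x))\<^sup>2) \<le> (cmod (g x))\<^sup>2"
        by (simp add: power2_eq_square algebra_simps)
      then show ?thesis using \<delta> unfolding \<phi>_def by (auto simp: pos_le_divide_eq mult.commute max_def)
    qed
    have \<phi>m: "\<phi> n \<in> borel_measurable M" for n unfolding \<phi>_def by measurable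
    have "(\<lambda>n. \<integral>x. \<phi> n x \<partial>M) \<longlonglongrightarrow> (\<integral>x. 0 \<partial>M)"
    proof (rule integral_dominated_convergence)
      show "integrable M (\<lambda>x. (cmod (g x))\<^sup>2 / (4 * \<delta>))" using L2D(2)[OF g] by simp
      show "AE x in M. norm (\<phi> n x) \<le> (cmod (g x))\<^sup>2 / (4 * \<delta>)" for n using \<phi>b by simp
      show "AE x in M. (\<lambda>n. \<phi> n x) \<longlonglongrightarrow> 0"
      proof (rule AE_I2)
        fix x
        have "(\<lambda>n. \<phi> n x) \<longlonglongrightarrow> max 0 (cmod (v x - v x) * cmod (g x) - \<delta> * (cmod (v x - v x))\<^sup>2)"
          unfolding \<phi>_def by (intro tendsto_intros lim)
        then show "(\<lambda>n. \<phi> n x) \<longlonglongrightarrow> 0" by simp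
      qed
    qed (use \<phi>m in auto)
    then have "(\<lambda>n. \<integral>x. \<phi> n x \<partial>M) \<longlonglongrightarrow> 0" by simp
    from LIMSEQ_D[OF this, of "e / 2"] e obtain n0 where n0: "\<And>n. n \<ge> n0 \<Longrightarrow> \<bar>\<integral>x. \<phi> n x \<partial>M\<bar> < e / 2"
      by auto
    have \<phi>i: "integrable M (\<phi> n)" for n
      by (rule Bochner_Integration.integrable_bound[of M "\<lambda>x. (cmod (g x))\<^sup>2 / (4 * \<delta>)"])
        (use L2D(2)[OF g] \<phi>b \<phi>m \<delta>(1) in \<open>auto intro!: AE_I2 order_trans[OF \<phi>b]\<close>)
    show "\<exists>n0. \<forall>n\<ge>n0. norm ((\<integral>x. cmod (u n x - v x) * cmod (g x) \<partial>M) - 0) < e"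
    proof (intro exI[of _ n0] allI impI)
      fix n assume n: "n \<ge> n0"
      have "(\<integral>x. cmod (u n x - v x) * cmod (g x) \<partial>M) \<le> (\<integral>x. \<phi> n x + \<delta> * (cmod (u n x - v x))\<^sup>2 \<partial>M)"
      proof (rule integral_mono)
        show "integrable M (\<lambda>x. cmod (u n x - v x) * cmod (g x))"
          using integrable_norm[OF L2_integrable_mult[OF d[of n] g]] by (simp add: norm_mult)
        show "integrable M (\<lambda>x. \<phi> n x + \<delta> * (cmod (u n x - v x))\<^sup>2)" using \<phi>i L2D(2)[OF d] by simp
      qed (simp add: \<phi>_def)
      also have "\<dots> = (\<integral>x. \<phi> n x \<partial>M) + \<delta> * (\<integral>x. (cmod (u n x - v x))\<^sup>2 \<partial>M)"
        using \<phi>i L2D(2)[OF d] by simp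
      also have "\<dots> < e / 2 + \<delta> * (4 * C)"
        using n0[OF n] mult_left_mono[OF dC[of n], of \<delta>] \<delta>(1) by linarith
      finally have "(\<integral>x. cmod (u n x - v x) * cmod (g x) \<partial>M) < e" using \<delta>(3) by simp
      then show "norm ((\<integral>x. cmod (u n x - v x) * cmod (g x) \<partial>M) - 0) < e"
        by (simp add: abs_less_iff order.strict_trans2[of _ 0] e)
    qed
  qed
  have "(\<lambda>n. L2_inner M (u n) g - L2_inner M v g) \<longlonglongrightarrow> 0"
  proof (rule Lim_null_comparison[OF always_eventually main], rule allI)
    fix n
    have "L2_inner M (u n) g - L2_inner M v g = (\<integral>x. (u n x - v x) * cnj (g x) \<partial>M)"
      unfolding L2_inner_def left_diff_distrib
      by (rule Bochner_Integration.integral_diff[symmetric]) (intro L2_integrable_mult u v g)+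
    also have "norm \<dots> \<le> (\<integral>x. norm ((u n x - v x) * cnj (g x)) \<partial>M)" by (rule integral_norm_bound)
    finally show "norm (L2_inner M (u n) g - L2_inner M v g) \<le> (\<integral>x. cmod (u n x - v x) * cmod (g x) \<partial>M)"
      by (simp add: norm_mult)
  qed
  then show "(\<lambda>n. L2_inner M (u n) g) \<longlonglongrightarrow> L2_inner M v g" by (rule LIM_zero_cancel)
qed

section \<open>Polynomial functional calculus and spectral measures\<close>

text \<open>The operator \<open>p(T)\<close>, evaluated by Horner's scheme.\<close>

definition poly_op :: "(('v \<Rightarrow> complex) \<Rightarrow> 'v \<Rightarrow> complex) \<Rightarrow> real poly \<Rightarrow> ('v \<Rightarrow> complex) \<Rightarrow> 'v \<Rightarrow> complex" where
  "poly_op T p f = fold_coeffs (\<lambda>a u x. complex_of_real a * f x + T u x) p (\<lambda>x. 0)"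

lemma poly_linear_eqI:
  fixes \<Phi> \<Psi> :: "real poly \<Rightarrow> 'b::real_vector"
  assumes "\<And>p q. \<Phi> (p + q) = \<Phi> p + \<Phi> q" "\<And>c p. \<Phi> (smult c p) = c *\<^sub>R \<Phi> p"
    and "\<And>p q. \<Psi> (p + q) = \<Psi> p + \<Psi> q" "\<And>c p. \<Psi> (smult c p) = c *\<^sub>R \<Psi> p"
    and "\<And>n. \<Phi> ([:0, 1:] ^ n) = \<Psi> ([:0, 1:] ^ n)"
  shows "\<Phi> p = \<Psi> p"
proof (induction p)
  case 0
  show ?case using assms(2)[of 0 0] assms(4)[of 0 0] by simp
next
  case (pCons a p)
  have "\<Phi> (q * [:0, 1:] ^ n) = \<Psi> (q * [:0, 1:] ^ n)" for q n
  proof (induction q arbitrary: n)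
    case 0
    show ?case using assms(2)[of 0 0] assms(4)[of 0 0] by simp
  next
    case (pCons a p)
    have "pCons a p * [:0, 1:] ^ n = smult a ([:0, 1:] ^ n) + p * [:0, 1:] ^ Suc n" by simp
    then show ?case using assms(1-4) assms(5)[of n] pCons.IH[of "Suc n"] by metis
  qed
  from this[of "pCons a p" 0] show ?case by simp
qed

lemma pcompose_power: "pcompose (p ^ n) q = pcompose p q ^ n" for p :: "'a::comm_semiring_1 poly"
  by (induction n) (auto simp: pcompose_mult pcompose_1)

locale positive_operator =
  fixes M :: "'v measure" and T :: "('v \<Rightarrow> complex) \<Rightarrow> 'v \<Rightarrow> complex"
  assumes T_add: "T (\<lambda>x. f x + g x) = (\<lambda>x. T f x + T g x)"
    and T_scale: "T (\<lambda>x. c * f x) = (\<lambda>x. c * T f x)"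
    and T_L2: "f \<in> L2_space M \<Longrightarrow> T f \<in> L2_space M"
    and T_sym: "f \<in> L2_space M \<Longrightarrow> g \<in> L2_space M \<Longrightarrow> L2_inner M (T f) g = L2_inner M f (T g)"
    and T_pos: "f \<in> L2_space M \<Longrightarrow> 0 \<le> Re (L2_inner M (T f) f)"
    and T_le: "f \<in> L2_space M \<Longrightarrow> Re (L2_inner M (T f) f) \<le> 2 * Re (L2_inner M f f)"
begin

abbreviation "op \<equiv> poly_op T"

lemma T_zero: "T (\<lambda>x. 0) = (\<lambda>x. 0)"
  using T_scale[of 0 "\<lambda>x. 0"] by simp

lemma op_0: "op 0 f = (\<lambda>x. 0)"
  by (simp add: poly_op_def)

lemma op_pCons: "op (pCons a p) f = (\<lambda>x. complex_of_real a * f x + T (op p f) x)"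
  by (cases "p = 0 \<and> a = 0") (auto simp: poly_op_def T_zero)

lemma op_add: "op (p + q) f = (\<lambda>x. op p f x + op q f x)"
  by (induction p q rule: poly_induct2) (auto simp: op_0 op_pCons T_add algebra_simps)

lemma op_smult: "op (smult c p) f = (\<lambda>x. complex_of_real c * op p f x)"
  by (induction p) (auto simp: op_0 op_pCons T_scale algebra_simps)

lemma op_mult: "op (p * q) f = op p (op q f)"
  by (induction p) (auto simp: op_0 op_pCons op_add op_smult)

lemma op_1: "op 1 f = f"
  by (simp add: one_pCons op_pCons op_0 T_zero)

lemma op_x_power: "op ([:0, 1:] ^ n) f = (T ^^ n) f"
proof (induction n)
  case (Suc n)
  have "op ([:0, 1:] ^ Suc n) f = op [:0, 1:] (op ([:0, 1:] ^ n) f)" unfolding power_Suc op_mult ..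
  then show ?case using Suc by (simp add: op_pCons op_0 T_zero)
qed (simp add: op_1)

lemma op_L2: "f \<in> L2_space M \<Longrightarrow> op p f \<in> L2_space M"
  by (induction p) (auto simp: op_0 op_pCons L2_zero intro!: L2_add L2_scale T_L2)

lemma op_f_add: "op p (\<lambda>x. f x + g x) = (\<lambda>x. op p f x + op p g x)"
  by (induction p) (auto simp: op_0 op_pCons T_add algebra_simps)

lemma op_f_scale: "op p (\<lambda>x. c * f x) = (\<lambda>x. c * op p f x)"
  by (induction p) (auto simp: op_0 op_pCons T_scale algebra_simps)

lemma op_sym:
  assumes "f \<in> L2_space M" "g \<in> L2_space M"
  shows "L2_inner M (op p f) g = L2_inner M f (op p g)"
  using assms
proof (induction p arbitrary: f)
  case 0 then show ?case by (simp add: op_0 L2_inner_def)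
next
  case (pCons a p)
  have comm: "op p (T f) = T (op p f)"
    using op_mult[of p "[:0, 1:]" f] op_mult[of "[:0, 1:]" p f]
    by (simp add: op_pCons op_0 T_zero mult.commute)
  have "L2_inner M (op (pCons a p) f) g = L2_inner M (\<lambda>x. complex_of_real a * f x) g + L2_inner M (T (op p f)) g"
    unfolding op_pCons using pCons.prems by (intro L2_inner_add_left L2_scale T_L2 op_L2)
  also have "L2_inner M (T (op p f)) g = L2_inner M f (T (op p g))"
    unfolding comm[symmetric] using pCons by (simp add: T_L2 T_sym op_L2)
  finally show ?case
    unfolding op_pCons using pCons.prems
    by (subst L2_inner_add_right)
      (auto simp: L2_inner_scale_left L2_inner_scale_right L2_scale T_L2 op_L2)
qed

lemma op_sq:
  assumes "f \<in> L2_space M"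
  shows "L2_inner M (op (p * p * r) f) f = L2_inner M (op r (op p f)) (op p f)"
proof -
  have "op (p * p * r) f = op p (op r (op p f))" unfolding op_mult[symmetric] by (simp add: mult_ac)
  then show ?thesis using assms by (simp add: op_sym op_L2)
qed

lemma op_real: "f \<in> L2_space M \<Longrightarrow> Im (L2_inner M (op p f) f) = 0"
  using op_sym[of f f p] L2_inner_cnj[of M "op p f" f] by (metis complex_cnj_cancel_iff Im_complex_of_real Reals_cnj_iff complex_is_Real_iff)

text \<open>Even powers are absorbed into the vector, as \<open>\<langle>p(T)\<^sup>2 r(T) f, f\<rangle> = \<langle>r(T) u, u\<rangle>\<close> for \<open>u = p(T) f\<close>. What remains
  is at most \<open>s t\<close> with \<open>s = T/2\<close> and \<open>t = 1 - s\<close>, and \<open>s t = t\<^sup>2 s + s\<^sup>2 t\<close>.\<close>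

lemma op_bernstein_pos:
  assumes "f \<in> L2_space M"
  shows "0 \<le> Re (L2_inner M (op ([:0, 1/2:] ^ k * [:1, -1/2:] ^ j) f) f)"
proof -
  let ?s = "[:0, 1/2:] :: real poly" and ?t = "[:1, -1/2:] :: real poly"
  have s: "0 \<le> Re (L2_inner M (op ?s u) u)" "0 \<le> Re (L2_inner M (op ?t u) u)" if u: "u \<in> L2_space M" for u
  proof -
    have *: "op ?s u = (\<lambda>x. (1/2) * T u x)" "op ?t u = (\<lambda>x. u x + (-1/2) * T u x)"
      using T_scale[of "1/2" u] T_scale[of "-1/2" u] by (auto simp: op_pCons op_0 T_zero)
    show "0 \<le> Re (L2_inner M (op ?s u) u)" unfolding *(1) L2_inner_scale_left using T_pos[OF u] by simp
    show "0 \<le> Re (L2_inner M (op ?t u) u)" unfolding *(2)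
      using T_le[OF u]
      by (simp only: L2_inner_add_left[OF u L2_scale[OF T_L2[OF u]] u] L2_inner_scale_left) simp
  qed
  define a b where "a = k div 2" and "b = j div 2"
  define p where "p = ?s ^ a * ?t ^ b"
  define u where "u = op p f"
  have u: "u \<in> L2_space M" unfolding u_def by (rule op_L2[OF assms])
  have "0 \<le> Re (L2_inner M (op (?s ^ (k mod 2) * ?t ^ (j mod 2)) u) u)"
  proof -
    consider "k mod 2 = 0" "j mod 2 = 0" | "k mod 2 = 1" "j mod 2 = 0"
      | "k mod 2 = 0" "j mod 2 = 1" | "k mod 2 = 1" "j mod 2 = 1"
      by (meson mod2_eq_if)
    then show ?thesis
    proof cases
      case 1 then show ?thesis by (simp add: op_1 L2_inner_self_ge_0)
    next
      case 4
      have e: "?s * ?t = ?t * ?t * ?s + ?s * ?s * ?t" by simp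
      have "L2_inner M (op (?s * ?t) u) u = L2_inner M (op (?t * ?t * ?s) u) u + L2_inner M (op (?s * ?s * ?t) u) u"
        unfolding e op_add by (intro L2_inner_add_left op_L2 u)
      then show ?thesis unfolding 4 op_sq[OF u] using s op_L2[OF u] by simp
    qed (use s[OF u] in simp_all)
  qed
  also have "L2_inner M (op (?s ^ (k mod 2) * ?t ^ (j mod 2)) u) u =
      L2_inner M (op (p * p * (?s ^ (k mod 2) * ?t ^ (j mod 2))) f) f"
    unfolding u_def by (rule op_sq[OF assms, symmetric])
  also have "p * p * (?s ^ (k mod 2) * ?t ^ (j mod 2)) = ?s ^ (a + a + k mod 2) * ?t ^ (b + b + j mod 2)"
    unfolding p_def power_add by (simp add: mult_ac)
  also have "a + a + k mod 2 = k" unfolding a_def by presburger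
  also have "b + b + j mod 2 = j" unfolding b_def by presburger
  finally show ?thesis .
qed

text \<open>The Hausdorff moment problem for \<open>p \<mapsto> \<langle>p(T/2) f, f\<rangle>\<close>, rescaled from \<open>[0, 1]\<close> to \<open>[0, 2]\<close>.\<close>

lemma spectral_measure_ex:
  assumes f: "f \<in> L2_space M"
  shows "\<exists>\<nu>. finite_measure \<nu> \<and> sets \<nu> = sets borel \<and>
        (\<exists>K. compact K \<and> emeasure \<nu> (- K) = 0) \<and>
        (\<forall>n. L2_inner M ((T ^^ n) f) f = complex_of_real (\<integral>t. t ^ n \<partial>\<nu>))"
proof -
  define \<Lambda> where "\<Lambda> p = Re (L2_inner M (op (pcompose p [:0, 1/2:]) f) f)" for p
  have add: "\<Lambda> (p + q) = \<Lambda> p + \<Lambda> q" for p q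
    unfolding \<Lambda>_def pcompose_add op_add using f by (subst L2_inner_add_left) (auto intro: op_L2)
  have sm: "\<Lambda> (smult c p) = c * \<Lambda> p" for c p
    unfolding \<Lambda>_def pcompose_smult op_smult L2_inner_scale_left by simp
  have ps: "0 \<le> \<Lambda> ([:0, 1:] ^ k * [:1, - 1:] ^ j)" for k j
  proof -
    have "pcompose ([:0, 1:] ^ k * [:1, - 1:] ^ j) [:0, 1/2:] = ([:0, 1/2:] ^ k * [:1, -1/2:] ^ j :: real poly)"
      by (simp add: pcompose_mult pcompose_power pcompose_pCons)
    then show ?thesis unfolding \<Lambda>_def using op_bernstein_pos[OF f, of k j] by simp
  qed
  obtain \<sigma> where \<sigma>: "finite_measure \<sigma>" "sets \<sigma> = sets borel" "AE t in \<sigma>. t \<in> {0..1}"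
    "\<And>n. \<Lambda> ([:0, 1:] ^ n) = (\<integral>t. t ^ n \<partial>\<sigma>)"
    by (rule hausdorff_moment[of \<Lambda>]) (use add sm ps in blast)+
  interpret finite_measure \<sigma> by (rule \<sigma>)
  have m[measurable]: "(\<lambda>s. 2 * s) \<in> measurable \<sigma> borel"
    using \<sigma>(2) measurable_cong_sets[OF \<sigma>(2) refl] by auto
  show ?thesis
  proof (intro exI[of _ "distr \<sigma> borel (\<lambda>s. 2 * s)"] conjI allI)
    show "finite_measure (distr \<sigma> borel (\<lambda>s. 2 * s))" by (rule finite_measure_distr[OF m])
    show "\<exists>K. compact K \<and> emeasure (distr \<sigma> borel (\<lambda>s. 2 * s)) (- K) = 0"
    proof (intro exI[of _ "{0..2}"] conjI)
      have "AE t in \<sigma>. t \<notin> (\<lambda>s. 2 * s) -` (- {0..2})" using \<sigma>(3) by eventually_elim auto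
      then have "emeasure \<sigma> {t \<in> space \<sigma>. t \<in> (\<lambda>s. 2 * s) -` (- {0..2})} = 0"
        by (rule emeasure_eq_0_AE)
      also have "{t \<in> space \<sigma>. t \<in> (\<lambda>s. 2 * s) -` (- {0..2})} = (\<lambda>s. 2 * s) -` (- {0..2}) \<inter> space \<sigma>"
        by auto
      finally show "emeasure (distr \<sigma> borel (\<lambda>s. 2 * s)) (- {0..2}) = 0"
        by (subst emeasure_distr[OF m]) auto
    qed simp
    fix n
    have "(\<integral>t. t ^ n \<partial>distr \<sigma> borel (\<lambda>s. 2 * s)) = 2 ^ n * \<Lambda> ([:0, 1:] ^ n)"
      by (subst integral_distr[OF m]) (auto simp: \<sigma>(4) power_mult_distrib)
    also have "\<Lambda> ([:0, 1:] ^ n) = Re (L2_inner M ((T ^^ n) f) f) / 2 ^ n"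
    proof -
      have "pcompose ([:0, 1:] ^ n) [:0, 1/2:] = smult ((1/2) ^ n) ([:0, 1:] ^ n :: real poly)"
        by (simp add: pcompose_power pcompose_pCons flip: smult_power)
      then show ?thesis unfolding \<Lambda>_def
        by (simp only: op_smult L2_inner_scale_left op_x_power) (simp add: power_one_over field_simps)
    qed
    finally show "L2_inner M ((T ^^ n) f) f = complex_of_real (\<integral>t. t ^ n \<partial>distr \<sigma> borel (\<lambda>s. 2 * s))"
      using op_real[OF f, of "[:0, 1:] ^ n"] by (simp add: op_x_power complex_eq_iff)
  qed simp
qed

abbreviation "\<nu> f \<equiv> spectral_measure M T f"

lemma spectral_measure:
  assumes f: "f \<in> L2_space M"
  shows "finite_measure (\<nu> f)" "sets (\<nu> f) = sets borel"
    "\<exists>K. compact K \<and> emeasure (\<nu> f) (- K) = 0"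
    "L2_inner M ((T ^^ n) f) f = complex_of_real (\<integral>t. t ^ n \<partial>\<nu> f)"
  unfolding spectral_measure_def using someI_ex[OF spectral_measure_ex[OF f]] by blast+

lemma spectral_meas: "f \<in> L2_space M \<Longrightarrow> h \<in> borel_measurable borel \<Longrightarrow> h \<in> borel_measurable (\<nu> f)"
  using spectral_measure(2)[of f] measurable_cong_sets by blast

lemma spectral_integrable_poly:
  assumes f: "f \<in> L2_space M"
  shows "integrable (\<nu> f) (poly p)"
proof -
  interpret finite_measure "\<nu> f" by (rule spectral_measure[OF f])
  obtain K where K: "compact K" "emeasure (\<nu> f) (- K) = 0" using spectral_measure(3)[OF f] by blast
  have "bounded (poly p ` K)"
    by (intro compact_imp_bounded compact_continuous_image K continuous_intros)
  then obtain B where B: "\<And>t. t \<in> K \<Longrightarrow> norm (poly p t) \<le> B" unfolding bounded_iff by auto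
  have "AE t in \<nu> f. norm (poly p t) \<le> B"
    by (rule AE_I[of _ _ "- K"])
      (use K B in \<open>auto simp: spectral_measure(2)[OF f] borel_closed compact_imp_closed intro!: borel_comp\<close>)
  then show ?thesis
    by (intro integrable_const_bound) (auto intro!: spectral_meas[OF f] borel_measurable_continuous_onI continuous_intros)
qed

lemma spectral_poly:
  assumes f: "f \<in> L2_space M"
  shows "L2_inner M (op p f) f = complex_of_real (\<integral>t. poly p t \<partial>\<nu> f)"
proof (rule poly_linear_eqI)
  note [simp] = spectral_integrable_poly[OF f]
  show "L2_inner M (op (p + q) f) f = L2_inner M (op p f) f + L2_inner M (op q f) f" for p q
    unfolding op_add using f by (intro L2_inner_add_left op_L2)
  show "L2_inner M (op (smult c p) f) f = c *\<^sub>R L2_inner M (op p f) f" for c p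
    unfolding op_smult L2_inner_scale_left by (simp add: scaleR_conv_of_real)
  show "complex_of_real (\<integral>t. poly (p + q) t \<partial>\<nu> f) = complex_of_real (\<integral>t. poly p t \<partial>\<nu> f) + complex_of_real (\<integral>t. poly q t \<partial>\<nu> f)" for p q
    by simp
  show "complex_of_real (\<integral>t. poly (smult c p) t \<partial>\<nu> f) = c *\<^sub>R complex_of_real (\<integral>t. poly p t \<partial>\<nu> f)" for c p
    by (simp add: scaleR_conv_of_real)
  show "L2_inner M (op ([:0, 1:] ^ n) f) f = complex_of_real (\<integral>t. poly ([:0, 1:] ^ n) t \<partial>\<nu> f)" for n
    using spectral_measure(4)[OF f, of n] by (simp add: op_x_power)
qed

lemma spectral_poly_eq:
  assumes f: "f \<in> L2_space M" and "\<And>t. poly p t = h t"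
  shows "L2_inner M (op p f) f = complex_of_real (\<integral>t. h t \<partial>\<nu> f)" "integrable (\<nu> f) h"
proof -
  have "poly p = h" using assms(2) by auto
  then show "L2_inner M (op p f) f = complex_of_real (\<integral>t. h t \<partial>\<nu> f)" "integrable (\<nu> f) h"
    using spectral_poly[OF f, of p] spectral_integrable_poly[OF f, of p] by auto
qed

lemma spectral_sq:
  assumes f: "f \<in> L2_space M"
  shows "(\<integral>x. (cmod (op p f x))\<^sup>2 \<partial>M) = (\<integral>t. (poly p t)\<^sup>2 \<partial>\<nu> f)"
proof -
  have "complex_of_real (\<integral>x. (cmod (op p f x))\<^sup>2 \<partial>M) = L2_inner M (op (p * p * 1) f) f"
    unfolding op_sq[OF f] by (simp add: L2_inner_self op_1)
  also have "\<dots> = complex_of_real (\<integral>t. (poly p t)\<^sup>2 \<partial>\<nu> f)"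
    by (rule spectral_poly_eq[OF f]) (simp add: power2_eq_square)
  finally show ?thesis by (simp only: of_real_eq_iff)
qed

lemma spectral_sq_T:
  assumes f: "f \<in> L2_space M"
  shows "Re (L2_inner M (T (op p f)) (op p f)) = (\<integral>t. t * (poly p t)\<^sup>2 \<partial>\<nu> f)"
proof -
  have "L2_inner M (T (op p f)) (op p f) = L2_inner M (op (p * p * [:0, 1:]) f) f"
    unfolding op_sq[OF f] by (simp add: op_pCons op_0 T_zero)
  also have "\<dots> = complex_of_real (\<integral>t. t * (poly p t)\<^sup>2 \<partial>\<nu> f)"
    by (rule spectral_poly_eq[OF f]) (simp add: power2_eq_square mult_ac)
  finally show ?thesis by simp
qed

text \<open>This is \<open>\<parallel>(1 - T)\<^sup>n f\<parallel> \<le> \<parallel>f\<parallel>\<close>: the loss in each step is \<open>1 - (1 - t)\<^sup>2 = 4 (t/2) (1 - t/2)\<close>.\<close>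

lemma contraction:
  assumes f: "f \<in> L2_space M"
  shows "Re (L2_inner M (op ([:1, -1:] ^ (2 * n)) f) f) \<le> Re (L2_inner M f f)"
proof (induction n)
  case 0 then show ?case by (simp add: op_1)
next
  case (Suc n)
  define p where "p = ([:1, -1:] ^ n :: real poly)"
  have e: "([:1, -1:] ^ (2 * m) :: real poly) = [:1, -1:] ^ m * [:1, -1:] ^ m * 1" for m
    by (simp add: power_add[symmetric] mult_2)
  define s t where "s = ([:0, 1/2:] :: real poly)" and "t = ([:1, -1/2:] :: real poly)"
  have d: "(p * p * 1 :: real poly) = [:1, -1:] ^ Suc n * [:1, -1:] ^ Suc n * 1 + smult 4 (p * p * (s * t))"
  proof -
    have "(1 :: real poly) = [:1, -1:] * [:1, -1:] + smult 4 (s * t)"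
      by (simp add: s_def t_def one_pCons)
    then have "p * p * 1 = p * p * ([:1, -1:] * [:1, -1:] + smult 4 (s * t))" by metis
    also have "\<dots> = ([:1, -1:] * p) * ([:1, -1:] * p) + smult 4 (p * p * (s * t))"
      by (simp only: distrib_left mult_smult_right mult_ac)
    finally show ?thesis unfolding p_def power_Suc by (simp only: mult_1_right)
  qed
  have "Re (L2_inner M (op (p * p * 1) f) f) =
      Re (L2_inner M (op ([:1, -1:] ^ Suc n * [:1, -1:] ^ Suc n * 1) f) f) + 4 * Re (L2_inner M (op (p * p * (s * t)) f) f)"
    unfolding d op_add op_smult using f
    by (subst L2_inner_add_left) (auto simp: L2_inner_scale_left intro!: L2_scale op_L2)
  moreover have "0 \<le> Re (L2_inner M (op (p * p * (s * t)) f) f)"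
    unfolding op_sq[OF f] s_def t_def using op_bernstein_pos[OF op_L2[OF f], of 1 1 p] by simp
  ultimately show ?case using Suc unfolding e p_def by simp
qed

text \<open>By its definition the spectral measure is only known to have some compact support. The moments of
  \<open>(1 - t)\<^sup>2\<^sup>n\<close> do not grow with \<open>n\<close>, so there is no mass where \<open>\<bar>1 - t\<bar> > 1\<close>.\<close>

lemma spectral_support:
  assumes f: "f \<in> L2_space M"
  shows "AE t in \<nu> f. 0 \<le> t \<and> t \<le> 2"
proof -
  interpret finite_measure "\<nu> f" by (rule spectral_measure[OF f])
  define F where "F = Re (L2_inner M f f)"
  have mom: "(\<integral>t. (1 - t) ^ (2 * n) \<partial>\<nu> f) \<le> F" for n
    using contraction[OF f, of n] spectral_poly_eq(1)[OF f, of "[:1, -1:] ^ (2 * n)" "\<lambda>t. (1 - t) ^ (2 * n)"]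
    unfolding F_def by simp
  have int: "integrable (\<nu> f) (\<lambda>t. (1 - t) ^ (2 * n))" for n
    by (rule spectral_poly_eq(2)[OF f, of "[:1, -1:] ^ (2 * n)"]) simp
  have [measurable]: "{t. P t} \<in> sets (\<nu> f)" if "{t. P t} \<in> sets borel" for P
    using that spectral_measure(2)[OF f] by simp
  have sp: "space (\<nu> f) = UNIV" using sets_eq_imp_space_eq[OF spectral_measure(2)[OF f]] by simp
  have z: "measure (\<nu> f) {t. 1 + e \<le> \<bar>1 - t\<bar>} = 0" if e: "e > 0" for e
  proof -
    let ?A = "{t. 1 + e \<le> \<bar>1 - t\<bar>}"
    have A: "?A \<in> sets (\<nu> f)" by measurable
    have "measure (\<nu> f) ?A * (1 + e) ^ (2 * n) \<le> F" for n
    proof -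
      have "measure (\<nu> f) ?A * (1 + e) ^ (2 * n) = (\<integral>t. (1 + e) ^ (2 * n) * indicator ?A t \<partial>\<nu> f)"
        using A by (simp add: sp)
      also have "\<dots> \<le> (\<integral>t. (1 - t) ^ (2 * n) \<partial>\<nu> f)"
      proof (rule integral_mono[OF _ int])
        show "integrable (\<nu> f) (\<lambda>t. (1 + e) ^ (2 * n) * indicator ?A t)"
          using A by (intro integrable_mult_right) (simp add: integrable_indicator_iff less_top[symmetric])
        fix t
        have "(1 + e) ^ (2 * n) \<le> (1 - t) ^ (2 * n)" if "t \<in> ?A"
          using power_mono[of "1 + e" "\<bar>1 - t\<bar>" "2 * n"] power_even_abs[of "2 * n" "1 - t"] that e by simp
        then show "(1 + e) ^ (2 * n) * indicator ?A t \<le> (1 - t) ^ (2 * n)"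
          by (cases "t \<in> ?A") auto
      qed
      finally show ?thesis using mom[of n] by simp
    qed
    then have b: "measure (\<nu> f) ?A \<le> F / ((1 + e)\<^sup>2) ^ n" for n
      using e by (simp add: pos_le_divide_eq power_mult)
    have "(\<lambda>n. F / ((1 + e)\<^sup>2) ^ n) \<longlonglongrightarrow> 0"
      using e by (intro LIMSEQ_divide_realpow_zero) (simp add: power2_eq_square algebra_simps add_pos_pos)
    then have "measure (\<nu> f) ?A \<le> 0" by (rule LIMSEQ_le_const) (use b in auto)
    then show ?thesis using measure_nonneg[of "\<nu> f" ?A] by linarith
  qed
  have "AE t in \<nu> f. \<forall>k. \<not> 1 + 1 / real (Suc k) \<le> \<bar>1 - t\<bar>"
  proof (subst AE_all_countable, rule allI)
    fix k
    show "AE t in \<nu> f. \<not> 1 + 1 / real (Suc k) \<le> \<bar>1 - t\<bar>"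
      by (rule AE_I[of _ _ "{t. 1 + 1 / real (Suc k) \<le> \<bar>1 - t\<bar>}"])
        (auto simp: emeasure_eq_measure z sp)
  qed
  then show ?thesis
  proof eventually_elim
    case (elim t)
    have "\<bar>1 - t\<bar> \<le> 1"
    proof (rule ccontr)
      assume "\<not> ?thesis"
      then obtain k where "1 / real (Suc k) < \<bar>1 - t\<bar> - 1" using nat_approx_posE[of "\<bar>1 - t\<bar> - 1"] by auto
      then show False using elim by (auto dest!: spec[of _ k])
    qed
    then show ?case by auto
  qed
qed

end

section \<open>Inverse square roots as limits of polynomials\<close>

text \<open>The coefficients of the binomial series of \<open>(1 - s)\<^sup>-\<^sup>1\<^sup>/\<^sup>2\<close>.\<close>

definition binom_coeff :: "nat \<Rightarrow> real" where
  "binom_coeff n = pochhammer (1/2) n / fact n"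

lemma binom_coeff_nonneg: "0 \<le> binom_coeff n"
  unfolding binom_coeff_def by (intro divide_nonneg_pos pochhammer_nonneg) auto

lemma binom_coeff_sums: "\<bar>s\<bar> < 1 \<Longrightarrow> (\<lambda>n. binom_coeff n * s ^ n) sums ((1 - s) powr (-1/2))"
proof -
  assume "\<bar>s\<bar> < 1"
  then have "(\<lambda>n. ((-1/2) gchoose n) * (-s) ^ n) sums (1 + (-s)) powr (-1/2)"
    by (intro gen_binomial_real) simp
  moreover have "((-1/2) gchoose n) * (-s) ^ n = binom_coeff n * s ^ n" for n
  proof -
    have "((-1/2 :: real) gchoose n) = (-1) ^ n * binom_coeff n"
      unfolding binom_coeff_def gbinomial_pochhammer by simp
    moreover have "(-s) ^ n = (-1) ^ n * s ^ n" by (metis mult_minus1 power_mult_distrib)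
    ultimately show ?thesis by (simp add: mult_ac flip: power_mult_distrib)
  qed
  ultimately show ?thesis by simp
qed

text \<open>Partial sums of the expansions of \<open>1/t\<close> and \<open>t\<^sup>-\<^sup>1\<^sup>/\<^sup>2\<close> in powers of \<open>1 - t/2\<close>. The variable \<open>1 - t/2\<close> is
  nonnegative on the whole spectrum, so that both sequences increase to their limits there, including
  the end point \<open>t = 2\<close>.\<close>

definition inverse_poly :: "nat \<Rightarrow> real poly" where
  "inverse_poly N = smult (1/2) (\<Sum>n<N. [:1, -1/2:] ^ n)"

definition inv_sqrt_poly :: "nat \<Rightarrow> real poly" where
  "inv_sqrt_poly N = smult (1 / sqrt 2) (\<Sum>n<N. smult (binom_coeff n) ([:1, -1/2:] ^ n))"

lemma poly_inverse_poly: "poly (inverse_poly N) t = (\<Sum>n<N. (1 - t / 2) ^ n) / 2"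
  by (simp add: inverse_poly_def poly_sum)

lemma poly_inv_sqrt_poly: "poly (inv_sqrt_poly N) t = (\<Sum>n<N. binom_coeff n * (1 - t / 2) ^ n) / sqrt 2"
  by (simp add: inv_sqrt_poly_def poly_sum)

lemma inverse_poly_nonneg: "0 \<le> t \<Longrightarrow> t \<le> 2 \<Longrightarrow> 0 \<le> poly (inverse_poly N) t"
  unfolding poly_inverse_poly by (intro divide_nonneg_pos sum_nonneg) auto

lemma inverse_poly_mult: "t * poly (inverse_poly N) t = 1 - (1 - t / 2) ^ N"
proof -
  have "(1 - (1 - t / 2)) * (\<Sum>n<N. (1 - t / 2) ^ n) = 1 - (1 - t / 2) ^ N"
    by (subst sum_gp_strict) (simp add: field_simps)
  then show ?thesis unfolding poly_inverse_poly by (simp add: field_simps)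
qed

lemma inverse_poly_SUP:
  assumes "0 \<le> t" "t \<le> 2"
  shows "(SUP N. ennreal (poly (inverse_poly N) t)) = inverse (ennreal t)"
proof -
  have inc: "incseq (\<lambda>N. ennreal (poly (inverse_poly N) t))"
    unfolding poly_inverse_poly using assms
    by (intro incseq_SucI ennreal_leI) (simp add: divide_right_mono)
  have "(\<lambda>N. ennreal (poly (inverse_poly N) t)) \<longlonglongrightarrow> inverse (ennreal t)"
  proof (cases "t = 0")
    case True
    have "filterlim (\<lambda>N. real N * (1/2)) at_top sequentially" by real_asymp
    then have "(\<lambda>N. ennreal (real N * (1/2))) \<longlonglongrightarrow> \<infinity>"
      unfolding infinity_ennreal_def by (rule ennreal_tendsto_top_eq_at_top[THEN iffD2])
    then show ?thesis using True unfolding poly_inverse_poly by simp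
  next
    case False
    then have t: "t > 0" using assms by simp
    have "(\<lambda>N. (1 - (1 - t / 2) ^ N) / t) \<longlonglongrightarrow> (1 - 0) / t"
      using assms t by (intro tendsto_intros LIMSEQ_realpow_zero) auto
    moreover have "(1 - (1 - t / 2) ^ N) / t = poly (inverse_poly N) t" for N
      using inverse_poly_mult[of t N] t by (simp add: field_simps)
    ultimately have "(\<lambda>N. poly (inverse_poly N) t) \<longlonglongrightarrow> inverse t" by (simp add: inverse_eq_divide)
    then have "(\<lambda>N. ennreal (poly (inverse_poly N) t)) \<longlonglongrightarrow> ennreal (inverse t)" by (rule tendsto_ennrealI)
    then show ?thesis using t by (simp add: inverse_ennreal)
  qed
  then show ?thesis using LIMSEQ_unique[OF LIMSEQ_SUP[OF inc]] by blast
qed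

lemma inv_sqrt_poly_tendsto:
  assumes "0 < t" "t \<le> 2"
  shows "(\<lambda>N. poly (inv_sqrt_poly N) t) \<longlonglongrightarrow> t powr (-1/2)"
    and "0 \<le> poly (inv_sqrt_poly N) t" "poly (inv_sqrt_poly N) t \<le> t powr (-1/2)"
    and "(poly (inv_sqrt_poly N) t)\<^sup>2 \<le> inverse t"
proof -
  have s: "(\<lambda>n. binom_coeff n * (1 - t / 2) ^ n) sums ((t / 2) powr (-1/2))"
    using binom_coeff_sums[of "1 - t / 2"] assms by simp
  have e: "(t / 2) powr (-1/2) / sqrt 2 = t powr (-1/2)"
    using assms by (simp add: powr_divide powr_minus powr_half_sqrt field_simps)
  have "(\<lambda>N. (\<Sum>n<N. binom_coeff n * (1 - t / 2) ^ n) / sqrt 2) \<longlonglongrightarrow> (t / 2) powr (-1/2) / sqrt 2"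
    using s unfolding sums_def by (intro tendsto_intros) auto
  then show l: "(\<lambda>N. poly (inv_sqrt_poly N) t) \<longlonglongrightarrow> t powr (-1/2)"
    unfolding poly_inv_sqrt_poly e .
  have nn: "0 \<le> binom_coeff n * (1 - t / 2) ^ n" for n using assms binom_coeff_nonneg by simp
  show 0: "0 \<le> poly (inv_sqrt_poly N) t"
    unfolding poly_inv_sqrt_poly by (intro divide_nonneg_pos sum_nonneg nn) auto
  have "(\<Sum>n<N. binom_coeff n * (1 - t / 2) ^ n) \<le> (t / 2) powr (-1/2)"
    using sum_le_suminf[OF sums_summable[OF s], of "{..<N}"] nn sums_unique[OF s] by auto
  then show 1: "poly (inv_sqrt_poly N) t \<le> t powr (-1/2)"
    unfolding poly_inv_sqrt_poly e[symmetric] by (rule divide_right_mono) simp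
  have "(poly (inv_sqrt_poly N) t)\<^sup>2 \<le> (t powr (-1/2))\<^sup>2" by (intro power_mono 0 1)
  also have "\<dots> = inverse t" using assms by (simp add: powr_minus powr_half_sqrt power_inverse)
  finally show "(poly (inv_sqrt_poly N) t)\<^sup>2 \<le> inverse t" .
qed

context positive_operator
begin

abbreviation "inv_sqrt_dom \<equiv> inv_sqrt_domain M T"

lemma energy:
  assumes f: "f \<in> L2_space M"
  shows "(\<integral>\<^sup>+t. inverse (ennreal t) \<partial>\<nu> f) = (SUP N. ennreal (Re (L2_inner M (op (inverse_poly N) f) f)))"
    and "0 \<le> Re (L2_inner M (op (inverse_poly N) f) f)"
proof -
  have nn: "AE t in \<nu> f. 0 \<le> poly (inverse_poly N) t" for N
    using spectral_support[OF f] by eventually_elim (auto intro: inverse_poly_nonneg)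
  have meas: "poly (inverse_poly N) \<in> borel_measurable (\<nu> f)" for N
    using spectral_integrable_poly[OF f] by (rule borel_measurable_integrable)
  have eq: "Re (L2_inner M (op (inverse_poly N) f) f) = (\<integral>t. poly (inverse_poly N) t \<partial>\<nu> f)" for N
    unfolding spectral_poly[OF f] by simp
  show "0 \<le> Re (L2_inner M (op (inverse_poly N) f) f)"
    unfolding eq by (rule integral_nonneg_AE[OF nn])
  have "(\<integral>\<^sup>+t. inverse (ennreal t) \<partial>\<nu> f) = (\<integral>\<^sup>+t. (SUP N. ennreal (poly (inverse_poly N) t)) \<partial>\<nu> f)"
    by (intro nn_integral_cong_AE eventually_mono[OF spectral_support[OF f]]) (simp add: inverse_poly_SUP)
  also have "\<dots> = (SUP N. \<integral>\<^sup>+t. ennreal (poly (inverse_poly N) t) \<partial>\<nu> f)"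
  proof (rule nn_integral_monotone_convergence_SUP_AE)
    show "AE t in \<nu> f. ennreal (poly (inverse_poly N) t) \<le> ennreal (poly (inverse_poly (Suc N)) t)" for N
      using spectral_support[OF f]
      by eventually_elim (auto intro!: ennreal_leI divide_right_mono simp: poly_inverse_poly)
    show "(\<lambda>t. ennreal (poly (inverse_poly N) t)) \<in> borel_measurable (\<nu> f)" for N
      using meas[of N] by measurable
  qed
  also have "\<dots> = (SUP N. ennreal (Re (L2_inner M (op (inverse_poly N) f) f)))"
    unfolding eq using nn by (simp add: nn_integral_eq_integral spectral_integrable_poly[OF f])
  finally show "(\<integral>\<^sup>+t. inverse (ennreal t) \<partial>\<nu> f) = (SUP N. ennreal (Re (L2_inner M (op (inverse_poly N) f) f)))" .
qed

text \<open>This describes the domain by quadratic forms in \<open>f\<close>, without spectral measures; for sums of vectors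
  the quadratic forms can be handled by the parallelogram law.\<close>

lemma dom_iff: "f \<in> inv_sqrt_dom \<longleftrightarrow> f \<in> L2_space M \<and> (\<exists>C. \<forall>N. Re (L2_inner M (op (inverse_poly N) f) f) \<le> C)"
proof (cases "f \<in> L2_space M")
  case True
  have "(SUP N. ennreal (Re (L2_inner M (op (inverse_poly N) f) f))) < \<infinity> \<longleftrightarrow>
      (\<exists>C. \<forall>N. Re (L2_inner M (op (inverse_poly N) f) f) \<le> C)"
  proof
    assume "(SUP N. ennreal (Re (L2_inner M (op (inverse_poly N) f) f))) < \<infinity>"
    then obtain C where C: "0 \<le> C" "(SUP N. ennreal (Re (L2_inner M (op (inverse_poly N) f) f))) = ennreal C"
      by (cases "(SUP N. ennreal (Re (L2_inner M (op (inverse_poly N) f) f)))") auto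
    have "ennreal (Re (L2_inner M (op (inverse_poly N) f) f)) \<le> ennreal C" for N
      unfolding C(2)[symmetric] by (rule SUP_upper) simp
    then show "\<exists>C. \<forall>N. Re (L2_inner M (op (inverse_poly N) f) f) \<le> C" using C(1) by auto
  next
    assume "\<exists>C. \<forall>N. Re (L2_inner M (op (inverse_poly N) f) f) \<le> C"
    then obtain C where "\<And>N. Re (L2_inner M (op (inverse_poly N) f) f) \<le> C" by blast
    then have "(SUP N. ennreal (Re (L2_inner M (op (inverse_poly N) f) f))) \<le> ennreal C"
      by (intro SUP_least ennreal_leI)
    then show "(SUP N. ennreal (Re (L2_inner M (op (inverse_poly N) f) f))) < \<infinity>"
      by (simp add: le_less_trans)
  qed
  then show ?thesis using True energy(1)[OF True] by (simp add: inv_sqrt_domain_def)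
qed (simp add: inv_sqrt_domain_def)

lemma quadratic_add:
  assumes "f \<in> L2_space M" "g \<in> L2_space M"
  shows "L2_inner M (op p (\<lambda>x. f x + g x)) (\<lambda>x. f x + g x) =
    L2_inner M (op p f) f + L2_inner M (op p f) g + L2_inner M (op p g) f + L2_inner M (op p g) g"
proof -
  note op_L2[OF assms(1)] op_L2[OF assms(2)]
  then show ?thesis unfolding op_f_add using assms
    by (simp add: L2_inner_add_left L2_inner_add_right L2_add)
qed

lemma quadratic_scale:
  "L2_inner M (op p (\<lambda>x. c * f x)) (\<lambda>x. c * f x) = (cmod c)\<^sup>2 * L2_inner M (op p f) f"
  unfolding op_f_scale L2_inner_scale_left L2_inner_scale_right complex_norm_square by simp

lemma dom_add:
  assumes f: "f \<in> inv_sqrt_dom" and g: "g \<in> inv_sqrt_dom"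
  shows "(\<lambda>x. f x + g x) \<in> inv_sqrt_dom"
proof -
  obtain C D where C: "\<And>N. Re (L2_inner M (op (inverse_poly N) f) f) \<le> C"
    and D: "\<And>N. Re (L2_inner M (op (inverse_poly N) g) g) \<le> D"
    using f g unfolding dom_iff by blast
  have L: "f \<in> L2_space M" "g \<in> L2_space M" using f g unfolding dom_iff by auto
  have L': "(\<lambda>x. -1 * g x) \<in> L2_space M" by (rule L2_scale[OF L(2)])
  have "Re (L2_inner M (op (inverse_poly N) (\<lambda>x. f x + g x)) (\<lambda>x. f x + g x)) \<le> 2 * C + 2 * D" for N
  proof -
    have "0 \<le> Re (L2_inner M (op (inverse_poly N) (\<lambda>x. f x + -1 * g x)) (\<lambda>x. f x + -1 * g x))"
      by (rule energy(2)[OF L2_add[OF L(1) L']])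
    then show ?thesis using C[of N] D[of N]
      unfolding quadratic_add[OF L] quadratic_add[OF L(1) L'] op_f_scale L2_inner_scale_left L2_inner_scale_right
      by simp
  qed
  then show ?thesis unfolding dom_iff using L2_add[OF L] by blast
qed

lemma dom_scale: "f \<in> inv_sqrt_dom \<Longrightarrow> (\<lambda>x. c * f x) \<in> inv_sqrt_dom"
  unfolding dom_iff quadratic_scale by (auto intro: L2_scale intro!: mult_left_mono exI[of _ "(cmod c)\<^sup>2 * _"])

text \<open>A vector of the domain has no spectral mass at \<open>0\<close>, the only point of the spectrum at which the polynomials
  \<open>inv_sqrt_poly N\<close> do not converge to \<open>t powr (-1/2)\<close>.\<close>

lemma dom_spectral:
  assumes h: "h \<in> inv_sqrt_dom"
  shows "AE t in \<nu> h. 0 < t \<and> t \<le> 2" "integrable (\<nu> h) inverse"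
proof -
  have L: "h \<in> L2_space M" and fin: "(\<integral>\<^sup>+t. inverse (ennreal t) \<partial>\<nu> h) < \<infinity>"
    using h unfolding inv_sqrt_domain_def by auto
  have "(\<lambda>t. inverse (ennreal t)) \<in> borel_measurable (\<nu> h)"
    by (rule spectral_meas[OF L]) measurable
  then have "AE t in \<nu> h. inverse (ennreal t) \<noteq> \<infinity>" using fin by (intro nn_integral_PInf_AE) auto
  with spectral_support[OF L] show p: "AE t in \<nu> h. 0 < t \<and> t \<le> 2"
  proof eventually_elim
    case (elim t)
    then show ?case by (cases "t = 0") auto
  qed
  have "(\<integral>\<^sup>+t. ennreal (norm (inverse t)) \<partial>\<nu> h) = (\<integral>\<^sup>+t. inverse (ennreal t) \<partial>\<nu> h)"
    by (intro nn_integral_cong_AE eventually_mono[OF p]) (simp add: inverse_ennreal)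
  then show "integrable (\<nu> h) inverse"
    using fin by (intro integrableI_bounded spectral_meas[OF L]) auto
qed

lemma inv_sqrt_poly_bounded:
  assumes h: "h \<in> inv_sqrt_dom"
  shows "(\<integral>x. (cmod (op (inv_sqrt_poly N) h x))\<^sup>2 \<partial>M) \<le> (\<integral>t. inverse t \<partial>\<nu> h)"
proof -
  have L: "h \<in> L2_space M" using h unfolding dom_iff by blast
  have "integrable (\<nu> h) (\<lambda>t. (poly (inv_sqrt_poly N) t)\<^sup>2)"
    by (rule spectral_poly_eq(2)[OF L, of "inv_sqrt_poly N * inv_sqrt_poly N"]) (simp add: power2_eq_square)
  then show ?thesis unfolding spectral_sq[OF L]
    by (intro integral_mono_AE dom_spectral(2)[OF h] eventually_mono[OF dom_spectral(1)[OF h]])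
      (auto intro: inv_sqrt_poly_tendsto(4))
qed

lemma inv_sqrt_poly_quadratic:
  assumes h: "h \<in> inv_sqrt_dom"
  shows "(\<lambda>N. L2_inner M (op (inv_sqrt_poly N) h) h) \<longlonglongrightarrow> complex_of_real (\<integral>t. t powr (-1/2) \<partial>\<nu> h)"
proof -
  have L: "h \<in> L2_space M" using h unfolding dom_iff by blast
  interpret finite_measure "\<nu> h" by (rule spectral_measure[OF L])
  have m: "(\<lambda>t. t powr (-1/2)) \<in> borel_measurable (\<nu> h)" by (rule spectral_meas[OF L]) measurable
  have i: "integrable (\<nu> h) (\<lambda>t. t powr (-1/2))"
  proof (rule Bochner_Integration.integrable_bound[OF _ m])
    show "integrable (\<nu> h) (\<lambda>t. 1 + inverse t)" using dom_spectral(2)[OF h] by simp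
    show "AE t in \<nu> h. norm (t powr (-1/2)) \<le> norm (1 + inverse t)"
      using dom_spectral(1)[OF h]
    proof eventually_elim
      case (elim t)
      \<comment> \<open>This yields \<open>t powr (-1/2) \<le> 1/4 + inverse t\<close>.\<close>
      have "0 \<le> (t powr (-1/2) - 1/2)\<^sup>2" by simp
      moreover have "(t powr (-1/2))\<^sup>2 = inverse t"
        using elim by (simp add: powr_minus powr_half_sqrt power_inverse)
      ultimately show ?case using elim by (simp add: power2_diff power_divide)
    qed
  qed
  have "(\<lambda>N. \<integral>t. poly (inv_sqrt_poly N) t \<partial>\<nu> h) \<longlonglongrightarrow> (\<integral>t. t powr (-1/2) \<partial>\<nu> h)"
  proof (rule integral_dominated_convergence[OF m _ i])
    show "poly (inv_sqrt_poly N) \<in> borel_measurable (\<nu> h)" for N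
      using spectral_integrable_poly[OF L] by (rule borel_measurable_integrable)
    show "AE t in \<nu> h. (\<lambda>N. poly (inv_sqrt_poly N) t) \<longlonglongrightarrow> t powr (-1/2)"
      by (rule eventually_mono[OF dom_spectral(1)[OF h]]) (rule inv_sqrt_poly_tendsto(1); simp)
    show "AE t in \<nu> h. norm (poly (inv_sqrt_poly N) t) \<le> t powr (-1/2)" for N
      using dom_spectral(1)[OF h]
      by eventually_elim (use inv_sqrt_poly_tendsto(2,3) in auto)
  qed
  then show ?thesis unfolding spectral_poly[OF L] by (rule tendsto_of_real)
qed

lemma polarization:
  assumes "f \<in> L2_space M" "g \<in> L2_space M"
  shows "(\<Sum>k<4. \<i> ^ k * L2_inner M (op p (\<lambda>x. f x + \<i> ^ k * g x)) (\<lambda>x. f x + \<i> ^ k * g x)) / 4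
    = L2_inner M (op p f) g"
proof -
  have "L2_inner M (op p (\<lambda>x. f x + c * g x)) (\<lambda>x. f x + c * g x) = 
     L2_inner M (op p f) f + cnj c * L2_inner M (op p f) g + c * L2_inner M (op p g) f
     + c * cnj c * L2_inner M (op p g) g" for c
    using quadratic_add[OF assms(1) L2_scale[OF assms(2), of c], of p]
    by (simp add: op_f_scale L2_inner_scale_left L2_inner_scale_right)
  then show ?thesis
    by (simp only:) (simp add: eval_nat_numeral algebra_simps)
qed

text \<open>The vectors \<open>p\<^sub>N(T) f\<close> are bounded in \<open>L\<^sup>2\<close>, so pointwise convergence is weak convergence. Polarization
  turns \<open>\<langle>p\<^sub>N(T) f, g\<rangle>\<close> into spectral integrals of \<open>p\<^sub>N\<close>, which converge by domination.\<close>

lemma inv_sqrt_op_eq: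
  assumes f: "f \<in> inv_sqrt_dom" and lim: "\<And>x. (\<lambda>N. op (inv_sqrt_poly N) f x) \<longlonglongrightarrow> u x"
    and dense: "\<And>v. v \<in> L2_space M \<Longrightarrow> (\<And>g. g \<in> inv_sqrt_dom \<Longrightarrow> L2_inner M v g = 0) \<Longrightarrow> v = (\<lambda>x. 0)"
  shows "inv_sqrt_op M T f = u"
proof -
  have Lf: "f \<in> L2_space M" using f unfolding dom_iff by blast
  note wc = L2_weak_convergence[OF op_L2[OF Lf] inv_sqrt_poly_bounded[OF f] lim]
  have u: "u \<in> L2_space M" by (rule wc(1)[OF L2_zero])
  define R where "R g = (\<Sum>k<4. \<i> ^ k * complex_of_real
               (\<integral>t. t powr (- 1 / 2) \<partial>spectral_measure M T (\<lambda>x. f x + \<i> ^ k * g x))) / 4" for g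
  have uR: "L2_inner M u g = R g" if g: "g \<in> inv_sqrt_dom" for g
  proof (rule LIMSEQ_unique)
    have Lg: "g \<in> L2_space M" using g unfolding dom_iff by blast
    show "(\<lambda>N. L2_inner M (op (inv_sqrt_poly N) f) g) \<longlonglongrightarrow> L2_inner M u g" by (rule wc(3)[OF Lg])
    show "(\<lambda>N. L2_inner M (op (inv_sqrt_poly N) f) g) \<longlonglongrightarrow> R g"
      unfolding R_def polarization[OF Lf Lg, symmetric]
      by (intro tendsto_divide tendsto_sum tendsto_mult tendsto_const
          inv_sqrt_poly_quadratic dom_add f dom_scale g) auto
  qed
  show ?thesis
    unfolding inv_sqrt_op_def R_def[symmetric]
  proof (rule the_equality)
    show "u \<in> L2_space M \<and> (\<forall>g\<in>inv_sqrt_dom. L2_inner M u g = R g)" using u uR by blast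
    fix v assume v: "v \<in> L2_space M \<and> (\<forall>g\<in>inv_sqrt_dom. L2_inner M v g = R g)"
    have "(\<lambda>x. v x - u x) = (\<lambda>x. 0)"
    proof (rule dense)
      show "(\<lambda>x. v x - u x) \<in> L2_space M" using v u by (intro L2_diff) auto
      fix g assume g: "g \<in> inv_sqrt_dom"
      then have Lg: "g \<in> L2_space M" unfolding dom_iff by blast
      have "L2_inner M (\<lambda>x. v x + -1 * u x) g = L2_inner M v g - L2_inner M u g"
        using v by (simp only: L2_inner_add_left[OF _ L2_scale[OF u] Lg] L2_inner_scale_left) simp
      then show "L2_inner M (\<lambda>x. v x - u x) g = 0" using v uR g by simp
    qed
    then show "v = u" by (auto simp: fun_eq_iff)
  qed
qed

end

section \<open>Shift, averaging and Laplacian of a parent map\<close>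

text \<open>With \<open>A f = f \<circ> par\<close>, the measure is invariant under \<open>par\<close>, so \<open>A\<close> is an isometry of \<open>L\<^sup>1\<close> and \<open>L\<^sup>2\<close>. Its adjoint
  averages over the children.\<close>

locale parent_tree =
  fixes q :: nat and par :: "'v \<Rightarrow> 'v" and l :: "'v \<Rightarrow> int"
  assumes q2: "2 \<le> q"
    and l_par: "l (par x) = l x + 1"
    and card_children: "card {y. par y = x} = q"
begin

abbreviation M :: "'v measure" where "M \<equiv> level_measure q l"

definition w :: "'v \<Rightarrow> real" where "w x = real q powi l x"

lemma w_pos: "0 < w x"
  unfolding w_def using q2 by simp

lemma w_par: "w (par x) = real q * w x"
  unfolding w_def l_par using q2 by (simp add: power_int_add)

lemma finite_children: "finite {y. par y = x}"
  using card_children[of x] q2 by (intro card_ge_0_finite) simp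

lemma M_eq: "M = density (count_space UNIV) (\<lambda>x. ennreal (w x))"
  by (simp add: level_measure_def point_measure_def w_def)

lemma sets_M[simp]: "sets M = UNIV" and space_M[simp]: "space M = UNIV"
  by (simp_all add: M_eq)

lemma measurable_M[simp, measurable]: "f \<in> measurable M N \<longleftrightarrow> range f \<subseteq> space N"
  by (auto simp: measurable_def)

lemma AE_M[simp]: "(AE x in M. P x) \<longleftrightarrow> (\<forall>x. P x)"
  unfolding M_eq by (subst AE_density) (auto simp: AE_count_space w_pos)

lemma nn_M: "(\<integral>\<^sup>+x. f x \<partial>M) = (\<integral>\<^sup>+x. ennreal (w x) * f x \<partial>count_space UNIV)"
  by (simp add: M_eq nn_integral_density)

lemma nn_finite_support:
  assumes "finite F" "\<And>x. x \<notin> F \<Longrightarrow> f x = 0" "\<And>x. 0 \<le> f x"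
  shows "(\<integral>\<^sup>+x. ennreal (f x) \<partial>M) = ennreal (\<Sum>x\<in>F. w x * f x)"
  unfolding nn_M using assms w_pos
  by (subst nn_integral_count_space'[OF assms(1)])
    (auto simp: sum_ennreal[symmetric] less_imp_le ennreal_mult)

lemma integral_finite_support:
  fixes f :: "'v \<Rightarrow> 'b::{banach, second_countable_topology}"
  assumes "finite F" "\<And>x. x \<notin> F \<Longrightarrow> f x = 0"
  shows "integrable M f" "(\<integral>x. f x \<partial>M) = (\<Sum>x\<in>F. w x *\<^sub>R f x)"
proof -
  show "integrable M f"
    using nn_finite_support[OF assms(1), of "\<lambda>x. norm (f x)"] assms(2) by (intro integrableI_bounded) auto
  have "(\<integral>x. f x \<partial>M) = (\<integral>x. w x *\<^sub>R f x \<partial>count_space UNIV)"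
    unfolding M_eq using w_pos by (subst integral_density) (auto simp: less_imp_le)
  also have "\<dots> = (\<Sum>x\<in>{x. w x *\<^sub>R f x \<noteq> 0}. w x *\<^sub>R f x)"
    using assms by (subst lebesgue_integral_count_space_finite_support) (auto intro: finite_subset[of _ F])
  also have "\<dots> = (\<Sum>x\<in>F. w x *\<^sub>R f x)"
    using assms by (intro sum.mono_neutral_left) auto
  finally show "(\<integral>x. f x \<partial>M) = (\<Sum>x\<in>F. w x *\<^sub>R f x)" .
qed

lemma emeasure_finite:
  assumes "finite F" shows "emeasure M F = ennreal (\<Sum>x\<in>F. w x)"
proof -
  have "emeasure M F = (\<integral>\<^sup>+x. ennreal (indicator F x) \<partial>M)" by (simp add: ennreal_indicator)
  also have "\<dots> = ennreal (\<Sum>x\<in>F. w x * indicator F x)"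
    using assms by (intro nn_finite_support) auto
  finally show ?thesis by simp
qed

lemma sum_le_integral:
  fixes f :: "'v \<Rightarrow> 'b::{banach, second_countable_topology}"
  assumes "integrable M f" "finite F"
  shows "(\<Sum>x\<in>F. w x * norm (f x)) \<le> (\<integral>x. norm (f x) \<partial>M)"
proof -
  have "(\<Sum>x\<in>F. w x * norm (f x)) = (\<Sum>x\<in>F. w x *\<^sub>R (norm (f x) * indicator F x))"
    by (intro sum.cong) auto
  also have "\<dots> = (\<integral>x. norm (f x) * indicator F x \<partial>M)"
    using assms(2) by (subst integral_finite_support(2)[OF assms(2)]) auto
  also have "\<dots> \<le> (\<integral>x. norm (f x) \<partial>M)"
  proof (rule integral_mono)
    show "integrable M (\<lambda>x. norm (f x) * indicator F x)"
      by (rule integral_finite_support(1)[OF assms(2)]) simp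
  qed (use integrable_norm[OF assms(1)] in \<open>auto simp: indicator_def\<close>)
  finally show ?thesis .
qed

subsection \<open>Passing to the parent, and averaging over the children\<close>

definition avg :: "('v \<Rightarrow> 'b) \<Rightarrow> 'v \<Rightarrow> 'b::real_normed_field" where
  "avg f x = (\<Sum>y | par y = x. f y) / of_nat q"

lemma nn_fibre:
  "(\<integral>\<^sup>+x. \<phi> x \<partial>count_space UNIV) = (\<integral>\<^sup>+y. (\<Sum>x | par x = y. \<phi> x) \<partial>count_space UNIV)"
proof -
  define f where "f = (\<lambda>(x, y). \<phi> x * indicator {par x} y)"
  have "(\<integral>\<^sup>+y. f (x, y) \<partial>count_space UNIV) = \<phi> x" for x
    by (subst nn_integral_count_space'[of "{par x}"]) (auto simp: f_def)
  moreover have "(\<integral>\<^sup>+x. f (x, y) \<partial>count_space UNIV) = (\<Sum>x | par x = y. \<phi> x)" for y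
    by (subst nn_integral_count_space'[OF finite_children[of y]]) (auto simp: f_def)
  ultimately show ?thesis
    using nn_integral_fst_count_space[of f] nn_integral_snd_count_space[of f] by simp
qed

lemma nn_par: "(\<integral>\<^sup>+x. F (par x) \<partial>M) = (\<integral>\<^sup>+x. F x \<partial>M)"
  unfolding nn_M
proof (subst nn_fibre, rule nn_integral_cong)
  fix y
  have "(\<Sum>x | par x = y. ennreal (w x) * F (par x)) = (\<Sum>x | par x = y. ennreal (w y / q) * F y)"
    using q2 by (intro sum.cong) (auto simp: w_par)
  also have "\<dots> = (of_nat q * ennreal (w y / q)) * F y" by (simp add: card_children mult.assoc)
  also have "of_nat q * ennreal (w y / q) = ennreal (w y)"
    using q2 w_pos[of y] by (simp add: ennreal_of_nat_eq_real_of_nat ennreal_mult[symmetric] less_imp_le)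
  finally show "(\<Sum>x | par x = y. ennreal (w x) * F (par x)) = ennreal (w y) * F y" .
qed

lemma distr_par: "distr M M par = M"
proof (rule measure_eqI)
  fix A
  have "emeasure (distr M M par) A = (\<integral>\<^sup>+x. indicator A (par x) \<partial>M)"
    by (subst emeasure_distr) (auto simp: indicator_vimage[symmetric])
  also have "\<dots> = emeasure M A" unfolding nn_par by simp
  finally show "emeasure (distr M M par) A = emeasure M A" .
qed simp

lemma integrable_par: "integrable M f \<Longrightarrow> integrable M (\<lambda>x. f (par x))"
  for f :: "'v \<Rightarrow> 'b::{banach, second_countable_topology}"
  using integrable_distr[of par M M f] by (simp add: distr_par)

lemma integral_par: "(\<integral>x. f (par x) \<partial>M) = (\<integral>x. f x \<partial>M)"
  for f :: "'v \<Rightarrow> 'b::{banach, second_countable_topology}"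
  using integral_distr[of par M M f] by (simp add: distr_par)

lemma avg_nonneg: "(\<And>x. 0 \<le> f x) \<Longrightarrow> 0 \<le> avg f x" for f :: "'v \<Rightarrow> real"
  unfolding avg_def by (intro divide_nonneg_nonneg sum_nonneg) auto

lemma norm_avg: "norm (avg f x) \<le> avg (\<lambda>x. norm (f x)) x"
  unfolding avg_def using norm_sum[of f] by (simp add: norm_divide divide_right_mono)

lemma nn_avg:
  assumes "\<And>x. 0 \<le> f x"
  shows "(\<integral>\<^sup>+x. ennreal (avg f x) \<partial>M) = (\<integral>\<^sup>+x. ennreal (f x) \<partial>M)"
  unfolding nn_M
proof (subst (2) nn_fibre, rule nn_integral_cong)
  fix y
  have "(\<Sum>x | par x = y. ennreal (w x) * ennreal (f x)) = (\<Sum>x | par x = y. ennreal (w y / q * f x))"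
    using q2 w_pos assms by (intro sum.cong) (auto simp: w_par ennreal_mult less_imp_le)
  also have "\<dots> = ennreal (\<Sum>x | par x = y. w y / q * f x)"
    using w_pos assms by (intro sum_ennreal) (auto simp: less_imp_le)
  also have "(\<Sum>x | par x = y. w y / q * f x) = w y * avg f y"
    by (simp add: avg_def sum_distrib_left sum_divide_distrib)
  finally show "ennreal (w y) * ennreal (avg f y) = (\<Sum>x | par x = y. ennreal (w x) * ennreal (f x))"
    using w_pos[of y] avg_nonneg[of f, OF assms] by (simp add: ennreal_mult less_imp_le)
qed

lemma integrable_avg:
  fixes f :: "'v \<Rightarrow> 'b::{real_normed_field, banach, second_countable_topology}"
  assumes "integrable M f" shows "integrable M (avg f)"
proof (rule integrableI_bounded)
  have "(\<integral>\<^sup>+x. ennreal (norm (avg f x)) \<partial>M) \<le> (\<integral>\<^sup>+x. ennreal (avg (\<lambda>x. norm (f x)) x) \<partial>M)"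
    by (intro nn_integral_mono ennreal_leI norm_avg)
  also have "\<dots> = (\<integral>\<^sup>+x. ennreal (norm (f x)) \<partial>M)" by (rule nn_avg) simp
  also have "\<dots> < \<infinity>" using assms by (simp add: integrable_iff_bounded)
  finally show "(\<integral>\<^sup>+x. ennreal (norm (avg f x)) \<partial>M) < \<infinity>" .
qed simp

lemma avg_diff: "avg (\<lambda>x. f x - g x) = (\<lambda>x. avg f x - avg g x)"
  and avg_add: "avg (\<lambda>x. f x + g x) = (\<lambda>x. avg f x + avg g x)"
  and avg_scale: "avg (\<lambda>x. c * f x) = (\<lambda>x. c * avg f x)"
  unfolding avg_def by (auto simp: sum_subtractf sum.distrib diff_divide_distrib add_divide_distrib sum_distrib_left)

lemma integral_avg_real:
  fixes f :: "'v \<Rightarrow> real"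
  assumes f: "integrable M f" shows "(\<integral>x. avg f x \<partial>M) = (\<integral>x. f x \<partial>M)"
proof -
  have *: "(\<integral>x. avg g x \<partial>M) = (\<integral>x. g x \<partial>M)" if "\<And>x. 0 \<le> g x" for g :: "'v \<Rightarrow> real"
    by (subst (1 2) integral_eq_nn_integral) (simp_all add: nn_avg avg_nonneg that)
  define g h where "g x = max 0 (f x)" and "h x = max 0 (- f x)" for x
  have p: "integrable M g" "integrable M h" unfolding g_def h_def using integrable_max[OF integrable_zero f] integrable_max[OF integrable_zero integrable_minus[OF f]] by simp_all
  have e: "f = (\<lambda>x. g x - h x)" unfolding g_def h_def by (rule ext) (simp add: max_def)
  have nn: "0 \<le> g x" "0 \<le> h x" for x unfolding g_def h_def by simp_all
  have "(\<integral>x. avg f x \<partial>M) = (\<integral>x. avg g x - avg h x \<partial>M)"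
    unfolding e avg_diff ..
  also have "\<dots> = (\<integral>x. g x \<partial>M) - (\<integral>x. h x \<partial>M)"
    by (simp only: Bochner_Integration.integral_diff[OF integrable_avg[OF p(1)] integrable_avg[OF p(2)]] *[OF nn(1)] *[OF nn(2)])
  also have "\<dots> = (\<integral>x. f x \<partial>M)" unfolding e by (rule Bochner_Integration.integral_diff[symmetric, OF p])
  finally show ?thesis .
qed

lemma integral_avg:
  fixes f :: "'v \<Rightarrow> complex"
  assumes f: "integrable M f" shows "(\<integral>x. avg f x \<partial>M) = (\<integral>x. f x \<partial>M)"
proof (rule complex_eqI)
  have r: "Re (avg f x) = avg (\<lambda>x. Re (f x)) x" "Im (avg f x) = avg (\<lambda>x. Im (f x)) x" for x
    unfolding avg_def by simp_all
  show "Re (\<integral>x. avg f x \<partial>M) = Re (\<integral>x. f x \<partial>M)"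
    unfolding integral_Re[OF f, symmetric] integral_Re[OF integrable_avg[OF f], symmetric] r
    by (rule integral_avg_real[OF integrable_Re[OF f]])
  show "Im (\<integral>x. avg f x \<partial>M) = Im (\<integral>x. f x \<partial>M)"
    unfolding integral_Im[OF f, symmetric] integral_Im[OF integrable_avg[OF f], symmetric] r
    by (rule integral_avg_real[OF integrable_Im[OF f]])
qed

lemma L2_iff: "f \<in> L2_space M \<longleftrightarrow> integrable M (\<lambda>x. (cmod (f x))\<^sup>2)"
  by (simp add: L2_space_def)

lemma par_L2: "f \<in> L2_space M \<Longrightarrow> (\<lambda>x. f (par x)) \<in> L2_space M"
  unfolding L2_iff by (rule integrable_par)

lemma avg_L2:
  assumes "f \<in> L2_space M" shows "avg f \<in> L2_space M"
  unfolding L2_iff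
proof (rule Bochner_Integration.integrable_bound)
  show "integrable M (avg (\<lambda>x. (cmod (f x))\<^sup>2))" using assms unfolding L2_iff by (rule integrable_avg)
  show "AE x in M. norm ((cmod (avg f x))\<^sup>2) \<le> norm (avg (\<lambda>x. (cmod (f x))\<^sup>2) x)"
  proof (simp, intro allI)
    fix x
    have "(cmod (avg f x))\<^sup>2 \<le> (avg (\<lambda>x. cmod (f x)) x)\<^sup>2" by (intro power_mono norm_avg) simp
    also have "\<dots> = (\<Sum>y | par y = x. cmod (f y))\<^sup>2 / (real q)\<^sup>2"
      by (simp add: avg_def power_divide)
    also have "\<dots> \<le> ((\<Sum>y | par y = x. (cmod (f y))\<^sup>2) * real q) / (real q)\<^sup>2"
      using sum_squared_le_sum_of_squares[of "\<lambda>y. cmod (f y)" "{y. par y = x}"] card_children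
      by (intro divide_right_mono) (auto simp: mult.commute)
    also have "\<dots> = avg (\<lambda>x. (cmod (f x))\<^sup>2) x"
      using q2 by (simp add: avg_def power2_eq_square)
    finally show "(cmod (avg f x))\<^sup>2 \<le> \<bar>avg (\<lambda>x. (cmod (f x))\<^sup>2) x\<bar>" by simp
  qed
qed simp

lemma avg_par: "avg (\<lambda>x. f (par x) * g x) x = f x * avg g x"
proof -
  have "(\<Sum>y | par y = x. f (par y) * g y) = (\<Sum>y | par y = x. f x * g y)" by (rule sum.cong) auto
  then show ?thesis by (simp add: avg_def sum_distrib_left)
qed

lemma avg_par1: "avg (\<lambda>x. f (par x)) x = f x"
  using avg_par[of f "\<lambda>_. 1" x] q2 by (simp add: avg_def card_children)

lemma adjoint:
  assumes "f \<in> L2_space M" "g \<in> L2_space M"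
  shows "L2_inner M (\<lambda>x. f (par x)) g = L2_inner M f (avg g)"
proof -
  have "f x * cnj (avg g x) = avg (\<lambda>x. f (par x) * cnj (g x)) x" for x
    unfolding avg_par by (simp add: avg_def sum_distrib_left)
  then have "L2_inner M f (avg g) = (\<integral>x. avg (\<lambda>x. f (par x) * cnj (g x)) x \<partial>M)"
    unfolding L2_inner_def by (simp only:)
  also have "\<dots> = L2_inner M (\<lambda>x. f (par x)) g"
    unfolding L2_inner_def by (intro integral_avg L2_integrable_mult par_L2 assms)
  finally show ?thesis ..
qed

definition lap :: "('v \<Rightarrow> complex) \<Rightarrow> 'v \<Rightarrow> complex" where
  "lap f x = f x - (f (par x) + avg f x) / 2"

lemma lap_eq: "lap f = (\<lambda>x. f x + (-1/2) * (f (par x) + avg f x))"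
  by (auto simp: lap_def)

lemma lap_L2: "f \<in> L2_space M \<Longrightarrow> lap f \<in> L2_space M"
  unfolding lap_eq by (intro L2_add L2_scale par_L2 avg_L2)

lemma lap_inner:
  assumes f: "f \<in> L2_space M" and g: "g \<in> L2_space M"
  shows "L2_inner M (lap f) g = L2_inner M f g - (L2_inner M (\<lambda>x. f (par x)) g + L2_inner M (avg f) g) / 2"
  unfolding lap_eq using f g
  by (simp only: L2_inner_add_left L2_inner_scale_left L2_add L2_scale par_L2 avg_L2) (simp add: field_simps)

lemma avg_inner:
  assumes f: "f \<in> L2_space M" and g: "g \<in> L2_space M"
  shows "L2_inner M (avg f) g = L2_inner M f (\<lambda>x. g (par x))"
  using adjoint[OF g f] by (metis L2_inner_cnj)

lemma norm_par_pm:
  assumes f: "f \<in> L2_space M"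
  shows "(\<integral>x. (cmod (f (par x) + c * f x))\<^sup>2 \<partial>M) =
    (1 + (cmod c)\<^sup>2) * Re (L2_inner M f f) + 2 * Re (cnj c * L2_inner M (\<lambda>x. f (par x)) f)"
proof -
  note p = par_L2[OF f] and s = L2_scale[OF f, of c]
  have "(\<integral>x. (cmod (f (par x) + c * f x))\<^sup>2 \<partial>M) = Re (L2_inner M (\<lambda>x. f (par x) + c * f x) (\<lambda>x. f (par x) + c * f x))"
    by (simp add: L2_inner_self)
  also have "L2_inner M (\<lambda>x. f (par x) + c * f x) (\<lambda>x. f (par x) + c * f x)
      = L2_inner M (\<lambda>x. f (par x)) (\<lambda>x. f (par x)) + cnj c * L2_inner M (\<lambda>x. f (par x)) f
        + (cnj (cnj c * L2_inner M (\<lambda>x. f (par x)) f) + c * cnj c * L2_inner M f f)"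
    by (simp only: L2_inner_add_left[OF p s L2_add[OF p s]] L2_inner_add_right[OF p p s]
        L2_inner_add_right[OF f p s] L2_inner_scale_left L2_inner_scale_right L2_inner_cnj[of M f "\<lambda>x. f (par x)"])
      (simp add: algebra_simps)
  also have "L2_inner M (\<lambda>x. f (par x)) (\<lambda>x. f (par x)) = L2_inner M f f"
    unfolding L2_inner_def by (rule integral_par)
  also have "c * cnj c = complex_of_real ((cmod c)\<^sup>2)" by (simp add: complex_norm_square[symmetric])
  finally show ?thesis by (simp add: algebra_simps)
qed

text \<open>As \<open>A\<close> is an isometry, \<open>2 lap = (A - 1)* (A - 1)\<close> and \<open>2 (2 - lap) = (A + 1)* (A + 1)\<close>.\<close>

lemma lap_energy:
  assumes f: "f \<in> L2_space M"
  shows "(\<integral>x. (cmod (f (par x) - f x))\<^sup>2 \<partial>M) = 2 * Re (L2_inner M (lap f) f)"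
    and "(\<integral>x. (cmod (f (par x) + f x))\<^sup>2 \<partial>M) = 4 * Re (L2_inner M f f) - 2 * Re (L2_inner M (lap f) f)"
proof -
  have "Re (L2_inner M (avg f) f) = Re (L2_inner M (\<lambda>x. f (par x)) f)"
    unfolding avg_inner[OF f f] by (subst L2_inner_cnj) simp
  then have "2 * Re (L2_inner M (lap f) f) = 2 * Re (L2_inner M f f) - 2 * Re (L2_inner M (\<lambda>x. f (par x)) f)"
    unfolding lap_inner[OF f f] by simp
  then show "(\<integral>x. (cmod (f (par x) - f x))\<^sup>2 \<partial>M) = 2 * Re (L2_inner M (lap f) f)"
    "(\<integral>x. (cmod (f (par x) + f x))\<^sup>2 \<partial>M) = 4 * Re (L2_inner M f f) - 2 * Re (L2_inner M (lap f) f)"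
    using norm_par_pm[OF f, of "-1"] norm_par_pm[OF f, of 1] by simp_all
qed

sublocale positive_operator M lap
proof
  show "lap (\<lambda>x. f x + g x) = (\<lambda>x. lap f x + lap g x)" for f g
    by (auto simp: lap_def avg_add field_simps)
  show "lap (\<lambda>x. c * f x) = (\<lambda>x. c * lap f x)" for c f
    by (auto simp: lap_def avg_scale field_simps)
  show "lap f \<in> L2_space M" if "f \<in> L2_space M" for f using that by (rule lap_L2)
  show "L2_inner M (lap f) g = L2_inner M f (lap g)" if f: "f \<in> L2_space M" and g: "g \<in> L2_space M" for f g
  proof -
    have "L2_inner M f (lap g) = cnj (L2_inner M (lap g) f)" by (rule L2_inner_cnj)
    also have "\<dots> = cnj (L2_inner M g f) - (cnj (L2_inner M (\<lambda>x. g (par x)) f) + cnj (L2_inner M (avg g) f)) / 2"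
      unfolding lap_inner[OF g f] by simp
    also have "\<dots> = L2_inner M (lap f) g"
      unfolding lap_inner[OF f g] L2_inner_cnj[symmetric] adjoint[OF f g] avg_inner[OF f g] by simp
    finally show ?thesis ..
  qed
  show "0 \<le> Re (L2_inner M (lap f) f)" if "f \<in> L2_space M" for f
  proof -
    have "0 \<le> (\<integral>x. (cmod (f (par x) - f x))\<^sup>2 \<partial>M)" by simp
    then show ?thesis unfolding lap_energy(1)[OF that] by simp
  qed
  show "Re (L2_inner M (lap f) f) \<le> 2 * Re (L2_inner M f f)" if "f \<in> L2_space M" for f
  proof -
    have "0 \<le> (\<integral>x. (cmod (f (par x) + f x))\<^sup>2 \<partial>M)" by simp
    then show ?thesis unfolding lap_energy(2)[OF that] by simp
  qed
qed

subsection \<open>Iterates\<close>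

definition desc :: "nat \<Rightarrow> 'v \<Rightarrow> 'v set" where "desc j x = {y. (par ^^ j) y = x}"

lemma l_par_pow: "l ((par ^^ j) x) = l x + int j"
  by (induction j) (auto simp: l_par)

lemma w_par_pow: "w ((par ^^ j) x) = real q ^ j * w x"
  by (induction j) (auto simp: w_par)

lemma desc_Suc: "desc (Suc j) x = (\<Union>y\<in>{y. par y = x}. desc j y)"
  by (auto simp: desc_def)

lemma finite_desc: "finite (desc j x)"
proof (induction j arbitrary: x)
  case 0 then show ?case by (simp add: desc_def)
next
  case (Suc j) then show ?case unfolding desc_Suc using finite_children by simp
qed

lemma l_desc: "y \<in> desc j x \<Longrightarrow> l y = l x - int j"
  using l_par_pow[of j y] by (auto simp: desc_def)

lemma desc_disjoint: "i \<noteq> j \<Longrightarrow> desc i x \<inter> desc j x = {}"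
  using l_desc[of _ i x] l_desc[of _ j x] by fastforce

lemma w_desc: "y \<in> desc j x \<Longrightarrow> w x = real q ^ j * w y"
  using w_par_pow[of j y] by (auto simp: desc_def)

lemma avg_pow: "(avg ^^ j) f x = (\<Sum>y\<in>desc j x. f y) / of_nat q ^ j"
proof (induction j arbitrary: x)
  case 0 then show ?case by (simp add: desc_def)
next
  case (Suc j)
  have "(\<Sum>y\<in>desc (Suc j) x. f y) = (\<Sum>z | par z = x. \<Sum>y\<in>desc j z. f y)"
    unfolding desc_Suc by (subst sum.UNION_disjoint) (auto simp: finite_children finite_desc, auto simp: desc_def)
  then show ?case using Suc by (simp add: avg_def sum_divide_distrib divide_divide_eq_left mult.commute)
qed

lemma card_desc: "card (desc j x) = q ^ j"
proof (induction j arbitrary: x)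
  case 0 then show ?case by (simp add: desc_def)
next
  case (Suc j)
  have "card (desc (Suc j) x) = (\<Sum>y | par y = x. card (desc j y))"
    unfolding desc_Suc by (rule card_UN_disjoint) (auto simp: finite_children finite_desc, auto simp: desc_def)
  then show ?case using Suc by (simp add: card_children)
qed

lemma w_avg_pow: "of_real (w x) * (avg ^^ j) f x = (\<Sum>y\<in>desc j x. of_real (w y) * f y)"
proof -
  have "(\<Sum>y\<in>desc j x. of_real (w y) * f y) = (\<Sum>y\<in>desc j x. of_real (w x) * f y / of_nat q ^ j)"
    using q2 by (intro sum.cong refl) (simp add: w_desc)
  then show ?thesis by (simp add: avg_pow sum_divide_distrib sum_distrib_left)
qed

text \<open>The sets of descendants of \<open>x\<close> at different depths are disjoint, hence all averages of \<open>f\<close> below \<open>x\<close> together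
  are controlled by a single \<open>L\<^sup>1\<close> norm. This makes the kernel operators below converge on all of \<open>L\<^sup>1\<close>.\<close>

lemma sum_avg_pow_le:
  fixes f :: "'v \<Rightarrow> 'b::{real_normed_field, banach, second_countable_topology}"
  assumes f: "integrable M f"
  shows "(\<Sum>j<J. norm ((avg ^^ j) f x)) \<le> (\<integral>x. norm (f x) \<partial>M) / w x"
proof -
  have "w x * norm ((avg ^^ j) f x) \<le> (\<Sum>y\<in>desc j x. w y * norm (f y))" for j
    using norm_sum[of "\<lambda>y. of_real (w y) * f y" "desc j x"] w_pos
    unfolding w_avg_pow[symmetric] by (simp add: norm_mult less_imp_le)
  then have "w x * (\<Sum>j<J. norm ((avg ^^ j) f x)) \<le> (\<Sum>j<J. \<Sum>y\<in>desc j x. w y * norm (f y))"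
    unfolding sum_distrib_left by (intro sum_mono)
  also have "\<dots> = (\<Sum>y\<in>(\<Union>j<J. desc j x). w y * norm (f y))"
    by (rule sum.UNION_disjoint[symmetric]) (use desc_disjoint in \<open>auto simp: finite_desc\<close>)
  also have "\<dots> \<le> (\<integral>x. norm (f x) \<partial>M)"
    by (rule sum_le_integral[OF f]) (simp add: finite_desc)
  finally show ?thesis using w_pos[of x] by (simp add: pos_le_divide_eq mult.commute)
qed

lemma nn_par_pow: "(\<integral>\<^sup>+x. F ((par ^^ i) x) \<partial>M) = (\<integral>\<^sup>+x. F x \<partial>M)"
proof (induction i arbitrary: F)
  case (Suc i)
  then show ?case using nn_par[of F] Suc[of "\<lambda>x. F (par x)"] by simp
qed simp

lemma nn_avg_pow_le:
  "(\<integral>\<^sup>+x. ennreal (norm ((avg ^^ j) f x)) \<partial>M) \<le> (\<integral>\<^sup>+x. ennreal (norm (f x)) \<partial>M)"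
proof (induction j)
  case (Suc j)
  have "(\<integral>\<^sup>+x. ennreal (norm ((avg ^^ Suc j) f x)) \<partial>M) \<le> (\<integral>\<^sup>+x. ennreal (avg (\<lambda>x. norm ((avg ^^ j) f x)) x) \<partial>M)"
    by (intro nn_integral_mono ennreal_leI) (simp add: norm_avg)
  also have "\<dots> = (\<integral>\<^sup>+x. ennreal (norm ((avg ^^ j) f x)) \<partial>M)" by (rule nn_avg) simp
  finally show ?case using Suc by (rule order_trans)
qed simp

end

section \<open>The kernel of the inverse square root\<close>

text \<open>The coefficients of \<open>(1 - t/2)\<^sup>n\<close> with respect to the Chebyshev polynomials of the second kind in \<open>1 - t\<close>;
  the recursion is \<open>1 - t/2 = 1/2 + (1 - t)/2\<close> and \<open>2 x U\<^sub>m = U\<^sub>m\<^sub>+\<^sub>1 + U\<^sub>m\<^sub>-\<^sub>1\<close>.\<close>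

fun cheb_coeff :: "nat \<Rightarrow> nat \<Rightarrow> real" where
  "cheb_coeff 0 m = (if m = 0 then 1 else 0)"
| "cheb_coeff (Suc n) m = cheb_coeff n m / 2 + ((if m = 0 then 0 else cheb_coeff n (m - 1)) + cheb_coeff n (Suc m)) / 4"

lemma cheb_coeff_eq_0: "n < m \<Longrightarrow> cheb_coeff n m = 0"
  by (induction n arbitrary: m) auto

text \<open>The Chebyshev coefficients of \<open>t\<^sup>-\<^sup>1\<^sup>/\<^sup>2\<close>, i.e. \<open>(2/\<pi>) \<integral> (1 - cos s)\<^sup>-\<^sup>1\<^sup>/\<^sup>2 sin ((m + 1) s) sin s ds\<close> over \<open>[0, \<pi>]\<close>.\<close>

definition kappa :: "nat \<Rightarrow> real" where
  "kappa m = sqrt 2 / pi * (1 / (real m + 1/2) + 1 / (real m + 3/2))"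

lemma integral_cos_nat: "((\<lambda>t. cos (real k * t)) has_integral (if k = 0 then pi else 0)) {0..pi}"
proof (cases "k = 0")
  case True
  then show ?thesis using has_integral_const_real[of "1::real" 0 pi] by simp
next
  case False
  have "((\<lambda>t. cos (real k * t)) has_integral (sin (real k * pi) / real k - sin (real k * 0) / real k)) {0..pi}"
    using False
    by (intro fundamental_theorem_of_calculus)
      (auto intro!: derivative_eq_intros simp: has_real_derivative_iff_has_vector_derivative[symmetric])
  then show ?thesis using False by simp
qed

lemma cheb_coeff_integral:
  "((\<lambda>t. ((1 + cos t) / 2) ^ n * sin (real (Suc m) * t) * sin t) has_integral (pi / 2 * cheb_coeff n m)) {0..pi}"
proof (induction n arbitrary: m)
  case 0
  have "((\<lambda>t. (cos (real m * t) - cos (real (m + 2) * t)) / 2) has_integral ((if m = 0 then pi else 0) - (if m + 2 = 0 then pi else 0)) / 2) {0..pi}"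
    by (intro has_integral_divide has_integral_diff integral_cos_nat)
  moreover have "(cos (real m * t) - cos (real (m + 2) * t)) / 2 = sin (real (Suc m) * t) * sin t" for t
    using cos_add[of "real (Suc m) * t" t] cos_diff[of "real (Suc m) * t" t] by (simp add: algebra_simps)
  ultimately show ?case by (simp split: if_splits)
next
  case (Suc n)
  let ?g = "\<lambda>m t. ((1 + cos t) / 2) ^ n * sin (real (Suc m) * t) * sin t"
  have p: "((\<lambda>t. if m = 0 then 0 else ?g (m - 1) t) has_integral (pi / 2 * (if m = 0 then 0 else cheb_coeff n (m - 1)))) {0..pi}"
    using Suc[of "m - 1"] by (cases "m = 0") auto
  have int: "((\<lambda>t. ?g m t / 2 + ((if m = 0 then 0 else ?g (m - 1) t) + ?g (Suc m) t) / 4) has_integral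
     (pi / 2 * cheb_coeff n m / 2 + (pi / 2 * (if m = 0 then 0 else cheb_coeff n (m - 1)) + pi / 2 * cheb_coeff n (Suc m)) / 4)) {0..pi}"
    by (intro has_integral_add has_integral_divide Suc p)
  have fe: "?g m t / 2 + ((if m = 0 then 0 else ?g (m - 1) t) + ?g (Suc m) t) / 4
      = ((1 + cos t) / 2) ^ Suc n * sin (real (Suc m) * t) * sin t" for t
  proof -
    have "(if m = 0 then 0 else ?g (m - 1) t) = ((1 + cos t) / 2) ^ n * sin (real m * t) * sin t" by auto
    moreover have "sin (real m * t) + sin (real (Suc (Suc m)) * t) = 2 * cos t * sin (real (Suc m) * t)"
      using sin_add[of "real (Suc m) * t" t] sin_diff[of "real (Suc m) * t" t] by (simp add: algebra_simps)
    moreover have "?g m t / 2 + (((1 + cos t) / 2) ^ n * sin (real m * t) * sin t + ?g (Suc m) t) / 4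
      = ((1 + cos t) / 2) ^ n * sin t * (sin (real (Suc m) * t) / 2 + (sin (real m * t) + sin (real (Suc (Suc m)) * t)) / 4)"
      by (simp add: algebra_simps)
    ultimately show ?thesis by (simp add: algebra_simps)
  qed
  have ve: "pi / 2 * cheb_coeff n m / 2 + (pi / 2 * (if m = 0 then 0 else cheb_coeff n (m - 1)) + pi / 2 * cheb_coeff n (Suc m)) / 4
      = pi / 2 * cheb_coeff (Suc n) m"
    by (simp add: algebra_simps)
  show ?case using int by (simp only: fe ve)
qed

definition inv_sqrt_coeff :: "nat \<Rightarrow> nat \<Rightarrow> real" where
  "inv_sqrt_coeff N m = (\<Sum>n<N. binom_coeff n * cheb_coeff n m) / sqrt 2"

lemma inv_sqrt_coeff_eq_0: "N \<le> m \<Longrightarrow> inv_sqrt_coeff N m = 0"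
  unfolding inv_sqrt_coeff_def by (simp add: cheb_coeff_eq_0)

lemma inv_sqrt_coeff_integral:
  "((\<lambda>t. poly (inv_sqrt_poly N) (1 - cos t) * sin (real (Suc m) * t) * sin t) has_integral (pi / 2 * inv_sqrt_coeff N m)) {0..pi}"
proof -
  have "((\<lambda>t. (\<Sum>n<N. binom_coeff n * (((1 + cos t) / 2) ^ n * sin (real (Suc m) * t) * sin t)) / sqrt 2) has_integral
      (\<Sum>n<N. binom_coeff n * (pi / 2 * cheb_coeff n m)) / sqrt 2) {0..pi}"
    by (intro has_integral_divide has_integral_sum has_integral_mult_right cheb_coeff_integral) auto
  moreover have "(\<Sum>n<N. binom_coeff n * (((1 + cos t) / 2) ^ n * sin (real (Suc m) * t) * sin t)) / sqrt 2
      = poly (inv_sqrt_poly N) (1 - cos t) * sin (real (Suc m) * t) * sin t" for t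
  proof -
    have "1 - (1 - cos t) / 2 = (1 + cos t) / 2" by (simp add: field_simps)
    then show ?thesis
      by (simp only: poly_inv_sqrt_poly) (simp add: sum_distrib_left sum_distrib_right mult_ac)
  qed
  moreover have "(\<Sum>n<N. binom_coeff n * (pi / 2 * cheb_coeff n m)) / sqrt 2 = pi / 2 * inv_sqrt_coeff N m"
    unfolding inv_sqrt_coeff_def by (simp add: sum_distrib_left mult_ac)
  ultimately show ?thesis by (simp only:)
qed

lemma kappa_integral:
  "((\<lambda>t. sqrt 2 * cos (t / 2) * sin (real (Suc m) * t)) has_integral (pi / 2 * kappa m)) {0..pi}"
proof -
  define a b where "a = real m + 3/2" and "b = real m + 1/2"
  have ab: "a > 0" "b > 0" unfolding a_def b_def by auto
  have int: "((\<lambda>t. sqrt 2 / 2 * (sin (a * t) + sin (b * t))) has_integral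
      (sqrt 2 / 2 * (- cos (a * pi) / a - cos (b * pi) / b) - sqrt 2 / 2 * (- cos (a * 0) / a - cos (b * 0) / b))) {0..pi}"
    using ab by (intro fundamental_theorem_of_calculus)
      (auto intro!: derivative_eq_intros simp: has_real_derivative_iff_has_vector_derivative[symmetric] field_simps)
  have fe: "sqrt 2 / 2 * (sin (a * t) + sin (b * t)) = sqrt 2 * cos (t / 2) * sin (real (Suc m) * t)" for t
  proof -
    have "sin (a * t) + sin (b * t) = 2 * cos (t / 2) * sin (real (Suc m) * t)"
      using sin_add[of "real (Suc m) * t" "t / 2"] sin_diff[of "real (Suc m) * t" "t / 2"]
      unfolding a_def b_def by (simp add: algebra_simps)
    then show ?thesis by simp
  qed
  have c0: "cos (a * pi) = 0" "cos (b * pi) = 0"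
  proof -
    have "b * pi = real m * pi + pi / 2" "a * pi = real (Suc m) * pi + pi / 2"
      unfolding a_def b_def by (simp_all add: algebra_simps)
    then show "cos (a * pi) = 0" "cos (b * pi) = 0" by (simp_all only: cos_add cos_pi_half sin_npi)
  qed
  have "kappa m = sqrt 2 / pi * (1 / b + 1 / a)" by (simp add: kappa_def a_def b_def)
  then have ve: "sqrt 2 / 2 * (- cos (a * pi) / a - cos (b * pi) / b) - sqrt 2 / 2 * (- cos (a * 0) / a - cos (b * 0) / b)
      = pi / 2 * kappa m"
    using c0 ab by (simp add: field_simps)
  show ?thesis using int by (simp only: fe ve)
qed

text \<open>With \<open>1 - cos t = 2 sin\<^sup>2 (t/2)\<close>, the factor \<open>sin t\<close> cancels the singularity of \<open>(1 - cos t)\<^sup>-\<^sup>1\<^sup>/\<^sup>2\<close> at \<open>0\<close>.\<close>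

lemma inv_sqrt_integrand:
  assumes "0 < t" "t \<le> pi"
  shows "(\<lambda>N. poly (inv_sqrt_poly N) (1 - cos t) * sin t) \<longlonglongrightarrow> sqrt 2 * cos (t / 2)"
    "\<bar>poly (inv_sqrt_poly N) (1 - cos t) * sin t\<bar> \<le> sqrt 2 * cos (t / 2)"
proof -
  have sp: "sin (t / 2) > 0" using assms by (intro sin_gt_zero) auto
  have cp: "cos (t / 2) \<ge> 0" using assms by (intro cos_ge_zero) auto
  have e: "1 - cos t = 2 * (sin (t / 2))\<^sup>2"
    using cos_double_sin[of "t / 2"] by simp
  have s: "sin t = 2 * sin (t / 2) * cos (t / 2)" using sin_double[of "t / 2"] by simp
  have "0 < 2 * (sin (t / 2))\<^sup>2" using sp by simp
  then have t: "0 < 1 - cos t" "1 - cos t \<le> 2" using cos_ge_minus_one[of t] e by linarith+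
  have p: "(1 - cos t) powr (-1/2) * sin t = sqrt 2 * cos (t / 2)"
  proof -
    have "(1 - cos t) powr (-1/2) = inverse (sqrt (1 - cos t))" using t by (simp add: powr_minus powr_half_sqrt)
    also have "sqrt (1 - cos t) = sqrt 2 * sin (t / 2)" unfolding e using sp by (simp add: real_sqrt_mult)
    finally have "(1 - cos t) powr (-1/2) * sin t
        = inverse (sqrt 2 * sin (t / 2)) * ((sqrt 2 * sin (t / 2)) * (sqrt 2 * cos (t / 2)))"
      unfolding s by simp
    moreover have "sqrt 2 * sin (t / 2) \<noteq> 0" using sp by simp
    moreover have "inverse X * (X * Y) = Y" if "X \<noteq> 0" for X Y :: real
      using that by (simp add: mult.assoc[symmetric])
    ultimately show ?thesis by (simp only:)
  qed
  have sn: "sin t \<ge> 0" using assms by (intro sin_ge_zero) auto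
  show "(\<lambda>N. poly (inv_sqrt_poly N) (1 - cos t) * sin t) \<longlonglongrightarrow> sqrt 2 * cos (t / 2)"
    unfolding p[symmetric] by (intro tendsto_intros inv_sqrt_poly_tendsto t)
  have "poly (inv_sqrt_poly N) (1 - cos t) * sin t \<le> (1 - cos t) powr (-1/2) * sin t"
    by (intro mult_right_mono inv_sqrt_poly_tendsto t sn)
  then show "\<bar>poly (inv_sqrt_poly N) (1 - cos t) * sin t\<bar> \<le> sqrt 2 * cos (t / 2)"
    unfolding p using sn inv_sqrt_poly_tendsto(2)[OF t] by simp
qed

lemma inv_sqrt_coeff_bound: "\<bar>inv_sqrt_coeff N m\<bar> \<le> 4"
  and inv_sqrt_coeff_tendsto: "(\<lambda>N. inv_sqrt_coeff N m) \<longlonglongrightarrow> kappa m"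
proof -
  let ?f = "\<lambda>N t. poly (inv_sqrt_poly N) (1 - cos t) * sin (real (Suc m) * t) * sin t"
  have int: "integral {0..pi} (?f N) = pi / 2 * inv_sqrt_coeff N m" "?f N integrable_on {0..pi}" for N
    by (rule integral_unique[OF inv_sqrt_coeff_integral], rule has_integral_integrable[OF inv_sqrt_coeff_integral])
  have bd: "\<bar>?f N t\<bar> \<le> 2" if "t \<in> {0..pi}" for N t
  proof (cases "t = 0")
    case False
    have "sqrt 2 * cos (t / 2) \<le> 2 * 1"
      by (intro mult_mono) (use that in \<open>auto intro!: cos_ge_zero real_le_lsqrt\<close>)
    then have "\<bar>poly (inv_sqrt_poly N) (1 - cos t) * sin t\<bar> * \<bar>sin (real (Suc m) * t)\<bar> \<le> 2 * 1"
      using inv_sqrt_integrand(2)[of t N] that False by (intro mult_mono) auto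
    then show ?thesis by (simp add: abs_mult mult_ac)
  qed simp
  have "\<bar>integral {0..pi} (?f N)\<bar> \<le> integral {0..pi} (\<lambda>t. 2)"
    using integral_norm_bound_integral[OF int(2)[of N], of "\<lambda>t. 2"] bd by auto
  then show "\<bar>inv_sqrt_coeff N m\<bar> \<le> 4" unfolding int(1) by (simp add: abs_mult)
  have "(\<lambda>N. integral {0..pi} (?f N)) \<longlonglongrightarrow> integral {0..pi} (\<lambda>t. sqrt 2 * cos (t / 2) * sin (real (Suc m) * t))"
  proof (rule dominated_convergence(2))
    show "(\<lambda>t. 2 :: real) integrable_on {0..pi}" by auto
    fix t assume t: "t \<in> {0..pi}"
    show "(\<lambda>N. ?f N t) \<longlonglongrightarrow> sqrt 2 * cos (t / 2) * sin (real (Suc m) * t)"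
    proof (cases "t = 0")
      case False
      have "(\<lambda>N. poly (inv_sqrt_poly N) (1 - cos t) * sin t * sin (real (Suc m) * t)) \<longlonglongrightarrow> sqrt 2 * cos (t / 2) * sin (real (Suc m) * t)"
        by (intro tendsto_mult tendsto_const inv_sqrt_integrand(1)) (use t False in auto)
      then show ?thesis by (simp only: mult_ac)
    qed simp
  qed (use int bd in auto)
  also have "integral {0..pi} (\<lambda>t. sqrt 2 * cos (t / 2) * sin (real (Suc m) * t)) = pi / 2 * kappa m"
    using kappa_integral by (rule integral_unique)
  finally have "(\<lambda>N. pi / 2 * inv_sqrt_coeff N m) \<longlonglongrightarrow> pi / 2 * kappa m" unfolding int(1) .
  then show "(\<lambda>N. inv_sqrt_coeff N m) \<longlonglongrightarrow> kappa m"
    using tendsto_mult[OF tendsto_const[of "2 / pi"], of "\<lambda>N. pi / 2 * inv_sqrt_coeff N m" "pi / 2 * kappa m" sequentially]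
    by simp
qed

lemma kappa_nonneg: "0 \<le> kappa m"
  unfolding kappa_def by (intro mult_nonneg_nonneg add_nonneg_nonneg) auto

lemma kappa_le: "kappa m \<le> 1 / (real m + 1/2)"
proof -
  have "1 / (real m + 1/2) + 1 / (real m + 3/2) \<le> 2 / (real m + 1/2)"
  proof -
    have "1 / (real m + 3/2) \<le> 1 / (real m + 1/2)" by (intro divide_left_mono) auto
    moreover have "2 / (real m + 1/2) = 1 / (real m + 1/2) + 1 / (real m + 1/2)" by simp
    ultimately show ?thesis by linarith
  qed
  then have "kappa m \<le> sqrt 2 / pi * (2 / (real m + 1/2))"
    unfolding kappa_def by (intro mult_left_mono) auto
  also have "\<dots> \<le> 1 / (real m + 1/2)"
  proof -
    have "sqrt 2 \<le> 3/2" by (rule real_le_lsqrt) (auto simp: power2_eq_square)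
    then have "2 * sqrt 2 \<le> pi" using pi_gt3 by linarith
    then have "2 * sqrt 2 / pi \<le> 1" by simp
    then have "2 * sqrt 2 / pi * (1 / (real m + 1/2)) \<le> 1 * (1 / (real m + 1/2))"
      by (intro mult_right_mono) auto
    then show ?thesis by (simp add: mult_ac)
  qed
  finally show ?thesis .
qed

lemma kappa_bound: "\<bar>kappa m\<bar> \<le> 2"
proof -
  have "1 / (real m + 1/2) \<le> 1 / (1/2)" by (intro divide_left_mono) auto
  then show ?thesis using kappa_nonneg[of m] kappa_le[of m] by simp
qed

lemma kappa_decseq: "m \<le> n \<Longrightarrow> kappa n \<le> kappa m"
  unfolding kappa_def by (intro mult_left_mono add_mono divide_left_mono) auto

lemma kappa_convex: "m \<le> n \<Longrightarrow> kappa n - kappa (Suc n) \<le> kappa m - kappa (Suc m)"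
proof -
  have e: "kappa m - kappa (Suc m) = sqrt 2 / pi * (2 / ((real m + 1/2) * (real m + 5/2)))" for m
  proof -
    have "1 / (real m + 1/2) - 1 / (real m + 5/2) = 2 / ((real m + 1/2) * (real m + 5/2))"
      by (subst diff_frac_eq) auto
    moreover have "real (Suc m) + 1/2 = real m + 3/2" "real (Suc m) + 3/2 = real m + 5/2" by simp_all
    ultimately show ?thesis unfolding kappa_def right_diff_distrib[symmetric] by (simp only:) simp
  qed
  assume "m \<le> n"
  then show ?thesis unfolding e by (intro mult_left_mono divide_left_mono mult_mono) auto
qed

lemma tannery:
  fixes a :: "nat \<Rightarrow> nat \<Rightarrow> complex"
  assumes "\<And>k. (\<lambda>n. a k n) \<longlonglongrightarrow> b k" "\<And>k n. cmod (a k n) \<le> B k" "summable B"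
  shows "(\<lambda>n. \<Sum>k. a k n) \<longlonglongrightarrow> (\<Sum>k. b k)"
proof -
  have "\<forall>\<^sub>F (k, n) in at_top \<times>\<^sub>F sequentially. cmod (a k n) \<le> B k"
    by (intro always_eventually) (simp add: assms(2))
  from tannerys_theorem[OF assms(1) this assms(3)] show ?thesis by simp
qed

context parent_tree
begin

text \<open>Here \<open>avg\<close> is a left inverse of \<open>A\<close>, which implies that \<open>\<Sum>i\<le>m. A\<^sup>i avg\<^sup>m\<^sup>-\<^sup>i\<close> satisfies the three-term recursion of
  the Chebyshev polynomials and equals \<open>U\<^sub>m ((A + avg)/2)\<close>.\<close>

definition cheb_op :: "nat \<Rightarrow> ('v \<Rightarrow> complex) \<Rightarrow> 'v \<Rightarrow> complex" where
  "cheb_op m f x = (\<Sum>i\<le>m. (avg ^^ (m - i)) f ((par ^^ i) x))"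

lemma cheb_op_par: "cheb_op m f (par x) = cheb_op (Suc m) f x - (avg ^^ Suc m) f x"
  unfolding cheb_op_def by (subst sum.atMost_Suc_shift) (simp add: funpow_swap1)

lemma avg_sum: "avg (\<lambda>x. \<Sum>i\<in>I. F i x) = (\<lambda>x. \<Sum>i\<in>I. avg (F i) x)"
  unfolding avg_def by (rule ext) (simp add: sum_divide_distrib sum.swap[of _ I])

lemma avg_cheb_op: "avg (cheb_op m f) x = (avg ^^ Suc m) f x + (if m = 0 then 0 else cheb_op (m - 1) f x)"
proof -
  have "avg (cheb_op m f) x = (\<Sum>i\<le>m. avg (\<lambda>x. (avg ^^ (m - i)) f ((par ^^ i) x)) x)"
    unfolding cheb_op_def[abs_def] avg_sum ..
  also have "\<dots> = (avg ^^ Suc m) f x + (if m = 0 then 0 else cheb_op (m - 1) f x)"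
  proof (cases m)
    case (Suc k)
    have "avg (\<lambda>x. (avg ^^ (m - Suc i)) f ((par ^^ Suc i) x)) x = (avg ^^ (k - i)) f ((par ^^ i) x)" for i
      using avg_par1[of "\<lambda>x. (avg ^^ (k - i)) f ((par ^^ i) x)" x] Suc by (simp add: funpow_swap1)
    then show ?thesis unfolding Suc by (subst sum.atMost_Suc_shift) (simp add: cheb_op_def Suc del: funpow.simps(2), simp)
  qed simp
  finally show ?thesis .
qed

lemma cheb_op_0: "cheb_op 0 f = f"
  by (auto simp: cheb_op_def)

lemma op_cheb_coeff:
  assumes "n < R"
  shows "op ([:1, -1/2:] ^ n) f x = (\<Sum>m<R. complex_of_real (cheb_coeff n m) * cheb_op m f x)"
  using assms
proof (induction n arbitrary: R x)
  case 0
  then obtain R' where R: "R = Suc R'" by (cases R) auto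
  show ?case unfolding R by (subst sum.lessThan_Suc_shift) (simp add: op_1 cheb_op_0)
next
  case (Suc n)
  then obtain R' where R: "R = Suc R'" "n < R'" by (cases R) auto
  let ?u = "op ([:1, -1/2:] ^ n) f" and ?c = "\<lambda>m. complex_of_real (cheb_coeff n m)"
  have "op ([:1, -1/2:] ^ Suc n) f x = ?u x - lap ?u x / 2"
  proof -
    have "op ([:1, -1/2:] ^ Suc n) f = op [:1, -1/2:] ?u" unfolding power_Suc op_mult ..
    also have "\<dots> = (\<lambda>x. ?u x - lap ?u x / 2)"
      using T_scale[of "-1/2" ?u] by (auto simp: op_pCons op_0 T_zero)
    finally show ?thesis by simp
  qed
  also have "\<dots> = ?u x / 2 + (?u (par x) + avg ?u x) / 4"
    by (simp add: lap_def field_simps)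
  also have "?u x = (\<Sum>m<R. ?c m * cheb_op m f x)" using Suc.IH[of R] R by simp
  also have "?u (par x) = (\<Sum>m<R. ?c m * (cheb_op (Suc m) f x - (avg ^^ Suc m) f x))"
    using Suc.IH[of R] R by (simp add: cheb_op_par)
  also have "avg ?u x = (\<Sum>m<R. ?c m * ((avg ^^ Suc m) f x + (if m = 0 then 0 else cheb_op (m - 1) f x)))"
  proof -
    have "?u = (\<lambda>x. \<Sum>m<R. ?c m * cheb_op m f x)" using Suc.IH[of R] R by auto
    then have "avg ?u x = (\<Sum>m<R. ?c m * avg (cheb_op m f) x)" by (simp only: avg_sum avg_scale)
    then show ?thesis by (simp only: avg_cheb_op)
  qed
  also have "(\<Sum>m<R. ?c m * cheb_op m f x) / 2 + ((\<Sum>m<R. ?c m * (cheb_op (Suc m) f x - (avg ^^ Suc m) f x)) +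
      (\<Sum>m<R. ?c m * ((avg ^^ Suc m) f x + (if m = 0 then 0 else cheb_op (m - 1) f x)))) / 4
    = (\<Sum>m<R. ?c m * cheb_op m f x) / 2 + ((\<Sum>m<R. ?c m * cheb_op (Suc m) f x) +
      (\<Sum>m<R. ?c m * (if m = 0 then 0 else cheb_op (m - 1) f x))) / 4"
    unfolding right_diff_distrib distrib_left sum.distrib sum_subtractf by simp
  also have "(\<Sum>m<R. ?c m * cheb_op (Suc m) f x) = (\<Sum>m<R. (if m = 0 then 0 else ?c (m - 1)) * cheb_op m f x)"
    unfolding R(1) using cheb_coeff_eq_0[OF R(2)]
    by (subst (2) sum.lessThan_Suc_shift) simp
  also have "(\<Sum>m<R. ?c m * (if m = 0 then 0 else cheb_op (m - 1) f x)) = (\<Sum>m<R. ?c (Suc m) * cheb_op m f x)"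
    unfolding R(1) using cheb_coeff_eq_0[of n "Suc R'"] R(2)
    by (subst sum.lessThan_Suc_shift) simp
  also have "(\<Sum>m<R. ?c m * cheb_op m f x) / 2 + ((\<Sum>m<R. (if m = 0 then 0 else ?c (m - 1)) * cheb_op m f x) + (\<Sum>m<R. ?c (Suc m) * cheb_op m f x)) / 4
    = (\<Sum>m<R. complex_of_real (cheb_coeff (Suc n) m) * cheb_op m f x)"
    unfolding sum_divide_distrib sum.distrib[symmetric]
    by (rule sum.cong) (auto simp: field_simps)
  finally show ?case .
qed

lemma op_inv_sqrt_poly: "op (inv_sqrt_poly N) f x = (\<Sum>m<N. complex_of_real (inv_sqrt_coeff N m) * cheb_op m f x)"
proof -
  have s: "op (\<Sum>n<k. P n) f = (\<lambda>x. \<Sum>n<k. op (P n) f x)" for k and P :: "nat \<Rightarrow> real poly"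
    by (induction k) (auto simp: op_0 op_add)
  have "op (inv_sqrt_poly N) f x = complex_of_real (1 / sqrt 2) * (\<Sum>n<N. complex_of_real (binom_coeff n) * op ([:1, -1/2:] ^ n) f x)"
    unfolding inv_sqrt_poly_def op_smult s ..
  also have "(\<Sum>n<N. complex_of_real (binom_coeff n) * op ([:1, -1/2:] ^ n) f x)
      = (\<Sum>n<N. complex_of_real (binom_coeff n) * (\<Sum>m<N. complex_of_real (cheb_coeff n m) * cheb_op m f x))"
    by (intro sum.cong refl arg_cong2[of _ _ _ _ "(*)"] op_cheb_coeff) simp
  also have "\<dots> = (\<Sum>m<N. (\<Sum>n<N. complex_of_real (binom_coeff n) * complex_of_real (cheb_coeff n m)) * cheb_op m f x)"
    by (simp add: sum_distrib_left sum_distrib_right, subst sum.swap) (simp add: mult_ac)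
  also have "complex_of_real (1 / sqrt 2) * \<dots> = (\<Sum>m<N. complex_of_real (inv_sqrt_coeff N m) * cheb_op m f x)"
    unfolding inv_sqrt_coeff_def sum_distrib_left by (intro sum.cong refl) simp
  finally show ?thesis .
qed

subsection \<open>Kernel operators\<close>

text \<open>The operators \<open>\<Sum>i j. c i j A\<^sup>i avg\<^sup>j\<close>, as iterated sums over the ascent \<open>i\<close> and the descent \<open>j\<close>.\<close>

definition kernel_row :: "(nat \<Rightarrow> nat \<Rightarrow> real) \<Rightarrow> nat \<Rightarrow> ('v \<Rightarrow> complex) \<Rightarrow> 'v \<Rightarrow> complex" where
  "kernel_row c i f y = (\<Sum>j. complex_of_real (c i j) * (avg ^^ j) f y)"

definition kernel_op :: "(nat \<Rightarrow> nat \<Rightarrow> real) \<Rightarrow> ('v \<Rightarrow> complex) \<Rightarrow> 'v \<Rightarrow> complex" where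
  "kernel_op c f x = (\<Sum>i. kernel_row c i f ((par ^^ i) x))"

lemma avg_pow_summable:
  assumes "integrable M f"
  shows "summable (\<lambda>j. cmod ((avg ^^ j) f y))" "(\<Sum>j. cmod ((avg ^^ j) f y)) \<le> (\<integral>x. cmod (f x) \<partial>M) / w y"
proof -
  show "summable (\<lambda>j. cmod ((avg ^^ j) f y))"
    by (rule summableI_nonneg_bounded[OF _ sum_avg_pow_le[OF assms]]) simp
  then show "(\<Sum>j. cmod ((avg ^^ j) f y)) \<le> (\<integral>x. cmod (f x) \<partial>M) / w y"
    by (rule suminf_le_const) (rule sum_avg_pow_le[OF assms])
qed

lemma kernel_row_summable:
  assumes f: "integrable M f" and c: "\<And>i j. \<bar>c i j\<bar> \<le> B"
  shows "summable (\<lambda>j. cmod (complex_of_real (c i j) * (avg ^^ j) f y))"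
    "cmod (kernel_row c i f y) \<le> B * ((\<integral>x. cmod (f x) \<partial>M) / w y)"
proof -
  have B: "0 \<le> B" using c[of 0 0] by linarith
  have b: "cmod (complex_of_real (c i j) * (avg ^^ j) f y) \<le> B * cmod ((avg ^^ j) f y)" for j
    using c by (simp add: norm_mult mult_right_mono)
  note s = summable_mult[OF avg_pow_summable(1)[OF f], of B]
  show 1: "summable (\<lambda>j. cmod (complex_of_real (c i j) * (avg ^^ j) f y))"
    by (rule summable_comparison_test'[OF s[of y]]) (use b in simp)
  have "cmod (kernel_row c i f y) \<le> (\<Sum>j. cmod (complex_of_real (c i j) * (avg ^^ j) f y))"
    unfolding kernel_row_def by (rule summable_norm[OF 1])
  also have "\<dots> \<le> (\<Sum>j. B * cmod ((avg ^^ j) f y))" by (rule suminf_le[OF b 1 s])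
  also have "\<dots> = B * (\<Sum>j. cmod ((avg ^^ j) f y))" by (rule suminf_mult[OF avg_pow_summable(1)[OF f]])
  also have "\<dots> \<le> B * ((\<integral>x. cmod (f x) \<partial>M) / w y)"
    by (intro mult_left_mono avg_pow_summable(2)[OF f] B)
  finally show "cmod (kernel_row c i f y) \<le> B * ((\<integral>x. cmod (f x) \<partial>M) / w y)" .
qed

lemma kernel_op_summable:
  assumes f: "integrable M f" and c: "\<And>i j. \<bar>c i j\<bar> \<le> B"
  shows "cmod (kernel_row c i f ((par ^^ i) x)) \<le> B * ((\<integral>x. cmod (f x) \<partial>M) / w x) * (1/2) ^ i"
    "summable (\<lambda>i. cmod (kernel_row c i f ((par ^^ i) x)))"
    "cmod (kernel_op c f x) \<le> 2 * B * ((\<integral>x. cmod (f x) \<partial>M) / w x)"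
proof -
  let ?I = "\<integral>x. cmod (f x) \<partial>M"
  have B: "0 \<le> B" using c[of 0 0] by linarith
  show b: "cmod (kernel_row c i f ((par ^^ i) x)) \<le> B * (?I / w x) * (1/2) ^ i" for i
  proof -
    have "?I / w ((par ^^ i) x) \<le> ?I / (2 ^ i * w x)"
      unfolding w_par_pow using w_pos[of x] q2
      by (intro divide_left_mono mult_right_mono power_mono mult_pos_pos) auto
    then have "B * (?I / w ((par ^^ i) x)) \<le> B * (?I / (2 ^ i * w x))" using B by (rule mult_left_mono)
    with kernel_row_summable(2)[where c = c and B = B and i = i and y = "(par ^^ i) x", OF f c] show ?thesis by (simp add: power_one_over field_simps)
  qed
  have g: "summable (\<lambda>i. B * (?I / w x) * (1/2 :: real) ^ i)" by (intro summable_mult) (simp add: summable_geometric)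
  show s: "summable (\<lambda>i. cmod (kernel_row c i f ((par ^^ i) x)))"
    by (rule summable_comparison_test'[OF g]) (use b in simp)
  have "cmod (kernel_op c f x) \<le> (\<Sum>i. cmod (kernel_row c i f ((par ^^ i) x)))"
    unfolding kernel_op_def by (rule summable_norm[OF s])
  also have "\<dots> \<le> (\<Sum>i. B * (?I / w x) * (1/2 :: real) ^ i)" by (rule suminf_le[OF b s g])
  also have "\<dots> = B * (?I / w x) * 2"
    by (subst suminf_mult) (simp_all add: summable_geometric suminf_geometric)
  finally show "cmod (kernel_op c f x) \<le> 2 * B * (?I / w x)" by (simp add: mult_ac)
qed

lemma avg_pow_add: "(avg ^^ j) (\<lambda>x. f x + g x) = (\<lambda>x. (avg ^^ j) f x + (avg ^^ j) g x)"
  by (induction j) (auto simp: avg_add)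

lemma avg_pow_scale: "(avg ^^ j) (\<lambda>x. c * f x) = (\<lambda>x. c * (avg ^^ j) f x)"
  by (induction j) (auto simp: avg_scale)

lemma kernel_op_add:
  assumes f: "integrable M f" and g: "integrable M g" and c: "\<And>i j. \<bar>c i j\<bar> \<le> B"
  shows "kernel_op c (\<lambda>x. f x + g x) x = kernel_op c f x + kernel_op c g x"
proof -
  have sj: "summable (\<lambda>j. complex_of_real (c i j) * (avg ^^ j) h y)" if "integrable M h" for i h y
    by (rule summable_norm_cancel) (rule kernel_row_summable(1)[OF that c])
  have si: "summable (\<lambda>i. kernel_row c i h ((par ^^ i) x))" if "integrable M h" for h
    by (rule summable_norm_cancel) (rule kernel_op_summable(2)[OF that c])
  have "kernel_row c i (\<lambda>x. f x + g x) y = kernel_row c i f y + kernel_row c i g y" for i y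
    unfolding kernel_row_def avg_pow_add distrib_left by (rule suminf_add[OF sj[OF f] sj[OF g], symmetric])
  then show ?thesis
    unfolding kernel_op_def by (simp only: suminf_add[OF si[OF f] si[OF g]])
qed

lemma kernel_op_scale:
  assumes f: "integrable M f" and c: "\<And>i j. \<bar>c i j\<bar> \<le> B"
  shows "kernel_op c (\<lambda>x. a * f x) x = a * kernel_op c f x"
proof -
  have sj: "summable (\<lambda>j. complex_of_real (c i j) * (avg ^^ j) f y)" for i y
    by (rule summable_norm_cancel) (rule kernel_row_summable(1)[OF f c])
  have si: "summable (\<lambda>i. kernel_row c i f ((par ^^ i) x))"
    by (rule summable_norm_cancel) (rule kernel_op_summable(2)[OF f c])
  have "kernel_row c i (\<lambda>x. a * f x) y = a * kernel_row c i f y" for i y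
    unfolding kernel_row_def avg_pow_scale suminf_mult[OF sj, symmetric] by (simp only: mult.left_commute)
  then show ?thesis
    unfolding kernel_op_def by (simp only: suminf_mult[OF si])
qed

lemma op_inv_sqrt_poly_kernel_op: "op (inv_sqrt_poly N) f x = kernel_op (\<lambda>i j. inv_sqrt_coeff N (i + j)) f x"
proof -
  let ?a = "\<lambda>i j. complex_of_real (inv_sqrt_coeff N (i + j)) * (avg ^^ j) f ((par ^^ i) x)"
  have "op (inv_sqrt_poly N) f x = (\<Sum>m<N. \<Sum>i\<le>m. ?a i (m - i))"
    unfolding op_inv_sqrt_poly cheb_op_def by (simp add: sum_distrib_left)
  also have "\<dots> = (\<Sum>(i, j)\<in>{(i, j). i + j < N}. ?a i j)" by (rule sum.triangle_reindex[symmetric])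
  also have "\<dots> = (\<Sum>(i, j)\<in>{..<N} \<times> {..<N}. ?a i j)"
    by (rule sum.mono_neutral_left) (auto, metis inv_sqrt_coeff_eq_0 not_le)
  also have "\<dots> = (\<Sum>i<N. \<Sum>j<N. ?a i j)" by (rule sum.cartesian_product[symmetric])
  also have "\<dots> = (\<Sum>i<N. kernel_row (\<lambda>i j. inv_sqrt_coeff N (i + j)) i f ((par ^^ i) x))"
    unfolding kernel_row_def by (intro sum.cong refl suminf_finite[symmetric]) (auto simp: inv_sqrt_coeff_eq_0)
  also have "\<dots> = kernel_op (\<lambda>i j. inv_sqrt_coeff N (i + j)) f x"
    unfolding kernel_op_def by (intro suminf_finite[symmetric]) (auto simp: inv_sqrt_coeff_eq_0 kernel_row_def)
  finally show ?thesis .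
qed

text \<open>The inverse square root of the Laplacian, as an operator defined pointwise on \<open>L\<^sup>1\<close>.\<close>

definition K :: "('v \<Rightarrow> complex) \<Rightarrow> 'v \<Rightarrow> complex" where
  "K = kernel_op (\<lambda>i j. kappa (i + j))"

lemma inv_sqrt_poly_tendsto_K:
  assumes f: "integrable M f"
  shows "(\<lambda>N. op (inv_sqrt_poly N) f x) \<longlonglongrightarrow> K f x"
  unfolding op_inv_sqrt_poly_kernel_op K_def kernel_op_def
proof (rule tannery)
  let ?I = "\<integral>x. cmod (f x) \<partial>M"
  fix i
  show "(\<lambda>N. kernel_row (\<lambda>i j. inv_sqrt_coeff N (i + j)) i f ((par ^^ i) x)) \<longlonglongrightarrow> kernel_row (\<lambda>i j. kappa (i + j)) i f ((par ^^ i) x)"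
    unfolding kernel_row_def
  proof (rule tannery)
    show "(\<lambda>N. complex_of_real (inv_sqrt_coeff N (i + j)) * (avg ^^ j) f ((par ^^ i) x)) \<longlonglongrightarrow> complex_of_real (kappa (i + j)) * (avg ^^ j) f ((par ^^ i) x)" for j
      by (intro tendsto_intros inv_sqrt_coeff_tendsto)
    show "cmod (complex_of_real (inv_sqrt_coeff N (i + j)) * (avg ^^ j) f ((par ^^ i) x)) \<le> 4 * cmod ((avg ^^ j) f ((par ^^ i) x))" for j N
      by (simp add: norm_mult inv_sqrt_coeff_bound mult_right_mono)
    show "summable (\<lambda>j. 4 * cmod ((avg ^^ j) f ((par ^^ i) x)))"
      by (intro summable_mult avg_pow_summable f)
  qed
  show "cmod (kernel_row (\<lambda>i j. inv_sqrt_coeff N (i + j)) i f ((par ^^ i) x)) \<le> 4 * (?I / w x) * (1/2) ^ i" for N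
    by (rule kernel_op_summable(1)[OF f]) (rule inv_sqrt_coeff_bound)
next
  show "summable (\<lambda>i. 4 * ((\<integral>x. cmod (f x) \<partial>M) / w x) * (1/2) ^ i)"
    by (intro summable_mult) (simp add: summable_geometric)
qed

end

section \<open>The domain of the inverse square root\<close>

lemma L2_inner_le:
  assumes "f \<in> L2_space M" "g \<in> L2_space M"
  shows "Re (L2_inner M f g) \<le> (\<integral>x. (cmod (f x))\<^sup>2 \<partial>M) / 4 + (\<integral>x. (cmod (g x))\<^sup>2 \<partial>M)"
proof -
  have "Re (L2_inner M f g) = (\<integral>x. Re (f x * cnj (g x)) \<partial>M)"
    unfolding L2_inner_def by (rule integral_Re[symmetric, OF L2_integrable_mult[OF assms]])
  also have "\<dots> \<le> (\<integral>x. (cmod (f x))\<^sup>2 / 4 + (cmod (g x))\<^sup>2 \<partial>M)"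
  proof (rule integral_mono)
    show "integrable M (\<lambda>x. Re (f x * cnj (g x)))" by (rule integrable_Re[OF L2_integrable_mult[OF assms]])
    show "integrable M (\<lambda>x. (cmod (f x))\<^sup>2 / 4 + (cmod (g x))\<^sup>2)" using assms by (simp add: L2D)
    fix x
    have "Re (f x * cnj (g x)) \<le> cmod (f x) * cmod (g x)"
      using complex_Re_le_cmod[of "f x * cnj (g x)"] by (simp add: norm_mult)
    moreover have "0 \<le> (cmod (f x) / 2 - cmod (g x))\<^sup>2" by simp
    ultimately show "Re (f x * cnj (g x)) \<le> (cmod (f x))\<^sup>2 / 4 + (cmod (g x))\<^sup>2"
      by (simp add: power2_diff power_divide)
  qed
  also have "\<dots> = (\<integral>x. (cmod (f x))\<^sup>2 \<partial>M) / 4 + (\<integral>x. (cmod (g x))\<^sup>2 \<partial>M)"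
    using assms by (simp add: L2D)
  finally show ?thesis .
qed

context parent_tree
begin

text \<open>Since \<open>2 lap = (1 - avg) (1 - A)\<close>, the range of \<open>1 - avg\<close> consists of values of the square root of \<open>lap\<close>. For
  \<open>r = inverse_poly N\<close> applied to \<open>f = v - avg v\<close>, the quantity \<open>X = \<langle>r, f\<rangle> = \<langle>r - A r, v\<rangle>\<close> satisfies
  \<open>X \<le> X/2 + \<parallel>v\<parallel>\<^sup>2\<close>, because \<open>\<parallel>r - A r\<parallel>\<^sup>2 \<le> 2 X\<close>.\<close>

lemma dom_coboundary:
  assumes v: "v \<in> L2_space M"
  shows "(\<lambda>x. v x - avg v x) \<in> inv_sqrt_dom"
proof -
  define f where "f x = v x - avg v x" for x
  have f: "f \<in> L2_space M" unfolding f_def[abs_def] by (intro L2_diff v avg_L2)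
  have "Re (L2_inner M (op (inverse_poly N) f) f) \<le> 2 * (\<integral>x. (cmod (v x))\<^sup>2 \<partial>M)" for N
  proof -
    define r where "r = op (inverse_poly N) f"
    have r: "r \<in> L2_space M" unfolding r_def by (rule op_L2[OF f])
    have rr: "(\<lambda>x. r x - r (par x)) \<in> L2_space M" by (intro L2_diff r par_L2)
    have d1: "L2_inner M r (\<lambda>x. a x - b x) = L2_inner M r a - L2_inner M r b"
      if "a \<in> L2_space M" "b \<in> L2_space M" for a b
      using L2_inner_add_right[OF r that(1) L2_scale[OF that(2), of "-1"]] L2_inner_scale_right[of M r "-1" b] by simp
    have d2: "L2_inner M (\<lambda>x. a x - b x) v = L2_inner M a v - L2_inner M b v"
      if "a \<in> L2_space M" "b \<in> L2_space M" for a b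
      using L2_inner_add_left[OF that(1) L2_scale[OF that(2), of "-1"] v] L2_inner_scale_left[of M "-1" b v] by simp
    have "L2_inner M r f = L2_inner M (\<lambda>x. r x - r (par x)) v"
      unfolding f_def[abs_def] d1[OF v avg_L2[OF v]] d2[OF r par_L2[OF r]] adjoint[OF r v] ..
    then have "Re (L2_inner M r f) \<le> (\<integral>x. (cmod (r (par x) - r x))\<^sup>2 \<partial>M) / 4 + (\<integral>x. (cmod (v x))\<^sup>2 \<partial>M)"
      using L2_inner_le[OF rr v] by (simp add: norm_minus_commute)
    also have "(\<integral>x. (cmod (r (par x) - r x))\<^sup>2 \<partial>M) = 2 * (\<integral>t. t * (poly (inverse_poly N) t)\<^sup>2 \<partial>\<nu> f)"
      unfolding lap_energy(1)[OF r] unfolding r_def spectral_sq_T[OF f] ..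
    also have "(\<integral>t. t * (poly (inverse_poly N) t)\<^sup>2 \<partial>\<nu> f) \<le> (\<integral>t. poly (inverse_poly N) t \<partial>\<nu> f)"
    proof (rule integral_mono_AE)
      show "integrable (\<nu> f) (\<lambda>t. t * (poly (inverse_poly N) t)\<^sup>2)"
        by (rule spectral_poly_eq(2)[OF f, of "[:0, 1:] * inverse_poly N * inverse_poly N"]) (simp add: power2_eq_square)
      show "integrable (\<nu> f) (poly (inverse_poly N))" by (rule spectral_integrable_poly[OF f])
      show "AE t in \<nu> f. t * (poly (inverse_poly N) t)\<^sup>2 \<le> poly (inverse_poly N) t"
      proof (rule eventually_mono[OF spectral_support[OF f]])
        fix t :: real assume t: "0 \<le> t \<and> t \<le> 2"
        have "t * poly (inverse_poly N) t \<le> 1" unfolding inverse_poly_mult using t by simp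
        from mult_right_mono[OF this inverse_poly_nonneg[of t N]] t
        show "t * (poly (inverse_poly N) t)\<^sup>2 \<le> poly (inverse_poly N) t" by (simp add: power2_eq_square mult.assoc)
      qed
    qed
    also have "(\<integral>t. poly (inverse_poly N) t \<partial>\<nu> f) = Re (L2_inner M r f)"
      unfolding r_def spectral_poly[OF f] by simp
    finally show ?thesis unfolding r_def by simp
  qed
  then show ?thesis unfolding f_def[abs_def, symmetric] dom_iff using f by blast
qed

definition point :: "'v \<Rightarrow> 'v \<Rightarrow> complex" where "point y x = (if x = y then 1 else 0)"

lemma finite_support_L2:
  "finite {x. f x \<noteq> 0} \<Longrightarrow> f \<in> L2_space M"
  unfolding L2_iff by (rule integral_finite_support(1)) auto

lemma par_pow_inj:
  assumes "(par ^^ i) x = (par ^^ j) x" shows "i = j"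
proof -
  have "l x + int i = l ((par ^^ j) x)" unfolding assms[symmetric] l_par_pow ..
  then show ?thesis unfolding l_par_pow by simp
qed

text \<open>The equation \<open>v - avg v = point y\<close> is solved by \<open>v = \<Sum>n. avg\<^sup>n (point y)\<close>, which lives on the ancestors of
  \<open>y\<close> and is square integrable, being \<open>q\<^sup>-\<^sup>n\<close> at an ancestor of mass \<open>q\<^sup>n w y\<close>.\<close>

lemma point_dom: "point y \<in> inv_sqrt_dom"
proof -
  define v where "v x = (if \<exists>n. (par ^^ n) y = x then complex_of_real (w y / w x) else 0)" for x
  define u where "u N x = (if \<exists>n<N. (par ^^ n) y = x then complex_of_real (w y / w x) else 0)" for N x
  have "v \<in> L2_space M"
  proof (rule L2_weak_convergence(1)[OF _ _ _ L2_zero])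
    fix N
    define F where "F = (\<lambda>n. (par ^^ n) y) ` {..<N}"
    have F: "finite F" "\<And>x. x \<notin> F \<Longrightarrow> u N x = 0" unfolding F_def u_def by auto
    show "u N \<in> L2_space M" by (rule finite_support_L2) (use F in \<open>auto intro: finite_subset\<close>)
    have "(\<integral>x. (cmod (u N x))\<^sup>2 \<partial>M) = (\<Sum>x\<in>F. w x * (cmod (u N x))\<^sup>2)"
      using integral_finite_support(2)[OF F(1), of "\<lambda>x. (cmod (u N x))\<^sup>2"] F(2) by simp
    also have "\<dots> = (\<Sum>n<N. w ((par ^^ n) y) * (cmod (u N ((par ^^ n) y)))\<^sup>2)"
      unfolding F_def by (subst sum.reindex) (auto intro!: inj_onI dest: par_pow_inj)
    also have "\<dots> = (\<Sum>n<N. w y * (1 / real q) ^ n)"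
    proof (rule sum.cong[OF refl])
      fix n assume "n \<in> {..<N}"
      then have "u N ((par ^^ n) y) = complex_of_real (w y / w ((par ^^ n) y))" unfolding u_def by auto
      also have "w y / w ((par ^^ n) y) = (1 / real q) ^ n"
        using w_pos[of y] by (simp add: w_par_pow power_one_over)
      finally have "cmod (u N ((par ^^ n) y)) = (1 / real q) ^ n" by (simp only: norm_of_real) simp
      then show "w ((par ^^ n) y) * (cmod (u N ((par ^^ n) y)))\<^sup>2 = w y * (1 / real q) ^ n"
        using q2 by (simp add: w_par_pow power2_eq_square power_one_over)
    qed
    also have "\<dots> \<le> (\<Sum>n<N. w y * (1 / 2) ^ n)"
      using w_pos[of y] q2 by (intro sum_mono mult_left_mono power_mono divide_left_mono) (auto simp: less_imp_le)
    also have "\<dots> = w y * (\<Sum>n<N. (1 / 2) ^ n)" by (simp add: sum_distrib_left)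
    also have "\<dots> \<le> w y * 2"
      using w_pos[of y] by (intro mult_left_mono) (auto simp: less_imp_le sum_gp_strict)
    finally show "(\<integral>x. (cmod (u N x))\<^sup>2 \<partial>M) \<le> w y * 2" .
  next
    fix x
    show "(\<lambda>N. u N x) \<longlonglongrightarrow> v x"
    proof (cases "\<exists>n. (par ^^ n) y = x")
      case True
      then obtain n where n: "(par ^^ n) y = x" by blast
      have "\<forall>\<^sub>F N in sequentially. u N x = v x"
        using eventually_gt_at_top[of n] by eventually_elim (use n True in \<open>auto simp: u_def v_def\<close>)
      then show ?thesis by (rule tendsto_eventually)
    next
      case False
      then have "u N x = v x" for N by (auto simp: u_def v_def)
      then show ?thesis by simp
    qed
  qed
  from dom_coboundary[OF this] have "(\<lambda>x. v x - avg v x) \<in> inv_sqrt_dom" .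
  also have "(\<lambda>x. v x - avg v x) = point y"
  proof
    fix x
    show "v x - avg v x = point y x"
    proof (cases "\<exists>n. (par ^^ n) y = x")
      case False
      have "v z = 0" if z: "par z = x" for z
      proof (rule ccontr)
        assume "v z \<noteq> 0"
        then obtain k where "(par ^^ k) y = z" unfolding v_def by (auto split: if_splits)
        then have "(par ^^ Suc k) y = x" using z by simp
        then show False using False by blast
      qed
      moreover have "x \<noteq> y" using False[unfolded not_ex, rule_format, of 0] by auto
      ultimately show ?thesis using False by (auto simp: avg_def v_def[of x] point_def)
    next
      case True
      then obtain n where n: "(par ^^ n) y = x" by blast
      have vx: "v x = complex_of_real (w y / w x)" using True by (auto simp: v_def)
      show ?thesis
      proof (cases n)
        case 0
        have "v z = 0" if "par z = x" for z
        proof -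
          have "(par ^^ k) y \<noteq> z" for k
          proof
            assume "(par ^^ k) y = z"
            then have "l z = l y + int k" using l_par_pow[of k y] by simp
            moreover have "l x = l z + 1" using l_par[of z] that by simp
            moreover have "x = y" using n 0 by simp
            ultimately show False by simp
          qed
          then show ?thesis unfolding v_def by auto
        qed
        then have "avg v x = 0" by (simp add: avg_def)
        then show ?thesis using n 0 vx w_pos[of x] by (simp add: point_def)
      next
        case (Suc k)
        define z0 where "z0 = (par ^^ k) y"
        have z0: "par z0 = x" using n Suc by (simp add: z0_def)
        have "v z = (if z = z0 then complex_of_real (w y / w z0) else 0)" if "par z = x" for z
        proof -
          have "j = k" if "(par ^^ j) y = z" for j
          proof -
            have "l z = l y + int j" using l_par_pow[of j y] that by simp
            moreover have "l z0 = l y + int k" unfolding z0_def by (rule l_par_pow)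
            moreover have "l z + 1 = l z0 + 1" using l_par[of z] l_par[of z0] z0 \<open>par z = x\<close> by simp
            ultimately show ?thesis by simp
          qed
          then have "(\<exists>j. (par ^^ j) y = z) \<longleftrightarrow> z = z0" unfolding z0_def by blast
          then show ?thesis unfolding v_def by simp
        qed
        then have "avg v x = (\<Sum>z | par z = x. if z = z0 then complex_of_real (w y / w z0) else 0) / of_nat q"
          unfolding avg_def by (intro arg_cong2[of _ _ _ _ "(/)"] sum.cong) auto
        also have "\<dots> = complex_of_real (w y / w z0) / of_nat q"
          using finite_children[of x] z0 by simp
        also have "\<dots> = v x"
          unfolding vx using w_par[of z0] z0 by (simp add: mult.commute)
        finally have "avg v x = v x" .
        moreover have "x \<noteq> y"
        proof
          assume "x = y"
          then have "l y = l y + int n" using l_par_pow[of n y] n by simp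
          then show False using Suc by simp
        qed
        ultimately show ?thesis by (simp add: point_def)
      qed
    qed
  qed
  finally show ?thesis .
qed

lemma finite_support_dom:
  assumes "finite {x. f x \<noteq> 0}" shows "f \<in> inv_sqrt_dom"
proof -
  have "(\<lambda>x. if x \<in> F then f x else 0) \<in> inv_sqrt_dom" if "finite F" for F
    using that
  proof induction
    case empty
    then show ?case using dom_scale[OF point_dom, of 0] by simp
  next
    case (insert y F)
    have "(\<lambda>x. if x \<in> insert y F then f x else 0) = (\<lambda>x. (if x \<in> F then f x else 0) + f y * point y x)"
      using insert by (auto simp: point_def)
    then show ?case using insert dom_add[OF _ dom_scale[OF point_dom]] by simp
  qed
  from this[OF assms] show ?thesis by (rule back_subst[of "\<lambda>f. f \<in> inv_sqrt_dom"]) auto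
qed

lemma finite_support_integrable:
  fixes f :: "'v \<Rightarrow> complex"
  shows "finite {x. f x \<noteq> 0} \<Longrightarrow> integrable M f"
  by (rule integral_finite_support(1)) auto

lemma inv_sqrt_lap:
  assumes "finite {x. f x \<noteq> 0}"
  shows "inv_sqrt_op M lap f = K f"
proof (rule inv_sqrt_op_eq[OF finite_support_dom[OF assms]])
  show "(\<lambda>N. op (inv_sqrt_poly N) f x) \<longlonglongrightarrow> K f x" for x
    by (rule inv_sqrt_poly_tendsto_K[OF finite_support_integrable[OF assms]])
  fix v assume v: "v \<in> L2_space M" "\<And>g. g \<in> inv_sqrt_dom \<Longrightarrow> L2_inner M v g = 0"
  show "v = (\<lambda>x. 0)"
  proof
    fix x
    have "0 = L2_inner M v (point x)" using v(2)[OF point_dom] by simp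
    also have "\<dots> = w x *\<^sub>R v x"
      unfolding L2_inner_def by (subst integral_finite_support(2)[of "{x}"]) (auto simp: point_def)
    finally show "v x = 0" using w_pos[of x] by simp
  qed
qed

text \<open>The operator \<open>(A - 1) lap\<^sup>-\<^sup>1\<^sup>/\<^sup>2\<close> is \<open>\<surd>2\<close> times an isometry, because \<open>\<parallel>(A - 1) u\<parallel>\<^sup>2 = 2 \<langle>lap u, u\<rangle>\<close>.\<close>

lemma K_energy:
  assumes "finite {x. f x \<noteq> 0}"
  shows "(\<lambda>x. K f (par x) - K f x) \<in> L2_space M"
    "(\<integral>x. (cmod (K f (par x) - K f x))\<^sup>2 \<partial>M) \<le> 2 * (\<integral>x. (cmod (f x))\<^sup>2 \<partial>M)"
proof -
  have f: "f \<in> L2_space M" "integrable M f"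
    using assms by (auto intro: finite_support_L2 finite_support_integrable)
  define u where "u N = op (inv_sqrt_poly N) f" for N
  have u: "u N \<in> L2_space M" for N unfolding u_def by (rule op_L2[OF f(1)])
  have d: "(\<lambda>x. u N (par x) - u N x) \<in> L2_space M" for N by (intro L2_diff par_L2 u)
  have b: "(\<integral>x. (cmod (u N (par x) - u N x))\<^sup>2 \<partial>M) \<le> 2 * (\<integral>x. (cmod (f x))\<^sup>2 \<partial>M)" for N
  proof -
    have "(\<integral>x. (cmod (u N (par x) - u N x))\<^sup>2 \<partial>M) = 2 * (\<integral>t. t * (poly (inv_sqrt_poly N) t)\<^sup>2 \<partial>\<nu> f)"
      unfolding lap_energy(1)[OF u] unfolding u_def spectral_sq_T[OF f(1)] ..
    also have "(\<integral>t. t * (poly (inv_sqrt_poly N) t)\<^sup>2 \<partial>\<nu> f) \<le> (\<integral>t. poly 1 t \<partial>\<nu> f)"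
    proof (rule integral_mono_AE)
      show "integrable (\<nu> f) (\<lambda>t. t * (poly (inv_sqrt_poly N) t)\<^sup>2)"
        by (rule spectral_poly_eq(2)[OF f(1), of "[:0, 1:] * inv_sqrt_poly N * inv_sqrt_poly N"]) (simp add: power2_eq_square)
      show "integrable (\<nu> f) (poly 1)" by (rule spectral_integrable_poly[OF f(1)])
      show "AE t in \<nu> f. t * (poly (inv_sqrt_poly N) t)\<^sup>2 \<le> poly 1 t"
      proof (rule eventually_mono[OF spectral_support[OF f(1)]])
        fix t :: real assume t: "0 \<le> t \<and> t \<le> 2"
        show "t * (poly (inv_sqrt_poly N) t)\<^sup>2 \<le> poly 1 t"
        proof (cases "t = 0")
          case False
          then have "t * (poly (inv_sqrt_poly N) t)\<^sup>2 \<le> t * inverse t"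
            using t inv_sqrt_poly_tendsto(4)[of t N] by (intro mult_left_mono) auto
          then show ?thesis using False by simp
        qed simp
      qed
    qed
    also have "(\<integral>t. poly 1 t \<partial>\<nu> f) = (\<integral>x. (cmod (f x))\<^sup>2 \<partial>M)"
      using spectral_poly[OF f(1), of 1] unfolding op_1 L2_inner_self of_real_eq_iff by (rule sym)
    finally show ?thesis by simp
  qed
  have l: "(\<lambda>N. u N (par x) - u N x) \<longlonglongrightarrow> K f (par x) - K f x" for x
    unfolding u_def by (intro tendsto_intros inv_sqrt_poly_tendsto_K f)
  show "(\<lambda>x. K f (par x) - K f x) \<in> L2_space M"
    "(\<integral>x. (cmod (K f (par x) - K f x))\<^sup>2 \<partial>M) \<le> 2 * (\<integral>x. (cmod (f x))\<^sup>2 \<partial>M)"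
    using L2_weak_convergence(1,2)[OF d b l L2_zero] by auto
qed

end

section \<open>The gradient of the kernel on atoms\<close>

text \<open>The kernel of \<open>(A - 1) lap\<^sup>-\<^sup>1\<^sup>/\<^sup>2\<close>: composing with \<open>A\<close> shifts the ascent by one, which leaves differences of
  \<open>kappa\<close> except in the row of ascent \<open>0\<close>.\<close>

fun grad_kernel :: "nat \<Rightarrow> nat \<Rightarrow> real" where
  "grad_kernel 0 j = - kappa j"
| "grad_kernel (Suc i) j = kappa (i + j) - kappa (Suc (i + j))"

lemma abs_grad_kernel: "\<bar>grad_kernel 0 j\<bar> = kappa j" "\<bar>grad_kernel (Suc i) j\<bar> = kappa (i + j) - kappa (Suc (i + j))"
  using kappa_nonneg[of j] kappa_decseq[of "i + j" "Suc (i + j)"] by auto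

lemma grad_kernel_bound: "\<bar>grad_kernel i j\<bar> \<le> 2"
proof (cases i)
  case (Suc n)
  then show ?thesis using abs_grad_kernel(2)[of n j] kappa_bound[of "n + j"] kappa_nonneg[of "Suc (n + j)"] by simp
qed (use kappa_bound in simp)

lemma grad_kernel_mono:
  assumes "j \<le> j'" shows "\<bar>grad_kernel i j'\<bar> \<le> \<bar>grad_kernel i j\<bar>"
proof (cases i)
  case 0
  show ?thesis unfolding 0 abs_grad_kernel by (rule kappa_decseq[OF assms])
next
  case (Suc n)
  show ?thesis unfolding Suc abs_grad_kernel using assms by (intro kappa_convex) simp
qed

lemma grad_kernel_diff:
  assumes "j \<le> j'" shows "\<bar>grad_kernel i j - grad_kernel i j'\<bar> = \<bar>grad_kernel i j\<bar> - \<bar>grad_kernel i j'\<bar>"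
proof (cases i)
  case 0
  show ?thesis unfolding 0 using kappa_decseq[OF assms] kappa_nonneg[of j] kappa_nonneg[of j'] by simp
next
  case (Suc n)
  show ?thesis
    using grad_kernel_mono[OF assms, of i] abs_grad_kernel(2)[of n j] abs_grad_kernel(2)[of n j'] unfolding Suc by simp
qed

lemma kappa_telescope: "(\<Sum>i<n. kappa (i + a) - kappa (Suc (i + a))) = kappa a - kappa (n + a)"
  by (induction n) auto

text \<open>The cancellation of an atom replaces \<open>grad_kernel i a\<close> by a difference in the second argument. The sum over
  all ascents \<open>i\<close> then telescopes: once for the rows of positive ascent, and once more for row \<open>0\<close>.\<close>

lemma grad_kernel_telescope:
  assumes "a \<le> b"
  shows "(\<Sum>i<n. \<bar>grad_kernel i a\<bar> - \<bar>grad_kernel i b\<bar>) \<le> 2 * (kappa a - kappa b)"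
proof (cases n)
  case 0 then show ?thesis using kappa_decseq[OF assms] by simp
next
  case (Suc m)
  have "(\<Sum>i<n. \<bar>grad_kernel i a\<bar> - \<bar>grad_kernel i b\<bar>)
      = (kappa a - kappa b) + ((\<Sum>i<m. kappa (i + a) - kappa (Suc (i + a))) - (\<Sum>i<m. kappa (i + b) - kappa (Suc (i + b))))"
    unfolding Suc sum.lessThan_Suc_shift abs_grad_kernel sum_subtractf by simp
  also have "\<dots> \<le> 2 * (kappa a - kappa b)"
    unfolding kappa_telescope using kappa_decseq[of "m + a" "m + b"] assms by simp
  finally show ?thesis .
qed

lemma sum_shift_diff_le:
  fixes f :: "nat \<Rightarrow> real"
  assumes "\<And>k. 0 \<le> f k"
  shows "(\<Sum>k<n. f k - f (k + p)) \<le> (\<Sum>k<p. f k)"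
proof -
  have "(\<Sum>k<n. f (k + p)) + (\<Sum>k<p. f k) = (\<Sum>k<n + p. f k)" by (induction n) auto
  moreover have "(\<Sum>k<n. f k) \<le> (\<Sum>k<n + p. f k)" using assms by (intro sum_mono2) auto
  ultimately show ?thesis by (simp add: sum_subtractf)
qed

lemma ennreal_suminf_le:
  assumes "\<And>n. (\<Sum>i<n. f i) \<le> (C::ennreal)"
  shows "(\<Sum>i. f i) \<le> C"
  unfolding suminf_eq_SUP by (rule SUP_least) (rule assms)

context parent_tree
begin

lemma K_gradient:
  assumes f: "integrable M f"
  shows "K f (par x) - K f x = kernel_op grad_kernel f x"
proof -
  let ?k = "\<lambda>i j. kappa (i + j)"
  have sj: "summable (\<lambda>j. complex_of_real (kappa (i + j)) * (avg ^^ j) f y)" for i y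
    by (rule summable_norm_cancel) (rule kernel_row_summable(1)[OF f, of ?k], rule kappa_bound)
  have si: "summable (\<lambda>i. kernel_row ?k i f ((par ^^ i) x))" for x
    by (rule summable_norm_cancel) (rule kernel_op_summable(2)[OF f, of ?k], rule kappa_bound)
  have sg: "summable (\<lambda>i. kernel_row grad_kernel i f ((par ^^ i) x))" for x
    by (rule summable_norm_cancel) (rule kernel_op_summable(2)[OF f, of grad_kernel], rule grad_kernel_bound)
  have g0: "kernel_row grad_kernel 0 f x = - kernel_row ?k 0 f x"
    unfolding kernel_row_def by (simp add: suminf_minus sj[of 0, simplified])
  have gS: "kernel_row grad_kernel (Suc i) f y = kernel_row ?k i f y - kernel_row ?k (Suc i) f y" for i y
  proof -
    have "kernel_row ?k i f y - kernel_row ?k (Suc i) f y = (\<Sum>j. complex_of_real (kappa (i + j)) * (avg ^^ j) f y - complex_of_real (kappa (Suc i + j)) * (avg ^^ j) f y)"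
      unfolding kernel_row_def by (rule suminf_diff[OF sj sj])
    then show ?thesis unfolding kernel_row_def by (simp add: left_diff_distrib)
  qed
  have s1: "summable (\<lambda>i. kernel_row ?k i f ((par ^^ Suc i) x))" using si[of "par x"] by (simp add: funpow_swap1)
  have s2: "summable (\<lambda>i. kernel_row ?k (Suc i) f ((par ^^ Suc i) x))" by (subst summable_Suc_iff) (rule si)
  have "kernel_op grad_kernel f x = kernel_row grad_kernel 0 f x + (\<Sum>i. kernel_row grad_kernel (Suc i) f ((par ^^ Suc i) x))"
    unfolding kernel_op_def using suminf_split_head[OF sg[of x]] by simp
  also have "\<dots> = - kernel_row ?k 0 f x + ((\<Sum>i. kernel_row ?k i f ((par ^^ Suc i) x)) - (\<Sum>i. kernel_row ?k (Suc i) f ((par ^^ Suc i) x)))"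
    unfolding g0 gS suminf_diff[OF s1 s2] ..
  also have "(\<Sum>i. kernel_row ?k i f ((par ^^ Suc i) x)) = K f (par x)"
    unfolding K_def kernel_op_def by (simp add: funpow_swap1)
  also have "(\<Sum>i. kernel_row ?k (Suc i) f ((par ^^ Suc i) x)) = K f x - kernel_row ?k 0 f x"
    unfolding K_def kernel_op_def using suminf_split_head[OF si[of x]] by simp
  finally show ?thesis by simp
qed

lemma sum_w_desc: "(\<Sum>y\<in>desc j x. w y) = w x"
  using w_avg_pow[of x j "\<lambda>_. 1 :: real"] q2 by (simp add: avg_pow card_desc)

lemma sum_w_desc_Union:
  assumes "finite J" shows "(\<Sum>x\<in>(\<Union>j\<in>J. desc j r). w x) = real (card J) * w r"
  using assms by (subst sum.UNION_disjoint) (use desc_disjoint in \<open>auto simp: finite_desc sum_w_desc\<close>)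

end

text \<open>The envelope of a nondegenerate trapezoid consists of the descendants of \<open>r\<close> whose depths lie in \<open>D\<close>. The
  condition \<open>h/2 \<le> d\<close> is written without division.\<close>

locale tree_atom = parent_tree q par l for q and par :: "'v \<Rightarrow> 'v" and l +
  fixes r :: 'v and h :: nat and D S and a :: "'v \<Rightarrow> complex"
  assumes h: "1 \<le> h"
    and D: "D = {d. h \<le> 2 * d \<and> d < 4 * h}" and S: "S = (\<Union>d\<in>D. desc d r)"
    and supp: "\<And>x. x \<notin> S \<Longrightarrow> a x = 0"
    and bound: "\<And>x. cmod (a x) \<le> 1 / measure M S"
    and mean: "(\<integral>x. a x \<partial>M) = 0"
begin

lemma finite_D: "finite D" and finite_S: "finite S"
  unfolding S D using finite_desc by auto

lemma finite_supp: "finite {x. a x \<noteq> 0}"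
  by (rule finite_subset[OF _ finite_S]) (use supp in auto)

definition depth :: "'v \<Rightarrow> nat" where "depth z = nat (l r - l z)"

lemma depth: "z \<in> S \<Longrightarrow> z \<in> desc (depth z) r" "z \<in> S \<Longrightarrow> depth z \<in> D"
proof -
  assume "z \<in> S"
  then obtain d where "d \<in> D" "z \<in> desc d r" unfolding S by blast
  moreover from this have "depth z = d" unfolding depth_def using l_desc by simp
  ultimately show "z \<in> desc (depth z) r" "depth z \<in> D" by auto
qed

lemma sum_S: "(\<Sum>z\<in>S. w z) = real (card D) * w r"
  unfolding S by (rule sum_w_desc_Union[OF finite_D])

lemma measure_S: "measure M S = real (card D) * w r"
  unfolding measure_def emeasure_finite[OF finite_S] sum_S
  using w_pos[of r] by (simp add: less_imp_le)

lemma card_D: "3 * h \<le> card D"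
proof -
  have "D = {(h + 1) div 2..<4 * h}" unfolding D by auto
  then show ?thesis using h by simp
qed

lemma measure_S_ge: "3 * real h * w r \<le> measure M S" "0 < measure M S"
proof -
  show 1: "3 * real h * w r \<le> measure M S"
    unfolding measure_S using card_D w_pos[of r] by (intro mult_right_mono) (auto simp: less_imp_le)
  have "0 < 3 * real h * w r" using h w_pos[of r] by simp
  with 1 show "0 < measure M S" by linarith
qed

lemma sum_w_S: "(\<Sum>z\<in>S. w z) = measure M S"
  unfolding measure_S by (rule sum_S)

lemma norm1: "(\<Sum>z\<in>S. w z * cmod (a z)) \<le> 1"
proof -
  have "(\<Sum>z\<in>S. w z * cmod (a z)) \<le> (\<Sum>z\<in>S. w z * (1 / measure M S))"
    by (intro sum_mono mult_left_mono bound) (simp add: less_imp_le w_pos)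
  also have "\<dots> = 1" using measure_S_ge(2) by (simp add: sum_w_S sum_divide_distrib[symmetric])
  finally show ?thesis .
qed

lemma nn_norm1: "(\<integral>\<^sup>+x. ennreal (cmod (a x)) \<partial>M) \<le> 1"
  using nn_finite_support[OF finite_S, of "\<lambda>x. cmod (a x)"] supp norm1 by simp

lemma norm2: "(\<integral>x. (cmod (a x))\<^sup>2 \<partial>M) \<le> 1 / measure M S"
proof -
  have "(\<integral>x. (cmod (a x))\<^sup>2 \<partial>M) = (\<Sum>z\<in>S. w z * (cmod (a z))\<^sup>2)"
    using integral_finite_support(2)[OF finite_S, of "\<lambda>x. (cmod (a x))\<^sup>2"] supp by simp
  also have "\<dots> = (\<Sum>z\<in>S. w z * cmod (a z) * cmod (a z))" by (simp add: power2_eq_square mult_ac)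
  also have "\<dots> \<le> (\<Sum>z\<in>S. w z * cmod (a z) * (1 / measure M S))"
    by (intro sum_mono mult_left_mono bound) (simp add: less_imp_le w_pos)
  also have "\<dots> = (\<Sum>z\<in>S. w z * cmod (a z)) / measure M S" by (simp add: sum_divide_distrib)
  also have "\<dots> \<le> 1 / measure M S" using norm1 measure_S_ge(2) by (intro divide_right_mono) auto
  finally show ?thesis .
qed

lemma mean_sum: "(\<Sum>z\<in>S. complex_of_real (w z) * a z) = 0"
  using mean integral_finite_support(2)[OF finite_S, of a] supp by (simp add: scaleR_conv_of_real)

abbreviation "G x \<equiv> K a (par x) - K a x"

definition B :: "'v set" where "B = (\<Union>d\<in>{..<8 * h}. desc d r)"

lemma finite_B: "finite B"
  unfolding B_def using finite_desc by simp

text \<open>Near the support the size of the kernel alone would only give a bound that grows like \<open>ln h\<close>, but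
  \<open>B\<close> has measure comparable to \<open>S\<close>, and the \<open>L\<^sup>2\<close> bound together with the inequality between arithmetic and
  geometric means suffices.\<close>

lemma local_part: "(\<integral>\<^sup>+x. ennreal (cmod (G x) * indicator B x) \<partial>M) \<le> 4"
proof -
  define b where "b = 8 * real h * w r"
  have b: "b > 0" unfolding b_def using h w_pos[of r] by simp
  have wB: "(\<Sum>x\<in>B. w x) = b" unfolding B_def b_def using sum_w_desc_Union[of "{..<8 * h}" r] by simp
  have en: "(\<Sum>x\<in>B. w x * (cmod (G x))\<^sup>2) \<le> 2 * (1 / measure M S)"
  proof -
    have "(\<Sum>x\<in>B. w x * norm ((cmod (G x))\<^sup>2)) \<le> (\<integral>x. norm ((cmod (G x))\<^sup>2) \<partial>M)"
      by (rule sum_le_integral[OF L2D(2)[OF K_energy(1)[OF finite_supp]] finite_B])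
    then show ?thesis using K_energy(2)[OF finite_supp] norm2 by simp
  qed
  have "(\<Sum>x\<in>B. w x * (cmod (G x) * indicator B x)) \<le> (\<Sum>x\<in>B. w x / (2 * b) + b / 2 * (w x * (cmod (G x))\<^sup>2))"
  proof (rule sum_mono)
    fix x assume x: "x \<in> B"
    have "0 \<le> (1 - b * cmod (G x))\<^sup>2" by simp
    then have "2 * b * cmod (G x) \<le> 1 + b\<^sup>2 * (cmod (G x))\<^sup>2" by (simp add: power2_diff power_mult_distrib)
    then have "cmod (G x) \<le> (1 + b\<^sup>2 * (cmod (G x))\<^sup>2) / (2 * b)" using b by (simp add: pos_le_divide_eq mult_ac)
    also have "\<dots> = 1 / (2 * b) + b / 2 * (cmod (G x))\<^sup>2" using b by (simp add: field_simps power2_eq_square)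
    finally have "w x * cmod (G x) \<le> w x * (1 / (2 * b) + b / 2 * (cmod (G x))\<^sup>2)"
      using w_pos[of x] by (intro mult_left_mono) (auto simp: less_imp_le)
    then show "w x * (cmod (G x) * indicator B x) \<le> w x / (2 * b) + b / 2 * (w x * (cmod (G x))\<^sup>2)"
      using x by (simp add: distrib_left mult_ac)
  qed
  also have "\<dots> = 1 / 2 + b / 2 * (\<Sum>x\<in>B. w x * (cmod (G x))\<^sup>2)"
    unfolding sum.distrib sum_distrib_left[symmetric] sum_divide_distrib[symmetric] wB using b by simp
  also have "\<dots> \<le> 1 / 2 + b / 2 * (2 * (1 / measure M S))"
    using b by (intro add_left_mono mult_left_mono en) simp
  also have "\<dots> \<le> 4"
  proof -
    have "0 \<le> real h * w r" using w_pos[of r] by simp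
    then have "b \<le> 3 * measure M S" using measure_S_ge(1) unfolding b_def by linarith
    then have "b / measure M S \<le> 3" using measure_S_ge(2) by (simp add: pos_divide_le_eq)
    then show ?thesis by simp
  qed
  finally have "(\<Sum>x\<in>B. w x * (cmod (G x) * indicator B x)) \<le> 4" .
  moreover have "(\<integral>\<^sup>+x. ennreal (cmod (G x) * indicator B x) \<partial>M) = ennreal (\<Sum>x\<in>B. w x * (cmod (G x) * indicator B x))"
    by (rule nn_finite_support[OF finite_B]) auto
  ultimately show ?thesis using ennreal_leI[of _ 4] by simp
qed

lemma avg_pow_supp:
  assumes "(avg ^^ j) a y \<noteq> 0"
  obtains z where "z \<in> S" "(par ^^ j) z = y"
proof -
  have "\<exists>z\<in>desc j y. a z \<noteq> 0"
  proof (rule ccontr)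
    assume "\<not> ?thesis"
    then have "(avg ^^ j) a y = 0" by (simp add: avg_pow)
    then show False using assms by simp
  qed
  then show ?thesis using that supp unfolding desc_def by blast
qed

lemma kernel_row_finite:
  assumes "\<And>j. n \<le> j \<Longrightarrow> (avg ^^ j) a y = 0"
  shows "kernel_row c i a y = (\<Sum>j<n. complex_of_real (c i j) * (avg ^^ j) a y)"
  unfolding kernel_row_def by (rule suminf_finite) (auto simp: assms not_less)

text \<open>For \<open>x\<close> outside \<open>B\<close>, the term of ascent \<open>i\<close> sees the atom from \<open>y = par\<^sup>i x\<close>. If \<open>y\<close> is \<open>r\<close> or below it,
  and a term is nonzero, then \<open>i \<ge> 4 h\<close>, and the size of the kernel alone gives convergence; this is
  \<open>below\<close>. Otherwise \<open>y\<close> is a strict ancestor of \<open>r\<close>, and \<open>above\<close> collects these terms.\<close>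

definition below :: "nat \<Rightarrow> 'v \<Rightarrow> real" where
  "below i y = (if 4 * h \<le> i then \<Sum>j<4 * h. \<bar>grad_kernel i j\<bar> * cmod ((avg ^^ j) a y) else 0)"

definition above :: "nat \<Rightarrow> 'v \<Rightarrow> real" where
  "above i y = (if \<exists>e. (par ^^ e) y = r then 0 else cmod (kernel_row grad_kernel i a y))"

lemma split_below_above:
  assumes x: "x \<notin> B"
  shows "cmod (kernel_row grad_kernel i a ((par ^^ i) x)) \<le> below i ((par ^^ i) x) + above i ((par ^^ i) x)"
proof -
  let ?y = "(par ^^ i) x"
  have l0: "0 \<le> below i ?y" unfolding below_def by (auto intro!: sum_nonneg)
  show ?thesis
  proof (cases "\<exists>e. (par ^^ e) ?y = r")
    case False then show ?thesis using l0 unfolding above_def by simp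
  next
    case True
    then obtain e where e: "(par ^^ e) ?y = r" by blast
    have "x \<in> desc (e + i) r" unfolding desc_def using e by (simp add: funpow_add)
    then have ei: "8 * h \<le> e + i" using x unfolding B_def by (auto simp: not_less[symmetric])
    have j: "e + j < 4 * h" if nz: "(avg ^^ j) a ?y \<noteq> 0" for j
    proof -
      obtain z where z: "z \<in> S" "(par ^^ j) z = ?y" using nz by (rule avg_pow_supp)
      have "l r = l ?y + int e" using l_par_pow[of e ?y] e by simp
      also have "l ?y = l z + int j" using l_par_pow[of j z] z(2) by simp
      finally have "depth z = e + j" unfolding depth_def by simp
      then show ?thesis using depth(2)[OF z(1)] unfolding D by simp
    qed
    have k: "kernel_row grad_kernel i a ?y = (\<Sum>j<4 * h. complex_of_real (grad_kernel i j) * (avg ^^ j) a ?y)"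
      by (rule kernel_row_finite) (use j in fastforce)
    show ?thesis
    proof (cases "4 * h \<le> i")
      case True
      have "cmod (kernel_row grad_kernel i a ?y) \<le> below i ?y"
        unfolding k below_def using True by (auto intro!: sum_norm_le simp: norm_mult)
      then show ?thesis using \<open>\<exists>e. _\<close> unfolding above_def by simp
    next
      case False
      then have "4 * h \<le> e" using ei by simp
      then have "(avg ^^ j) a ?y = 0" for j using j[of j] by fastforce
      then have "kernel_row grad_kernel i a ?y = 0" unfolding k by simp
      then show ?thesis using l0 unfolding above_def by simp
    qed
  qed
qed

lemma sum_below: "(\<Sum>i. \<integral>\<^sup>+x. ennreal (below i x) \<partial>M) \<le> 2"
proof (rule ennreal_suminf_le)
  fix n
  have i: "(\<integral>\<^sup>+x. ennreal (below i x) \<partial>M) \<le> ennreal (if 4 * h \<le> i then 4 * real h * \<bar>grad_kernel i 0\<bar> else 0)" for i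
  proof (cases "4 * h \<le> i")
    case True
    have "(\<integral>\<^sup>+x. ennreal (below i x) \<partial>M) = (\<integral>\<^sup>+x. (\<Sum>j<4 * h. ennreal \<bar>grad_kernel i j\<bar> * ennreal (cmod ((avg ^^ j) a x))) \<partial>M)"
      unfolding below_def using True by (intro nn_integral_cong) (simp add: ennreal_mult[symmetric])
    also have "\<dots> = (\<Sum>j<4 * h. ennreal \<bar>grad_kernel i j\<bar> * (\<integral>\<^sup>+x. ennreal (cmod ((avg ^^ j) a x)) \<partial>M))"
      by (simp add: nn_integral_sum nn_integral_cmult)
    also have "\<dots> \<le> (\<Sum>j<4 * h. ennreal \<bar>grad_kernel i 0\<bar> * 1)"
      by (intro sum_mono mult_mono ennreal_leI grad_kernel_mono order_trans[OF nn_avg_pow_le nn_norm1]) auto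
    also have "\<dots> = ennreal (4 * real h * \<bar>grad_kernel i 0\<bar>)"
      by (simp add: ennreal_mult ennreal_of_nat_eq_real_of_nat)
    finally show ?thesis using True by simp
  qed (simp add: below_def)
  have "(\<Sum>i<n. \<integral>\<^sup>+x. ennreal (below i x) \<partial>M) \<le> (\<Sum>i<n. ennreal (if 4 * h \<le> i then 4 * real h * \<bar>grad_kernel i 0\<bar> else 0))"
    by (intro sum_mono i)
  also have "\<dots> = ennreal (\<Sum>i<n. if 4 * h \<le> i then 4 * real h * \<bar>grad_kernel i 0\<bar> else 0)"
    by (rule sum_ennreal) auto
  also have "\<dots> \<le> ennreal 2"
  proof (rule ennreal_leI)
    have "(\<Sum>i<n. if 4 * h \<le> i then 4 * real h * \<bar>grad_kernel i 0\<bar> else 0)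
        \<le> (\<Sum>i<n + 4 * h. if 4 * h \<le> i then 4 * real h * \<bar>grad_kernel i 0\<bar> else 0)"
      by (intro sum_mono2) auto
    also have "\<dots> = (\<Sum>i<n. 4 * real h * \<bar>grad_kernel (i + 4 * h) 0\<bar>)"
      by (induction n) (auto simp: add.commute)
    also have "\<dots> = 4 * real h * (\<Sum>i<n. kappa (i + (4 * h - 1)) - kappa (Suc (i + (4 * h - 1))))"
    proof -
      have "\<bar>grad_kernel (i + 4 * h) 0\<bar> = kappa (i + (4 * h - 1)) - kappa (Suc (i + (4 * h - 1)))" for i
        using abs_grad_kernel(2)[of "i + (4 * h - 1)" 0] h by simp
      then show ?thesis by (simp add: sum_distrib_left)
    qed
    also have "\<dots> \<le> 4 * real h * (1 / (real (4 * h - 1) + 1/2))"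
      unfolding kappa_telescope using kappa_le[of "4 * h - 1"] kappa_nonneg[of "n + (4 * h - 1)"]
      by (intro mult_left_mono) auto
    also have "\<dots> \<le> 2"
    proof -
      have "real (4 * h - 1) = 4 * real h - 1" using h by (simp add: of_nat_diff)
      then show ?thesis using h by (simp add: field_simps)
    qed
    finally show "(\<Sum>i<n. if 4 * h \<le> i then 4 * real h * \<bar>grad_kernel i 0\<bar> else 0) \<le> 2" .
  qed
  finally show "(\<Sum>i<n. \<integral>\<^sup>+x. ennreal (below i x) \<partial>M) \<le> 2" by simp
qed

text \<open>The smallest element of \<open>D\<close>.\<close>

definition d0 :: nat where "d0 = (h + 1) div 2"

text \<open>Seen from an ancestor of \<open>r\<close>, the kernel depends only on the depth of the point of the support. The
  vanishing mean permits subtraction of its value at depth \<open>4 h\<close>.\<close>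

lemma above_le:
  assumes y: "y = (par ^^ k) r"
  shows "w y * cmod (kernel_row grad_kernel i a y) \<le> \<bar>grad_kernel i (d0 + k)\<bar> - \<bar>grad_kernel i (4 * h + k)\<bar>"
proof -
  have in_desc: "z \<in> desc j y \<longleftrightarrow> j = depth z + k" if z: "z \<in> S" for z j
  proof
    assume "z \<in> desc j y"
    then have "l y = l z + int j" using l_desc by fastforce
    moreover have "l y = l r + int k" unfolding y by (rule l_par_pow)
    moreover have "l r = l z + int (depth z)" using l_desc[OF depth(1)[OF z]] by simp
    ultimately show "j = depth z + k" by simp
  next
    assume j: "j = depth z + k"
    have "(par ^^ depth z) z = r" using depth(1)[OF z] unfolding desc_def by simp
    then have "(par ^^ (k + depth z)) z = y" unfolding y by (simp add: funpow_add)
    then show "z \<in> desc j y" unfolding desc_def j by (simp add: add.commute)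
  qed
  have wd: "complex_of_real (w y) * (avg ^^ j) a y = (\<Sum>z\<in>S. if j = depth z + k then complex_of_real (w z) * a z else 0)" for j
  proof -
    have "complex_of_real (w y) * (avg ^^ j) a y = (\<Sum>z\<in>desc j y \<inter> S. complex_of_real (w z) * a z)"
      unfolding w_avg_pow by (rule sum.mono_neutral_right) (auto simp: finite_desc supp)
    also have "desc j y \<inter> S = S \<inter> {z. j = depth z + k}" using in_desc by auto
    also have "(\<Sum>z\<in>\<dots>. complex_of_real (w z) * a z) = (\<Sum>z\<in>S. if j = depth z + k then complex_of_real (w z) * a z else 0)"
      using finite_S by (simp add: sum.inter_restrict)
    finally show ?thesis .
  qed
  have dl: "d0 \<le> depth z" "depth z < 4 * h" if "z \<in> S" for z
    using depth(2)[OF that] unfolding D d0_def by auto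
  have "kernel_row grad_kernel i a y = (\<Sum>j<4 * h + k. complex_of_real (grad_kernel i j) * (avg ^^ j) a y)"
  proof (rule kernel_row_finite)
    fix j assume "4 * h + k \<le> j"
    then have "complex_of_real (w y) * (avg ^^ j) a y = 0" unfolding wd using dl(2) by (intro sum.neutral) fastforce
    then show "(avg ^^ j) a y = 0" using w_pos[of y] by simp
  qed
  then have "complex_of_real (w y) * kernel_row grad_kernel i a y = (\<Sum>j<4 * h + k. complex_of_real (grad_kernel i j) * (complex_of_real (w y) * (avg ^^ j) a y))"
    by (simp add: sum_distrib_left mult_ac)
  also have "\<dots> = (\<Sum>z\<in>S. \<Sum>j<4 * h + k. if j = depth z + k then complex_of_real (grad_kernel i j) * (complex_of_real (w z) * a z) else 0)"
    unfolding wd by (subst sum.swap) (simp add: sum_distrib_left if_distrib cong: if_cong)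
  also have "\<dots> = (\<Sum>z\<in>S. complex_of_real (grad_kernel i (depth z + k)) * (complex_of_real (w z) * a z))"
    using dl(2) by (intro sum.cong refl) simp
  also have "\<dots> = (\<Sum>z\<in>S. complex_of_real (grad_kernel i (depth z + k) - grad_kernel i (4 * h + k)) * (complex_of_real (w z) * a z))"
  proof -
    have "(\<Sum>z\<in>S. complex_of_real (grad_kernel i (depth z + k) - grad_kernel i (4 * h + k)) * (complex_of_real (w z) * a z))
       = (\<Sum>z\<in>S. complex_of_real (grad_kernel i (depth z + k)) * (complex_of_real (w z) * a z))
         - complex_of_real (grad_kernel i (4 * h + k)) * (\<Sum>z\<in>S. complex_of_real (w z) * a z)"
      by (simp add: left_diff_distrib sum_subtractf sum_distrib_left)
    then show ?thesis unfolding mean_sum by simp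
  qed
  finally have e: "complex_of_real (w y) * kernel_row grad_kernel i a y = \<dots>" .
  have "w y * cmod (kernel_row grad_kernel i a y) = cmod (complex_of_real (w y) * kernel_row grad_kernel i a y)"
    using w_pos[of y] by (simp add: norm_mult)
  also have "\<dots> \<le> (\<Sum>z\<in>S. (\<bar>grad_kernel i (d0 + k)\<bar> - \<bar>grad_kernel i (4 * h + k)\<bar>) * (w z * cmod (a z)))"
    unfolding e
  proof (rule sum_norm_le)
    fix z assume z: "z \<in> S"
    have "\<bar>grad_kernel i (depth z + k) - grad_kernel i (4 * h + k)\<bar> \<le> \<bar>grad_kernel i (d0 + k)\<bar> - \<bar>grad_kernel i (4 * h + k)\<bar>"
      using grad_kernel_diff[of "depth z + k" "4 * h + k" i] grad_kernel_mono[of "d0 + k" "depth z + k" i] dl[OF z] by simp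
    moreover have "cmod (complex_of_real (grad_kernel i (depth z + k) - grad_kernel i (4 * h + k)) * (complex_of_real (w z) * a z))
        = \<bar>grad_kernel i (depth z + k) - grad_kernel i (4 * h + k)\<bar> * (w z * cmod (a z))"
      unfolding norm_mult norm_of_real using w_pos[of z] by simp
    ultimately show "cmod (complex_of_real (grad_kernel i (depth z + k) - grad_kernel i (4 * h + k)) * (complex_of_real (w z) * a z))
       \<le> (\<bar>grad_kernel i (d0 + k)\<bar> - \<bar>grad_kernel i (4 * h + k)\<bar>) * (w z * cmod (a z))"
      using w_pos[of z] by (simp add: mult_right_mono less_imp_le)
  qed
  also have "\<dots> \<le> (\<bar>grad_kernel i (d0 + k)\<bar> - \<bar>grad_kernel i (4 * h + k)\<bar>) * 1"
    unfolding sum_distrib_left[symmetric] using grad_kernel_mono[of "d0 + k" "4 * h + k" i] h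
    by (intro mult_left_mono norm1) (auto simp: d0_def)
  finally show ?thesis by simp
qed

lemma above_supp:
  assumes "above i y \<noteq> 0" obtains k where "y = (par ^^ Suc k) r"
proof -
  have no: "(par ^^ e) y \<noteq> r" for e
  proof
    assume "(par ^^ e) y = r"
    then have "above i y = 0" unfolding above_def by (intro if_P exI)
    with assms show False by simp
  qed
  have "kernel_row grad_kernel i a y \<noteq> 0" using assms unfolding above_def by (auto split: if_splits)
  have "\<exists>j. (avg ^^ j) a y \<noteq> 0"
  proof (rule ccontr)
    assume "\<not> ?thesis"
    then have "kernel_row grad_kernel i a y = 0" by (simp add: kernel_row_def)
    with \<open>kernel_row grad_kernel i a y \<noteq> 0\<close> show False by contradiction
  qed
  then obtain j where "(avg ^^ j) a y \<noteq> 0" by blast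
  then obtain z where z: "z \<in> S" "(par ^^ j) z = y" by (rule avg_pow_supp)
  have zr: "(par ^^ depth z) z = r" using depth(1)[OF z(1)] unfolding desc_def by simp
  show ?thesis
  proof (cases "j \<le> depth z")
    case True
    then have "(par ^^ (depth z - j)) y = (par ^^ (depth z - j + j)) z" unfolding z(2)[symmetric] by (simp only: funpow_add o_apply)
    then show ?thesis using no zr True by simp
  next
    case False
    then obtain k where k: "j = Suc k + depth z" using less_imp_Suc_add[of "depth z" j] by auto
    have "y = (par ^^ Suc k) ((par ^^ depth z) z)" unfolding z(2)[symmetric] k by (simp only: funpow_add o_apply)
    then have "y = (par ^^ Suc k) r" by (simp only: zr)
    then show ?thesis by (rule that)
  qed
qed

text \<open>After telescoping in the ascent, the sum over the ancestors telescopes as well, and leaves the sum of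
  \<open>kappa\<close> over the indices from \<open>h/2\<close> to \<open>4 h\<close>, a bounded stretch of the harmonic series.\<close>

lemma sum_above: "(\<Sum>i. \<integral>\<^sup>+x. ennreal (above i x) \<partial>M) \<le> 16"
proof (rule ennreal_suminf_le)
  fix n
  define e where "e i k = \<bar>grad_kernel i (d0 + Suc k)\<bar> - \<bar>grad_kernel i (4 * h + Suc k)\<bar>" for i k
  have d0h: "d0 \<le> 4 * h" unfolding d0_def by simp
  have e0: "0 \<le> e i k" for i k unfolding e_def using grad_kernel_mono[of "d0 + Suc k" "4 * h + Suc k" i] d0h by simp
  have i: "(\<integral>\<^sup>+x. ennreal (above i x) \<partial>M) \<le> (\<Sum>k. ennreal (e i k))" for i
  proof -
    define t where "t k y = (if y = (par ^^ Suc k) r then cmod (kernel_row grad_kernel i a y) else 0)" for k y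
    have "ennreal (above i y) \<le> (\<Sum>k. ennreal (t k y))" for y
    proof (cases "above i y = 0")
      case False
      then obtain k where k: "y = (par ^^ Suc k) r" by (rule above_supp)
      have "ennreal (above i y) \<le> ennreal (t k y)" unfolding t_def above_def using k by (auto intro: ennreal_leI)
      also have "\<dots> \<le> (\<Sum>k. ennreal (t k y))"
        using sum_le_suminf[of "\<lambda>k. ennreal (t k y)" "{k}"] by simp
      finally show ?thesis .
    qed simp
    then have "(\<integral>\<^sup>+x. ennreal (above i x) \<partial>M) \<le> (\<integral>\<^sup>+x. (\<Sum>k. ennreal (t k x)) \<partial>M)" by (intro nn_integral_mono)
    also have "\<dots> = (\<Sum>k. \<integral>\<^sup>+x. ennreal (t k x) \<partial>M)" by (rule nn_integral_suminf) simp
    also have "\<dots> \<le> (\<Sum>k. ennreal (e i k))"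
    proof (rule suminf_le)
      fix k
      have "(\<integral>\<^sup>+x. ennreal (t k x) \<partial>M) = ennreal (w ((par ^^ Suc k) r) * cmod (kernel_row grad_kernel i a ((par ^^ Suc k) r)))"
        by (subst nn_finite_support[of "{(par ^^ Suc k) r}"]) (auto simp: t_def)
      also have "\<dots> \<le> ennreal (e i k)" unfolding e_def by (intro ennreal_leI above_le refl)
      finally show "(\<integral>\<^sup>+x. ennreal (t k x) \<partial>M) \<le> ennreal (e i k)" .
    qed auto
    finally show ?thesis .
  qed
  have "(\<Sum>i<n. \<integral>\<^sup>+x. ennreal (above i x) \<partial>M) \<le> (\<Sum>i<n. \<Sum>k. ennreal (e i k))" by (intro sum_mono i)
  also have "\<dots> = (\<Sum>k. \<Sum>i<n. ennreal (e i k))" by (rule suminf_sum[symmetric]) auto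
  also have "\<dots> \<le> 16"
  proof (rule ennreal_suminf_le)
    fix m
    have "(\<Sum>k<m. \<Sum>i<n. e i k) \<le> (\<Sum>k<m. 2 * (kappa (d0 + Suc k) - kappa (4 * h + Suc k)))"
      unfolding e_def using d0h by (intro sum_mono grad_kernel_telescope) simp
    also have "\<dots> = 2 * (\<Sum>k<m. kappa (d0 + Suc k) - kappa (d0 + Suc (k + (4 * h - d0))))"
    proof -
      have "d0 + Suc (k + (4 * h - d0)) = 4 * h + Suc k" for k using d0h by simp
      then show ?thesis by (simp only: sum_distrib_left)
    qed
    also have "\<dots> \<le> 2 * (\<Sum>k<4 * h - d0. kappa (d0 + Suc k))"
      using sum_shift_diff_le[where f = "\<lambda>k. kappa (d0 + Suc k)" and n = m and p = "4 * h - d0"] kappa_nonneg by simp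
    also have "\<dots> \<le> 2 * (\<Sum>k<4 * h - d0. kappa d0)"
      by (intro mult_left_mono sum_mono kappa_decseq) auto
    also have "\<dots> = 2 * (real (4 * h - d0) * kappa d0)" by simp
    also have "\<dots> \<le> 2 * (real (4 * h) * (1 / (real d0 + 1/2)))"
      by (intro mult_left_mono mult_mono kappa_le kappa_nonneg) auto
    also have "\<dots> \<le> 16"
    proof -
      have "h \<le> 2 * d0" unfolding d0_def by simp
      then have "real h \<le> 2 * real d0" by linarith
      then show ?thesis by (simp add: field_simps)
    qed
    finally have "(\<Sum>k<m. \<Sum>i<n. e i k) \<le> 16" .
    moreover have "(\<Sum>k<m. \<Sum>i<n. ennreal (e i k)) = ennreal (\<Sum>k<m. \<Sum>i<n. e i k)"
      using e0 by (simp add: sum_ennreal sum_nonneg)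
    ultimately show "(\<Sum>k<m. \<Sum>i<n. ennreal (e i k)) \<le> 16"
      using ennreal_leI[of _ 16] by simp
  qed
  finally show "(\<Sum>i<n. \<integral>\<^sup>+x. ennreal (above i x) \<partial>M) \<le> 16" .
qed

lemma atom_bound: "(\<integral>\<^sup>+x. ennreal (cmod (G x)) \<partial>M) \<le> 22"
proof -
  have int: "integrable M a" by (rule finite_support_integrable[OF finite_supp])
  have G: "ennreal (cmod (G x)) \<le> (\<Sum>i. ennreal (below i ((par ^^ i) x))) + (\<Sum>i. ennreal (above i ((par ^^ i) x)))"
    if x: "x \<notin> B" for x
  proof -
    have s: "summable (\<lambda>i. cmod (kernel_row grad_kernel i a ((par ^^ i) x)))"
      by (rule kernel_op_summable(2)[OF int, of grad_kernel]) (rule grad_kernel_bound)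
    have "ennreal (cmod (G x)) \<le> ennreal (\<Sum>i. cmod (kernel_row grad_kernel i a ((par ^^ i) x)))"
      unfolding K_gradient[OF int] kernel_op_def by (intro ennreal_leI summable_norm s)
    also have "\<dots> = (\<Sum>i. ennreal (cmod (kernel_row grad_kernel i a ((par ^^ i) x))))"
      by (rule suminf_ennreal2[symmetric, OF _ s]) simp
    also have "\<dots> \<le> (\<Sum>i. ennreal (below i ((par ^^ i) x)) + ennreal (above i ((par ^^ i) x)))"
    proof (rule suminf_le)
      fix i
      have "0 \<le> below i ((par ^^ i) x)" "0 \<le> above i ((par ^^ i) x)"
        unfolding below_def above_def by (auto intro!: sum_nonneg)
      then show "ennreal (cmod (kernel_row grad_kernel i a ((par ^^ i) x))) \<le> ennreal (below i ((par ^^ i) x)) + ennreal (above i ((par ^^ i) x))"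
        using split_below_above[OF x, of i] by (simp add: ennreal_plus[symmetric] ennreal_leI del: ennreal_plus)
    qed auto
    also have "\<dots> = (\<Sum>i. ennreal (below i ((par ^^ i) x))) + (\<Sum>i. ennreal (above i ((par ^^ i) x)))"
      by (rule suminf_add[symmetric]) auto
    finally show ?thesis .
  qed
  have "(\<integral>\<^sup>+x. ennreal (cmod (G x)) \<partial>M) \<le> (\<integral>\<^sup>+x. ennreal (cmod (G x) * indicator B x) +
      ((\<Sum>i. ennreal (below i ((par ^^ i) x))) + (\<Sum>i. ennreal (above i ((par ^^ i) x)))) \<partial>M)"
  proof (rule nn_integral_mono)
    fix x
    show "ennreal (cmod (G x)) \<le> ennreal (cmod (G x) * indicator B x) +
      ((\<Sum>i. ennreal (below i ((par ^^ i) x))) + (\<Sum>i. ennreal (above i ((par ^^ i) x))))"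
      using G[of x] by (cases "x \<in> B") auto
  qed
  also have "\<dots> = (\<integral>\<^sup>+x. ennreal (cmod (G x) * indicator B x) \<partial>M) +
      ((\<Sum>i. \<integral>\<^sup>+x. ennreal (below i ((par ^^ i) x)) \<partial>M) + (\<Sum>i. \<integral>\<^sup>+x. ennreal (above i ((par ^^ i) x)) \<partial>M))"
    by (simp add: nn_integral_add nn_integral_suminf)
  also have "\<dots> \<le> 4 + (2 + 16)"
    unfolding nn_par_pow[of "\<lambda>x. ennreal (below _ x)"] nn_par_pow[of "\<lambda>x. ennreal (above _ x)"]
    by (intro add_mono local_part sum_below sum_above)
  finally show ?thesis by simp
qed

end

section \<open>From atoms to the Hardy space\<close>

context levelled_tree
begin

lemma dist_1: "graph_dist adj x y = 1 \<longleftrightarrow> adj x y"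
  by (rule dist_1_iff[OF conn])

end

locale riesz_tree = levelled_tree adj q g N for adj :: "'v \<Rightarrow> 'v \<Rightarrow> bool" and q g N +
  assumes q_ge_2: "2 \<le> q"
begin

sublocale parent_tree q par lev
  by standard (use q_ge_2 par(2) card_children in auto)

lemma sum_neighbours:
  fixes F :: "'v \<Rightarrow> 'b::comm_monoid_add"
  shows "(\<Sum>y | graph_dist adj x y = 1. F y) = F (par x) + (\<Sum>y | par y = x. F y)"
  unfolding dist_1 neighbours(1) using finite_children[of x] neighbours(2)[of x] by (subst sum.insert) auto

lemma laplacian_eq: "laplacian q adj lev = lap"
proof (intro ext)
  fix f x
  have q0: "real q > 0" using q_ge_2 by simp
  have up: "real q powr (real_of_int (lev (par x) - lev x) / 2) = sqrt (real q)"
    using q0 by (simp add: par(2) powr_half_sqrt)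
  have down: "real q powr (real_of_int (lev y - lev x) / 2) = 1 / sqrt (real q)" if "par y = x" for y
  proof -
    have "real_of_int (lev y - lev x) / 2 = - (1 / 2)" using par(2)[of y] that by simp
    then show ?thesis using q0 by (simp only: powr_minus powr_half_sqrt[OF less_imp_le[OF q0]]) (simp add: inverse_eq_divide)
  qed
  have "(\<Sum>y | graph_dist adj x y = 1. complex_of_real (real q powr (real_of_int (lev y - lev x) / 2)) * f y)
      = complex_of_real (sqrt (real q)) * f (par x) + (\<Sum>y | par y = x. complex_of_real (1 / sqrt (real q)) * f y)"
    unfolding sum_neighbours up using down by (intro arg_cong2[of _ _ _ _ "(+)"] refl sum.cong) auto
  also have "\<dots> = complex_of_real (sqrt (real q)) * f (par x) + complex_of_real (1 / sqrt (real q)) * (of_nat q * avg f x)"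
  proof -
    have "of_nat q * avg f x = (\<Sum>y | par y = x. f y)" unfolding avg_def using q0 by simp
    then show ?thesis by (simp only: sum_distrib_left)
  qed
  finally have s: "laplacian q adj lev f x = f x - complex_of_real (1 / (2 * sqrt (real q))) *
     (complex_of_real (sqrt (real q)) * f (par x) + complex_of_real (1 / sqrt (real q)) * (of_nat q * avg f x))"
    unfolding laplacian_def by simp
  have c: "complex_of_real (1 / (2 * sqrt (real q))) * complex_of_real (sqrt (real q)) = 1 / 2"
    unfolding of_real_mult[symmetric] using q0 by simp
  have d: "complex_of_real (1 / (2 * sqrt (real q))) * (complex_of_real (1 / sqrt (real q)) * of_nat q) = 1 / 2"
  proof -
    have "1 / (2 * sqrt (real q)) * (1 / sqrt (real q) * real q) = 1 / 2"
      using q0 real_sqrt_mult_self[of "real q"] by (simp add: field_simps)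
    from arg_cong[OF this, of complex_of_real] show ?thesis by simp
  qed
  have e: "\<alpha> * (\<beta> * u + \<gamma> * (\<delta> * v)) = (\<alpha> * \<beta>) * u + (\<alpha> * (\<gamma> * \<delta>)) * v" for \<alpha> \<beta> \<gamma> \<delta> u v :: complex
    by (simp add: algebra_simps)
  show "laplacian q adj lev f x = lap f x"
    unfolding s e c d lap_def by (simp add: add_divide_distrib)
qed

lemma gradient_eq: "gradient adj f x = cmod (f (par x) - f x) + real q * avg (\<lambda>y. cmod (f (par y) - f y)) x"
proof -
  have "(\<Sum>y | par y = x. cmod (f y - f x)) = (\<Sum>y | par y = x. cmod (f (par y) - f y))"
    by (intro sum.cong refl) (auto simp: norm_minus_commute)
  then show ?thesis unfolding gradient_def sum_neighbours using q_ge_2 by (simp add: avg_def)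
qed

lemma gradient_nonneg: "0 \<le> gradient adj f x"
  unfolding gradient_def by (intro sum_nonneg) simp

lemma nn_gradient:
  "(\<integral>\<^sup>+x. ennreal (gradient adj f x) \<partial>M) = ennreal (1 + real q) * (\<integral>\<^sup>+x. ennreal (cmod (f (par x) - f x)) \<partial>M)"
proof -
  have "(\<integral>\<^sup>+x. ennreal (gradient adj f x) \<partial>M)
      = (\<integral>\<^sup>+x. ennreal (cmod (f (par x) - f x)) + ennreal (real q) * ennreal (avg (\<lambda>y. cmod (f (par y) - f y)) x) \<partial>M)"
    unfolding gradient_eq by (intro nn_integral_cong) (simp add: avg_nonneg ennreal_mult)
  also have "\<dots> = (\<integral>\<^sup>+x. ennreal (cmod (f (par x) - f x)) \<partial>M)
      + ennreal (real q) * (\<integral>\<^sup>+x. ennreal (avg (\<lambda>y. cmod (f (par y) - f y)) x) \<partial>M)"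
    by (simp add: nn_integral_add nn_integral_cmult)
  also have "\<dots> = ennreal (1 + real q) * (\<integral>\<^sup>+x. ennreal (cmod (f (par x) - f x)) \<partial>M)"
    by (subst nn_avg) (simp_all add: ennreal_plus distrib_right)
  finally show ?thesis .
qed

text \<open>On the whole Hardy space the extension is given by the kernel, not by a limiting procedure.\<close>

definition Z :: "('v \<Rightarrow> complex) \<Rightarrow> 'v \<Rightarrow> real" where
  "Z f = gradient adj (K f)"

text \<open>The factor \<open>1 + q\<close> arises because each edge is counted at its lower end, of mass \<open>w x\<close>, and at its upper end,
  of mass \<open>q w x\<close>.\<close>

definition C :: real where "C = (1 + real q) * 22"

lemma C_nonneg: "0 \<le> C"
  unfolding C_def by simp

lemma Z_nonneg: "0 \<le> Z f x"
  unfolding Z_def by (rule gradient_nonneg)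

lemma atom_est: "is_atom q adj lev a \<Longrightarrow> (\<integral>\<^sup>+x. ennreal (Z a x) \<partial>M) \<le> ennreal C"
  and atom_finite: "is_atom q adj lev a \<Longrightarrow> finite {x. a x \<noteq> 0}"
proof -
  have cz: "(\<exists>r. S = {r}) \<or> (\<exists>r h D. 1 \<le> h \<and> D = {d. h \<le> 2 * d \<and> d < 4 * h} \<and> S = (\<Union>d\<in>D. desc d r))"
    if S: "CZ_set adj lev S" for S
  proof -
    obtain R where "trapezoid_envelope adj lev R S" using S unfolding CZ_set_def by blast
    then show ?thesis
    proof cases
      case (degenerate r) then show ?thesis by blast
    next
      case (nondegenerate h r)
      define k where "k = nat h"
      have h: "h = int k" "1 \<le> k" using nondegenerate by (auto simp: k_def)
      have "S = (\<Union>d\<in>{d. k \<le> 2 * d \<and> d < 4 * k}. desc d r)" (is "S = ?U")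
      proof (intro set_eqI)
        fix x
        have dx: "(par ^^ n) x = r \<Longrightarrow> lev r - lev x = int n" for n using l_par_pow[of n x] by auto
        have "x \<in> S \<longleftrightarrow> (\<exists>n. (par ^^ n) x = r) \<and> real k / 2 \<le> real_of_int (lev r - lev x) \<and> lev r - lev x < 4 * int k"
          unfolding nondegenerate(2) h lies_below_iff by simp
        also have "\<dots> \<longleftrightarrow> (\<exists>n. (par ^^ n) x = r \<and> k \<le> 2 * n \<and> n < 4 * k)"
          by (auto simp: dx) (use dx in fastforce)+
        also have "\<dots> \<longleftrightarrow> x \<in> ?U" by (auto simp: desc_def)
        finally show "x \<in> S \<longleftrightarrow> x \<in> ?U" .
      qed
      then show ?thesis using h(2) by blast
    qed
  qed
  have fin: "finite S" if "CZ_set adj lev S" for S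
    using cz[OF that] by (auto simp: finite_desc)
  show af: "finite {x. a x \<noteq> 0}" if a: "is_atom q adj lev a" for a
  proof -
    obtain S where "CZ_set adj lev S" "\<forall>x. x \<notin> S \<longrightarrow> a x = 0" using a unfolding is_atom_def by blast
    then show ?thesis using fin[of S] by (auto intro: finite_subset[of _ S])
  qed
  show "(\<integral>\<^sup>+x. ennreal (Z a x) \<partial>M) \<le> ennreal C" if at: "is_atom q adj lev a" for a
  proof -
    obtain S where S: "CZ_set adj lev S" "\<And>x. x \<notin> S \<Longrightarrow> a x = 0" "\<And>x. cmod (a x) \<le> 1 / measure M S"
      and mean: "(\<integral>x. a x \<partial>M) = 0"
      using at unfolding is_atom_def by blast
    have "(\<integral>\<^sup>+x. ennreal (cmod (K a (par x) - K a x)) \<partial>M) \<le> 22"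
      using cz[OF S(1)]
    proof (elim disjE exE conjE)
      fix r assume r: "S = {r}"
      have "w r *\<^sub>R a r = 0"
        using integral_finite_support(2)[of "{r}" a] S(2) r mean by simp
      then have "a = (\<lambda>x. 0 * a x)" using w_pos[of r] S(2) r by (intro ext) (case_tac "x = r"; simp)
      then have "K a x = 0" for x
        using kernel_op_scale[OF finite_support_integrable[OF af[OF at]], of "\<lambda>i j. kappa (i + j)" 2 0 x] kappa_bound
        unfolding K_def by simp
      then show ?thesis by simp
    next
      fix r h D assume a: "1 \<le> h" "D = {d. h \<le> 2 * d \<and> d < 4 * h}" "S = (\<Union>d\<in>D. desc d r)"
      interpret tree_atom q par lev r h D S a
        by unfold_locales (use a S mean in auto)
      show ?thesis by (rule atom_bound)
    qed
    then have "(\<integral>\<^sup>+x. ennreal (Z a x) \<partial>M) \<le> ennreal (1 + real q) * 22"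
      unfolding Z_def nn_gradient by (rule mult_left_mono) simp
    also have "\<dots> = ennreal C" unfolding C_def by (simp add: ennreal_mult)
    finally show ?thesis .
  qed
qed

lemma atom_integrable: "is_atom q adj lev a \<Longrightarrow> integrable M a"
  by (rule finite_support_integrable[OF atom_finite])

lemma K_add: "integrable M f \<Longrightarrow> integrable M h \<Longrightarrow> K (\<lambda>x. f x + h x) x = K f x + K h x"
  unfolding K_def by (rule kernel_op_add) (auto intro: kappa_bound)

lemma K_scale: "integrable M f \<Longrightarrow> K (\<lambda>x. c * f x) x = c * K f x"
  unfolding K_def by (rule kernel_op_scale) (auto intro: kappa_bound)

lemma K_diff: "integrable M f \<Longrightarrow> integrable M h \<Longrightarrow> K (\<lambda>x. f x - h x) x = K f x - K h x"
  using K_add[of f "\<lambda>x. -1 * h x" x] K_scale[of h "-1" x] by simp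

lemma K_bound: "integrable M f \<Longrightarrow> cmod (K f x) \<le> 4 * ((\<integral>x. cmod (f x) \<partial>M) / w x)"
  using kernel_op_summable(3)[of f "\<lambda>i j. kappa (i + j)" 2 x] kappa_bound unfolding K_def by simp

lemma Z_add:
  assumes "integrable M f" "integrable M h"
  shows "Z (\<lambda>y. f y + h y) x \<le> Z f x + Z h x"
proof -
  have "cmod ((K f y + K h y) - (K f x + K h x)) \<le> cmod (K f y - K f x) + cmod (K h y - K h x)" for y
    using norm_triangle_ineq[of "K f y - K f x" "K h y - K h x"] by (simp add: algebra_simps)
  then show ?thesis
    unfolding Z_def gradient_def K_add[OF assms] sum.distrib[symmetric] by (intro sum_mono)
qed

lemma Z_scale:
  assumes "integrable M f" shows "Z (\<lambda>y. c * f y) x = cmod c * Z f x"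
  unfolding Z_def gradient_def K_scale[OF assms] sum_distrib_left
  by (intro sum.cong refl) (simp flip: right_diff_distrib norm_mult)

lemma Z_sum:
  fixes c :: "nat \<Rightarrow> complex"
  assumes "\<And>j. is_atom q adj lev (a j)"
  shows "Z (\<lambda>x. \<Sum>j<n. c j * a j x) x \<le> (\<Sum>j<n. cmod (c j) * Z (a j) x)"
proof (induction n)
  case 0
  have "Z (\<lambda>x. 0 * a 0 x) x = cmod 0 * Z (a 0) x" by (rule Z_scale[OF atom_integrable[OF assms]])
  then show ?case by simp
next
  case (Suc n)
  have i: "integrable M (\<lambda>x. c j * a j x)" for j using atom_integrable[OF assms] by simp
  have "Z (\<lambda>x. (\<Sum>j<n. c j * a j x) + c n * a n x) x \<le> Z (\<lambda>x. \<Sum>j<n. c j * a j x) x + Z (\<lambda>x. c n * a n x) x"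
    by (rule Z_add) (auto intro: i)
  then show ?case using Suc Z_scale[OF atom_integrable[OF assms], of "c n" n x] by simp
qed

text \<open>Evaluation of \<open>K\<close> at a vertex is continuous on \<open>L\<^sup>1\<close>. Hence \<open>Z f\<close> is the pointwise limit of \<open>Z\<close> applied to the partial
  sums of the decomposition, and the uniform bound on atoms passes to \<open>f\<close> by Fatou's lemma.\<close>

lemma Z_decomposition:
  assumes f: "integrable M f" and dec: "atomic_decomposition q adj lev f c a"
  shows "(\<integral>\<^sup>+x. ennreal (Z f x) \<partial>M) \<le> ennreal (C * (\<Sum>j. cmod (c j)))"
proof -
  have at: "is_atom q adj lev (a j)" for j using dec unfolding atomic_decomposition_def by blast
  have sc: "summable (\<lambda>j. cmod (c j))" using dec unfolding atomic_decomposition_def by blast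
  define s where "s n x = (\<Sum>j<n. c j * a j x)" for n x
  have si: "integrable M (s n)" for n unfolding s_def[abs_def] using atom_integrable[OF at] by simp
  have conv: "(\<lambda>n. \<integral>x. cmod (f x - s n x) \<partial>M) \<longlonglongrightarrow> 0"
    using dec unfolding atomic_decomposition_def s_def by blast
  have Kc: "(\<lambda>n. K (s n) x) \<longlonglongrightarrow> K f x" for x
  proof -
    have "(\<lambda>n. K f x - K (s n) x) \<longlonglongrightarrow> 0"
    proof (rule Lim_null_comparison)
      show "\<forall>\<^sub>F n in sequentially. norm (K f x - K (s n) x) \<le> 4 * ((\<integral>x. cmod (f x - s n x) \<partial>M) / w x)"
        using K_bound[of "\<lambda>x. f x - s _ x" x] f si by (intro always_eventually allI) (simp add: K_diff[symmetric])
      have "(\<lambda>n. 4 * ((\<integral>x. cmod (f x - s n x) \<partial>M) / w x)) \<longlonglongrightarrow> 4 * (0 / w x)"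
        using w_pos[of x] by (intro tendsto_intros conv) auto
      then show "(\<lambda>n. 4 * ((\<integral>x. cmod (f x - s n x) \<partial>M) / w x)) \<longlonglongrightarrow> 0" by simp
    qed
    from tendsto_diff[OF tendsto_const[of "K f x"] this] show ?thesis by simp
  qed
  have Zc: "(\<lambda>n. Z (s n) x) \<longlonglongrightarrow> Z f x" for x
    unfolding Z_def gradient_def by (intro tendsto_intros Kc)
  have sn: "(\<integral>\<^sup>+x. ennreal (Z (s n) x) \<partial>M) \<le> ennreal (C * (\<Sum>j. cmod (c j)))" for n
  proof -
    have "(\<integral>\<^sup>+x. ennreal (Z (s n) x) \<partial>M) \<le> (\<integral>\<^sup>+x. (\<Sum>j<n. ennreal (cmod (c j)) * ennreal (Z (a j) x)) \<partial>M)"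
    proof (rule nn_integral_mono)
      fix x
      have "ennreal (Z (s n) x) \<le> ennreal (\<Sum>j<n. cmod (c j) * Z (a j) x)"
        unfolding s_def by (intro ennreal_leI Z_sum at)
      also have "\<dots> = (\<Sum>j<n. ennreal (cmod (c j)) * ennreal (Z (a j) x))"
        using Z_nonneg by (simp add: sum_ennreal[symmetric] ennreal_mult)
      finally show "ennreal (Z (s n) x) \<le> (\<Sum>j<n. ennreal (cmod (c j)) * ennreal (Z (a j) x))" .
    qed
    also have "\<dots> = (\<Sum>j<n. ennreal (cmod (c j)) * (\<integral>\<^sup>+x. ennreal (Z (a j) x) \<partial>M))"
      by (simp add: nn_integral_sum nn_integral_cmult)
    also have "\<dots> \<le> (\<Sum>j<n. ennreal (cmod (c j)) * ennreal C)"
      by (intro sum_mono mult_left_mono atom_est at) simp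
    also have "\<dots> = ennreal (\<Sum>j<n. cmod (c j) * C)"
      using C_nonneg by (simp add: sum_ennreal[symmetric] ennreal_mult)
    also have "\<dots> \<le> ennreal (C * (\<Sum>j. cmod (c j)))"
    proof (rule ennreal_leI)
      have "(\<Sum>j<n. cmod (c j)) \<le> (\<Sum>j. cmod (c j))" by (rule sum_le_suminf[OF sc]) auto
      from mult_right_mono[OF this C_nonneg]
      show "(\<Sum>j<n. cmod (c j) * C) \<le> C * (\<Sum>j. cmod (c j))"
        by (simp only: sum_distrib_left mult.commute)
    qed
    finally show ?thesis .
  qed
  have "(\<integral>\<^sup>+x. ennreal (Z f x) \<partial>M) = (\<integral>\<^sup>+x. liminf (\<lambda>n. ennreal (Z (s n) x)) \<partial>M)"
    by (intro nn_integral_cong lim_imp_Liminf[symmetric] tendsto_ennrealI Zc) simp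
  also have "\<dots> \<le> liminf (\<lambda>n. \<integral>\<^sup>+x. ennreal (Z (s n) x) \<partial>M)" by (rule nn_integral_liminf) simp
  also have "\<dots> \<le> liminf (\<lambda>n. ennreal (C * (\<Sum>j. cmod (c j))))"
    by (intro Liminf_mono always_eventually allI sn)
  finally show ?thesis by (simp add: Liminf_const)
qed

lemma Z_hardy:
  assumes "f \<in> hardy_space q adj lev"
  shows "integrable M (Z f)" "(\<integral>x. \<bar>Z f x\<bar> \<partial>M) \<le> C * hardy_norm q adj lev f"
proof -
  have f: "integrable M f" and ex: "\<exists>c a. atomic_decomposition q adj lev f c a"
    using assms unfolding hardy_space_def by auto
  let ?A = "{\<Sum>j. cmod (c j) | c. \<exists>a. atomic_decomposition q adj lev f c a}"
  have ne: "?A \<noteq> {}" using ex by auto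
  from ex obtain c a where "atomic_decomposition q adj lev f c a" by blast
  from Z_decomposition[OF f this] show Zi: "integrable M (Z f)"
    using Z_nonneg by (intro integrableI_bounded) (auto simp: le_less_trans)
  have le: "(\<integral>x. \<bar>Z f x\<bar> \<partial>M) \<le> C * S" if S_in: "S \<in> ?A" for S
  proof -
    obtain c a where S: "S = (\<Sum>j. cmod (c j))" and dec: "atomic_decomposition q adj lev f c a"
      using S_in by blast
    have "0 \<le> S" unfolding S using dec by (intro suminf_nonneg) (auto simp: atomic_decomposition_def)
    have "ennreal (\<integral>x. \<bar>Z f x\<bar> \<partial>M) = (\<integral>\<^sup>+x. ennreal (Z f x) \<partial>M)"
      using Zi Z_nonneg by (subst nn_integral_eq_integral) auto
    also have "\<dots> \<le> ennreal (C * S)" unfolding S by (rule Z_decomposition[OF f dec])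
    finally show ?thesis using C_nonneg \<open>0 \<le> S\<close> by simp
  qed
  show "(\<integral>x. \<bar>Z f x\<bar> \<partial>M) \<le> C * hardy_norm q adj lev f"
  proof (cases "C = 0")
    case True
    then show ?thesis using le ne by fastforce
  next
    case False
    then have "C > 0" using C_nonneg by simp
    then have "(\<integral>x. \<bar>Z f x\<bar> \<partial>M) / C \<le> Inf ?A"
      using le by (intro cInf_greatest ne) (simp add: pos_divide_le_eq mult.commute)
    then show ?thesis unfolding hardy_norm_def using \<open>C > 0\<close> by (simp add: pos_divide_le_eq mult.commute)
  qed
qed

lemma Z_riesz:
  assumes "finite {x. f x \<noteq> 0}" shows "Z f = riesz_transform q adj lev f"
  unfolding Z_def riesz_transform_def laplacian_eq inv_sqrt_lap[OF assms] ..

lemma bounded_Z: "bounded_sublinear_H1_L1 q adj lev Z"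
  unfolding bounded_sublinear_H1_L1_def
proof (intro conjI ballI allI exI[of _ C])
  have i: "f \<in> hardy_space q adj lev \<Longrightarrow> integrable M f" for f unfolding hardy_space_def by simp
  fix f assume f: "f \<in> hardy_space q adj lev"
  show "Z (\<lambda>y. c * f y) x = cmod c * Z f x" for c x by (rule Z_scale[OF i[OF f]])
  show "integrable M (Z f)" "(\<integral>x. \<bar>Z f x\<bar> \<partial>M) \<le> C * hardy_norm q adj lev f"
    using Z_hardy[OF f] by auto
  fix h assume h: "h \<in> hardy_space q adj lev"
  show "Z (\<lambda>y. f y + h y) x \<le> Z f x + Z h x" for x by (rule Z_add[OF i[OF f] i[OF h]])
qed

end

theorem mainTheorem5:
  fixes q :: nat
    and adj :: "'v \<Rightarrow> 'v \<Rightarrow> bool"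
    and g :: "'v set"
    and N :: "'v \<Rightarrow> int"
  assumes "q \<ge> 2"
    and "homogeneous_tree q adj"
    and "doubly_infinite_geodesic adj g"
    and "\<forall>x\<in>g. \<forall>y\<in>g. \<bar>N x - N y\<bar> = int (graph_dist adj x y)"
  shows "\<exists>Z. bounded_sublinear_H1_L1 q adj (level adj g N) Z \<and>
           (\<forall>f\<in>hardy_space q adj (level adj g N).
              finite {x. f x \<noteq> 0} \<longrightarrow> Z f = riesz_transform q adj (level adj g N) f)"
proof -
  interpret riesz_tree adj q g N
  proof
    show "adj x y \<Longrightarrow> adj y x" "\<not> adj x x" "\<not> is_cycle adj xs" "adj\<^sup>*\<^sup>* x y" "card {y. adj x y} = q + 1" for x y xs
      using assms(2) unfolding homogeneous_tree_def by (auto dest: sympD irreflpD)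
    show "g \<noteq> {}" "x \<in> g \<Longrightarrow> y \<in> g \<Longrightarrow> (\<lambda>u v. u \<in> g \<and> v \<in> g \<and> adj u v)\<^sup>*\<^sup>* x y"
      "x \<in> g \<Longrightarrow> card {y \<in> g. adj x y} = 2" for x y
      using assms(3) unfolding doubly_infinite_geodesic_def by auto
    show "x \<in> g \<Longrightarrow> y \<in> g \<Longrightarrow> \<bar>N x - N y\<bar> = int (graph_dist adj x y)" for x y
      using assms(4) by auto
    show "2 \<le> q" by (rule assms(1))
  qed
  show ?thesis using bounded_Z Z_riesz by blast
qed

end
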